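(* Let $G$ be a finite complex reflection group acting on $\mathbb C^d$, let $\Omega\subseteq\mathbb C^d$ be a bounded $G$-invariant domain, let $\boldsymbol\theta$ be a basic polynomial map associated to $G$, let $\widetilde\omega:\boldsymbol\theta(\Omega)\to(0,\infty)$ be continuous and let $\omega=\widetilde\omega\circ\boldsymbol\theta$. For each one-dimensional representation $\varrho$ of $G$, the weighted Bergman projections $P^{\omega_\varrho}_{\boldsymbol\theta(\Omega)}:L^2_{\omega_\varrho}(\boldsymbol\theta(\Omega))\to\mathbb A^2_{\omega_\varrho}(\boldsymbol\theta(\Omega))$ and $P^\omega_\Omega:L^2_\omega(\Omega)\to\mathbb A^2_\omega(\Omega)$ are related by $$P^\omega_\Omega\big(\ell_\varrho\,(\phi\circ\boldsymbol\theta)\big)=\ell_\varrho\,\big((P^{\omega_\varrho}_{\boldsymbol\theta(\Omega)}\phi)\circ\boldsymbol\theta\big),\qquad\phi\in L^2_{\omega_\varrho}(\boldsymbol\theta(\Omega)).$$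
   Context: A complex reflection on $\mathbb C^d$ is a linear map $\sigma$ of finite order in $GL(d,\mathbb C)$ such that $\mathrm{id}-\sigma$ has rank $1$. A finite complex reflection group is a finite subgroup $G\subset GL(d,\mathbb C)$ generated by complex reflections. $G$ acts on $\mathbb C^d$ by $\sigma\cdot\boldsymbol z=\sigma^{-1}\boldsymbol z$; a domain $\Omega$ is $G$-invariant if it is preserved by this action. A basic polynomial map associated to $G$ is $\boldsymbol\theta=(\theta_1,\dots,\theta_d):\mathbb C^d\to\mathbb C^d$, where $\theta_1,\dots,\theta_d$ are algebraically independent homogeneous polynomials with $\mathbb C[z_1,\dots,z_d]^G=\mathbb C[\theta_1,\dots,\theta_d]$ (these exist by the Chevalley–Shephard–Todd theorem). For a $G$-invariant domain $\Omega$, $\boldsymbol\theta(\Omega)$ is a domain. $J_{\boldsymbol\theta}$ is the determinant of the complex Jacobian matrix of $\boldsymbol\theta$. The polynomial $\ell_\varrho$: let $H_1,\dots,H_t$ be the distinct reflecting hyperplanes of $G$ (the hyperplanes $\ker(\mathrm{id}-\sigma)$, $\sigma\in G$ a complex reflection), $\ell_i$ a linear form with zero set $H_i$, $G_i=\langle a_i\rangle$ the cyclic subgroup of elements of $G$ acting trivially on $H_i$. For a one-dimensional representation $\varrho$, let $c_i$ be the least non-negative integer with $\varrho(a_i)=(\det a_i)^{c_i}$, and set $\ell_\varrho=\prod_{i=1}^t\ell_i^{c_i}$. For a domain $D$ and weight $\nu>0$ (continuous, defined on $D$ off a closed set of measure zero), $L^2_\nu(D)=L^2(D,\nu\,dV)$,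 $\mathbb A^2_\nu(D)$ is its closed subspace of holomorphic functions on $D$, and the weighted Bergman projection $P^\nu_D:L^2_\nu(D)\to\mathbb A^2_\nu(D)$ is $(P^\nu_D\phi)(\boldsymbol z)=\int_D\phi(\boldsymbol w)\mathcal B_\nu(\boldsymbol z,\boldsymbol w)\nu(\boldsymbol w)\,dV(\boldsymbol w)$, where $\mathcal B_\nu$ is the reproducing kernel of $\mathbb A^2_\nu(D)$ (i.e. the orthogonal projection). $dV$ is Lebesgue measure normalized on $\Omega$; the same multiple of Lebesgue measure is used on $\boldsymbol\theta(\Omega)$. The weight $\omega_\varrho$ is defined on $\boldsymbol\theta(\Omega)\setminus\boldsymbol\theta(\bigcup_iH_i)$ by $\omega_\varrho(\boldsymbol\theta(\boldsymbol z))=\frac{|\ell_\varrho(\boldsymbol z)|^2}{|J_{\boldsymbol\theta}(\boldsymbol z)|^2}\,\widetilde\omega(\boldsymbol\theta(\boldsymbol z))$ (well defined). *)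

theory Defs
  imports
    "HOL-Analysis.Analysis"
    "HOL-Library.Poly_Mapping"
    "HOL-Algebra.Generated_Groups"
begin

section \<open>Finite complex reflection groups\<close>

definition GL :: "(complex^'d^'d) monoid" where
  "GL = \<lparr>carrier = {A. invertible A}, mult = (**), one = mat 1\<rparr>"

definition complex_reflection :: "complex^'d^'d \<Rightarrow> bool" where
  "complex_reflection \<sigma> \<longleftrightarrow>
     \<sigma> \<in> carrier GL \<and> (\<exists>n::nat. n > 0 \<and> \<sigma> [^]\<^bsub>GL\<^esub> n = \<one>\<^bsub>GL\<^esub>) \<and> rank (mat 1 - \<sigma>) = 1"

definition finite_reflection_group :: "(complex^'d^'d) set \<Rightarrow> bool" where
  "finite_reflection_group G \<longleftrightarrow>
     subgroup G GL \<and> finite G \<and> generate GL {\<sigma> \<in> G. complex_reflection \<sigma>} = G"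

definition act :: "complex^'d^'d \<Rightarrow> complex^'d \<Rightarrow> complex^'d" where
  "act \<sigma> z = matrix_inv \<sigma> *v z"

definition domain_set :: "(complex^'d) set \<Rightarrow> bool" where
  "domain_set D \<longleftrightarrow> open D \<and> connected D \<and> D \<noteq> {}"

definition invariant_set :: "(complex^'d^'d) set \<Rightarrow> (complex^'d) set \<Rightarrow> bool" where
  "invariant_set G D \<longleftrightarrow> (\<forall>\<sigma>\<in>G. act \<sigma> ` D = D)"

definition one_dim_rep :: "(complex^'d^'d) set \<Rightarrow> (complex^'d^'d \<Rightarrow> complex) \<Rightarrow> bool" where
  "one_dim_rep G \<rho> \<longleftrightarrow>
     \<rho> \<in> hom (GL\<lparr>carrier := G\<rparr>) \<lparr>carrier = - {0}, mult = (*), one = 1\<rparr>"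


section \<open>Polynomials and basic polynomial maps\<close>

text \<open>
  Polynomials over the complex numbers in variables indexed by a finite type: finitely supported
  families of coefficients, indexed by exponent vectors.
\<close>

type_synonym 'd cpoly = "('d \<Rightarrow>\<^sub>0 nat) \<Rightarrow>\<^sub>0 complex"

text \<open>
  Insertion of a family \<open>x\<close> of elements of a commutative ring, with \<open>c\<close> the embedding of the
  coefficients: evaluation at points and substitution of polynomials are both instances.
\<close>

definition insertion :: "(complex \<Rightarrow> 'b) \<Rightarrow> ('d::finite \<Rightarrow> 'b) \<Rightarrow> 'd cpoly \<Rightarrow> 'b::comm_ring_1" where
  "insertion c x p =
     (\<Sum>m\<in>Poly_Mapping.keys p.
        c (Poly_Mapping.lookup p m) * (\<Prod>i\<in>UNIV. x i ^ Poly_Mapping.lookup m i))"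

definition poly_eval :: "'d::finite cpoly \<Rightarrow> complex^'d \<Rightarrow> complex" where
  "poly_eval p z = insertion (\<lambda>a. a) (\<lambda>i. z $ i) p"

definition poly_subst :: "('d::finite \<Rightarrow> 'd cpoly) \<Rightarrow> 'd cpoly \<Rightarrow> 'd cpoly" where
  "poly_subst \<theta> q = insertion (Poly_Mapping.single 0) \<theta> q"

definition homogeneous :: "'d::finite cpoly \<Rightarrow> bool" where
  "homogeneous p \<longleftrightarrow>
     (\<exists>n::nat. \<forall>m\<in>Poly_Mapping.keys p. (\<Sum>i\<in>UNIV. Poly_Mapping.lookup m i) = n)"

definition algebraically_independent :: "('d::finite \<Rightarrow> 'd cpoly) \<Rightarrow> bool" where
  "algebraically_independent \<theta> \<longleftrightarrow> (\<forall>q. poly_subst \<theta> q = 0 \<longrightarrow> q = 0)"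

definition invariant_polys :: "(complex^'d^'d) set \<Rightarrow> ('d::finite cpoly) set" where
  "invariant_polys G = {p. \<forall>\<sigma>\<in>G. \<forall>z. poly_eval p (act \<sigma> z) = poly_eval p z}"

definition basic_polys :: "(complex^'d^'d) set \<Rightarrow> ('d::finite \<Rightarrow> 'd cpoly) \<Rightarrow> bool" where
  "basic_polys G \<theta> \<longleftrightarrow>
     (\<forall>i. homogeneous (\<theta> i)) \<and> algebraically_independent \<theta> \<and>
     invariant_polys G = range (poly_subst \<theta>)"

definition basic_polynomial_map ::
  "(complex^'d^'d) set \<Rightarrow> (complex^'d \<Rightarrow> complex^'d) \<Rightarrow> bool" where
  "basic_polynomial_map G \<theta> \<longleftrightarrow>
     (\<exists>\<theta>'. basic_polys G \<theta>' \<and> \<theta> = (\<lambda>z. \<chi> i. poly_eval (\<theta>' i) z))"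

text \<open>The entries of the matrix are the complex partial derivatives.\<close>

definition complex_jacobian :: "(complex^'d \<Rightarrow> complex^'d) \<Rightarrow> complex^'d \<Rightarrow> complex" where
  "complex_jacobian \<theta> z = det (\<chi> i j. deriv (\<lambda>t. \<theta> (z + t *s axis j 1) $ i) 0)"


section \<open>Reflecting hyperplanes and the polynomial of a one-dimensional representation\<close>

definition reflecting_hyperplanes :: "(complex^'d^'d) set \<Rightarrow> (complex^'d) set set" where
  "reflecting_hyperplanes G =
     {{z. (mat 1 - \<sigma>) *v z = 0} | \<sigma>. \<sigma> \<in> G \<and> complex_reflection \<sigma>}"

definition pointwise_stabilizer ::
  "(complex^'d^'d) set \<Rightarrow> (complex^'d) set \<Rightarrow> (complex^'d^'d) set" where
  "pointwise_stabilizer G H = {\<sigma> \<in> G. \<forall>z\<in>H. act \<sigma> z = z}"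

text \<open>
  A choice of linear form \<open>l H\<close> and of generator \<open>a H\<close> for every reflecting hyperplane \<open>H\<close>.
\<close>

definition defining_forms ::
  "(complex^'d^'d) set \<Rightarrow> ((complex^'d) set \<Rightarrow> complex^'d \<Rightarrow> complex) \<Rightarrow> bool" where
  "defining_forms G l \<longleftrightarrow>
     (\<forall>H\<in>reflecting_hyperplanes G.
        Vector_Spaces.linear (*s) (*) (l H) \<and> {z. l H z = 0} = H)"

definition stabilizer_generators ::
  "(complex^'d^'d) set \<Rightarrow> ((complex^'d) set \<Rightarrow> complex^'d^'d) \<Rightarrow> bool" where
  "stabilizer_generators G a \<longleftrightarrow>
     (\<forall>H\<in>reflecting_hyperplanes G.
        a H \<in> G \<and> generate GL {a H} = pointwise_stabilizer G H)"

definition rep_exponent :: "(complex^'d^'d \<Rightarrow> complex) \<Rightarrow> complex^'d^'d \<Rightarrow> nat" where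
  "rep_exponent \<rho> b = (LEAST c. \<rho> b = det b ^ c)"

definition rep_poly ::
  "(complex^'d^'d) set \<Rightarrow> ((complex^'d) set \<Rightarrow> complex^'d \<Rightarrow> complex) \<Rightarrow>
   ((complex^'d) set \<Rightarrow> complex^'d^'d) \<Rightarrow> (complex^'d^'d \<Rightarrow> complex) \<Rightarrow> complex^'d \<Rightarrow> complex" where
  "rep_poly G l a \<rho> z = (\<Prod>H\<in>reflecting_hyperplanes G. l H z ^ rep_exponent \<rho> (a H))"


section \<open>Weighted Bergman spaces and projections\<close>

text \<open>
  \<open>V\<close> is the underlying volume measure, on the whole space; only the restriction of functions,
  weights and kernels to \<open>D\<close> matters.  Elements of \<open>L2\<close> are functions, not classes of functions
  that agree almost everywhere.
\<close>

definition L2 ::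
  "(complex^'d) measure \<Rightarrow> (complex^'d) set \<Rightarrow> (complex^'d \<Rightarrow> real) \<Rightarrow> (complex^'d \<Rightarrow> complex) set" where
  "L2 V D \<nu> = {f. set_borel_measurable V D f \<and>
                  set_integrable V D (\<lambda>w. (cmod (f w))\<^sup>2 * \<nu> w)}"

text \<open>Holomorphy in several variables: Frechet differentiability with complex-linear derivative.\<close>

definition holomorphic_fun :: "(complex^'d) set \<Rightarrow> (complex^'d \<Rightarrow> complex) \<Rightarrow> bool" where
  "holomorphic_fun D f \<longleftrightarrow>
     (\<forall>z\<in>D. \<exists>f'. (f has_derivative f') (at z) \<and> Vector_Spaces.linear (*s) (*) f')"

definition A2 ::
  "(complex^'d) measure \<Rightarrow> (complex^'d) set \<Rightarrow> (complex^'d \<Rightarrow> real) \<Rightarrow> (complex^'d \<Rightarrow> complex) set" where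
  "A2 V D \<nu> = {f \<in> L2 V D \<nu>. holomorphic_fun D f}"

definition reproducing_kernel ::
  "(complex^'d) measure \<Rightarrow> (complex^'d) set \<Rightarrow> (complex^'d \<Rightarrow> real) \<Rightarrow>
   (complex^'d \<Rightarrow> complex^'d \<Rightarrow> complex) \<Rightarrow> bool" where
  "reproducing_kernel V D \<nu> K \<longleftrightarrow>
     (\<forall>z\<in>D. (\<lambda>w. K w z) \<in> A2 V D \<nu>) \<and>
     (\<forall>f\<in>A2 V D \<nu>. \<forall>z\<in>D.
        f z = (LINT w:D|V. f w * cnj (K w z) * complex_of_real (\<nu> w)))"

text \<open>A reproducing kernel is unique on \<open>D \<times> D\<close>; the choice only concerns values elsewhere.\<close>

definition bergman_kernel ::
  "(complex^'d) measure \<Rightarrow> (complex^'d) set \<Rightarrow> (complex^'d \<Rightarrow> real) \<Rightarrow>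
   complex^'d \<Rightarrow> complex^'d \<Rightarrow> complex" where
  "bergman_kernel V D \<nu> = (SOME K. reproducing_kernel V D \<nu> K)"

definition bergman_projection ::
  "(complex^'d) measure \<Rightarrow> (complex^'d) set \<Rightarrow> (complex^'d \<Rightarrow> real) \<Rightarrow>
   (complex^'d \<Rightarrow> complex) \<Rightarrow> complex^'d \<Rightarrow> complex" where
  "bergman_projection V D \<nu> \<phi> z =
     (LINT w:D|V. \<phi> w * bergman_kernel V D \<nu> z w * complex_of_real (\<nu> w))"

text \<open>Lebesgue measure on the whole space, scaled so that \<open>D\<close> has measure 1.\<close>

definition normalized_volume :: "(complex^'d) set \<Rightarrow> (complex^'d) measure" where
  "normalized_volume D = scale_measure (1 / emeasure lebesgue D) lebesgue"

text \<open>
  The weight on \<open>\<theta> ` D\<close> induced by \<open>p = \<ell>\<^sub>\<rho>\<close>: the value at \<open>u\<close> is computed at any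
  preimage \<open>z\<close> of \<open>u\<close>, off the images of the reflecting hyperplanes.  The value 0 elsewhere is a
  dummy.
\<close>

definition rep_weight ::
  "(complex^'d^'d) set \<Rightarrow> (complex^'d) set \<Rightarrow> (complex^'d \<Rightarrow> complex^'d) \<Rightarrow> (complex^'d \<Rightarrow> complex) \<Rightarrow>
   (complex^'d \<Rightarrow> real) \<Rightarrow> complex^'d \<Rightarrow> real" where
  "rep_weight G D \<theta> p \<omega> u =
     (if u \<in> \<theta> ` D - \<theta> ` (\<Union>(reflecting_hyperplanes G))
      then THE r. \<forall>z\<in>D. \<theta> z = u \<longrightarrow>
             r = (cmod (p z))\<^sup>2 / (cmod (complex_jacobian \<theta> z))\<^sup>2 * \<omega> (\<theta> z)
      else 0)"

end

theory Submission
  imports Defs "HOL-Complex_Analysis.Complex_Analysis"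
begin

text \<open>The lift \<open>h \<mapsto> \<l> (h \<circ> \<theta>)\<close> is, up to the factor \<open>card G\<close>, an isometry from the weighted \<open>L2\<close> space
  over \<open>\<theta> ` \<Omega>\<close> to that over \<open>\<Omega>\<close>: the fibres of \<open>\<theta>\<close> are the orbits of \<open>G\<close>, almost all of them have \<open>card G\<close>
  points, and the real Jacobian determinant \<open>|J|\<^sup>2\<close> cancels against the one in the denominator of the
  weight (\<open>change_of_variables_theta\<close>, \<open>lift_integral\<close>).  A lift transforms under \<open>G\<close> by the character
  \<open>\<chi>\<^sub>l\<close> of \<open>\<l>\<close>.

  Conversely, every holomorphic function \<open>F\<close> on \<open>\<Omega>\<close> that transforms by \<open>\<chi>\<^sub>l\<close> is the lift of a
  holomorphic function.  At a reflecting hyperplane \<open>H\<close> with form \<open>l\<close> the generator of the stabilizer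
  multiplies \<open>F\<close> by \<open>\<epsilon>\<^sup>c\<close>, where \<open>\<epsilon>\<close> is its determinant and \<open>c\<close> the exponent of \<open>l\<close> in \<open>\<l>\<close>.  As \<open>c\<close> is
  smaller than the order of \<open>\<epsilon>\<close>, this forces \<open>F\<close> to be divisible by \<open>l\<^sup>c\<close>
  (\<open>relative_invariant_divisible\<close>).  The quotient \<open>F / \<l>\<close> is an invariant holomorphic function and descends to
  \<open>\<theta> ` \<Omega>\<close>: the map \<open>\<theta>\<close> is open, a local inverse exists where its Jacobian does not vanish, and the
  image of the exceptional set is contained in the zero set of a polynomial, whose singularities are
  removable for continuous functions (\<open>descend_holomorphic\<close>).

  Both Bergman kernels exist because point evaluations are locally bounded on the weighted Bergman spaces.
  The weight downstairs may vanish on the image of the hyperplanes, which again lies in the zero set of a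
  polynomial, and the maximum modulus principle carries the bound across this set
  (\<open>point_evaluation_bound\<close>).

  The projection at \<open>z\<close> pairs a function with the kernel \<open>k = K(\<cdot>, z)\<close>.  Pairing a lift with \<open>k\<close>
  or with the average of \<open>k\<close> over \<open>G\<close> against the character gives the same value (\<open>ip_average\<close>).  The
  average is a lift, and the reproducing property identifies it as the lift of a multiple of the kernel of
  \<open>\<theta> ` \<Omega>\<close> at \<open>\<theta> z\<close> (\<open>kernel_average\<close>).  The isometry then turns the pairing upstairs into the pairing downstairs.\<close>

(* The symbol $ is kept for the components of vectors. *)
no_notation fps_nth (infixl "$" 75)

section \<open>Holomorphic functions of several complex variables\<close>

lemma norm_vector_smult: "norm (t *s (v::complex^'d)) = cmod t * norm v"
  by (simp add: norm_vec_def norm_mult L2_set_right_distrib)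

lemma bounded_linear_smult_left: "bounded_linear (\<lambda>t. t *s (v::complex^'d))"
  by (rule linear_conv_bounded_linear[THEN iffD1], rule linearI)
     (simp_all add: vec_eq_iff algebra_simps)

lemma continuous_on_smult_left [continuous_intros]:
  "continuous_on S f \<Longrightarrow> continuous_on S (\<lambda>t. f t *s (v::complex^'d))"
  using bounded_linear.continuous_on[OF bounded_linear_smult_left] by blast

lemma holomorphic_fun_field_derivative_line:
  fixes v :: "complex^'d"
  assumes "(f has_derivative f') (at (z + t *s v))" "Vector_Spaces.linear (*s) (*) f'"
  shows "((\<lambda>s. f (z + s *s v)) has_field_derivative f' v) (at t)"
proof -
  have "((\<lambda>s. z + s *s v) has_derivative (\<lambda>s. s *s v)) (at t)"
    using has_derivative_add[OF has_derivative_const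
        bounded_linear_imp_has_derivative[OF bounded_linear_smult_left[of v]], of z "at t"] by simp
  from has_derivative_compose[OF this assms(1)]
  have "((\<lambda>s. f (z + s *s v)) has_derivative (\<lambda>s. f' (s *s v))) (at t)" .
  moreover have "f' (s *s v) = f' v * s" for s
    using assms(2) by (simp add: Vector_Spaces.linear_iff mult.commute)
  ultimately show ?thesis
    by (simp add: has_field_derivative_def)
qed

lemma holomorphic_fun_imp_continuous_on:
  "holomorphic_fun D f \<Longrightarrow> continuous_on D f"
  unfolding holomorphic_fun_def
  by (meson continuous_at_imp_continuous_on has_derivative_continuous)

lemma holomorphic_fun_line:
  assumes "holomorphic_fun D f"
  shows "(\<lambda>t. f (z + t *s v)) holomorphic_on {t. z + t *s v \<in> D}"
proof -
  have "(\<lambda>t. f (z + t *s v)) field_differentiable (at t)" if "z + t *s v \<in> D" for t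
    using assms holomorphic_fun_field_derivative_line that
    unfolding holomorphic_fun_def field_differentiable_def by blast
  then show ?thesis
    unfolding holomorphic_on_def by (auto intro: field_differentiable_at_within)
qed

lemma open_line_slice: "open D \<Longrightarrow> open {t. z + t *s (v::complex^'d) \<in> D}"
  using continuous_open_preimage[of UNIV "\<lambda>t. z + t *s v" D]
  by (simp add: vimage_def continuous_on_add continuous_on_smult_left)

text \<open>Cauchy's estimate on a disc of fixed radius, applied to the difference of \<open>f\<close> on two parallel
  lines, bounds the difference of the derivatives by the difference of the values, which is small by
  uniform continuity.\<close>

lemma partial_derivative_continuous:
  fixes f :: "complex^'d \<Rightarrow> complex"
  assumes D: "open D" and cf: "continuous_on D f" and z0: "z0 \<in> D" and v: "norm v = 1"
    and hol: "\<And>z. z \<in> D \<Longrightarrow> (\<lambda>t. f (z + t *s v)) field_differentiable (at 0)"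
  shows "isCont (\<lambda>z. deriv (\<lambda>t. f (z + t *s v)) 0) z0"
    and "\<And>z t. z + t *s v \<in> D \<Longrightarrow>
       ((\<lambda>t. f (z + t *s v)) has_field_derivative deriv (\<lambda>s. f ((z + t *s v) + s *s v)) 0) (at t)"
proof -
  define p where "p = (\<lambda>z. deriv (\<lambda>t. f (z + t *s v)) 0)"
  show A: "((\<lambda>t. f (z + t *s v)) has_field_derivative deriv (\<lambda>s. f ((z + t *s v) + s *s v)) 0) (at t)"
    if "z + t *s v \<in> D" for z t
  proof -
    have "((\<lambda>s. f ((z + t *s v) + s *s v)) has_field_derivative p (z + t *s v)) (at 0)"
      unfolding p_def using hol[OF that] field_differentiable_derivI by blast
    moreover have "(\<lambda>s. f ((z + t *s v) + s *s v)) = (\<lambda>s. (\<lambda>s. f (z + s *s v)) (s + t))"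
      by (rule ext, rule arg_cong[of _ _ f]) (simp add: vec_eq_iff algebra_simps)
    ultimately have "((\<lambda>s. (\<lambda>s. f (z + s *s v)) (s + t)) has_field_derivative p (z + t *s v)) (at 0)"
      by metis
    then show ?thesis
      unfolding p_def using DERIV_shift[of "\<lambda>s. f (z + s *s v)" _ 0 t] by simp
  qed
  show "isCont (\<lambda>z. deriv (\<lambda>t. f (z + t *s v)) 0) z0"
    unfolding p_def[symmetric] continuous_at_eps_delta
  proof (intro allI impI)
    fix e :: real assume e: "e > 0"
    obtain R where R: "R > 0" "cball z0 R \<subseteq> D"
      using D z0 open_contains_cball by blast
    define r where "r = R / 2"
    have r: "r > 0" "2 * r = R" using R by (auto simp: r_def)
    have uc: "uniformly_continuous_on (cball z0 R) f"
      by (rule compact_uniformly_continuous) (use R cf continuous_on_subset in auto)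
    obtain d0 where d0: "d0 > 0"
      "\<And>x y. x \<in> cball z0 R \<Longrightarrow> y \<in> cball z0 R \<Longrightarrow> dist x y < d0 \<Longrightarrow> dist (f x) (f y) < e/2 * r"
      using uc[unfolded uniformly_continuous_on_def, rule_format, of "e/2 * r"] e r
      by (metis dist_commute half_gt_zero mult_pos_pos)
    define d where "d = min d0 r"
    have d: "d > 0" using d0 r by (simp add: d_def)
    have "dist (p z) (p z0) < e" if z: "dist z z0 < d" for z
    proof -
      let ?g = "\<lambda>t. f (z + t *s v) - f (z0 + t *s v)"
      have mem: "z + t *s v \<in> cball z0 R" "z0 + t *s v \<in> cball z0 R" if "cmod t \<le> r" for t
      proof -
        have "norm (z - z0 + t *s v) \<le> norm (z - z0) + norm (t *s v)" by (rule norm_triangle_ineq)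
        also have "\<dots> \<le> r + r"
          using that z v by (simp add: d_def dist_norm norm_vector_smult)
        finally show "z + t *s v \<in> cball z0 R"
          using r by (simp add: dist_norm norm_minus_commute algebra_simps)
        show "z0 + t *s v \<in> cball z0 R"
          using that v r by (simp add: dist_norm norm_vector_smult)
      qed
      have der: "(?g has_field_derivative p (z + t *s v) - p (z0 + t *s v)) (at t)" if "cmod t \<le> r" for t
        unfolding p_def using mem[OF that] R by (intro DERIV_diff A) auto
      have h1: "?g holomorphic_on ball 0 r"
        unfolding holomorphic_on_def
        using der by (force simp: field_differentiable_def intro: DERIV_subset less_imp_le)
      have h2: "continuous_on (cball 0 r) ?g"
        by (intro continuous_at_imp_continuous_on) (use der DERIV_isCont in force)
      have h3: "cmod (?g t) \<le> e/2 * r" if "norm (0 - t) = r" for t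
      proof -
        have "dist (z + t *s v) (z0 + t *s v) < d0" using z by (simp add: d_def dist_norm)
        then show ?thesis using d0(2)[OF mem(1) mem(2), of t t] that by (simp add: dist_norm)
      qed
      have "norm ((deriv ^^ 1) ?g 0) \<le> fact 1 * (e/2 * r) / r ^ 1"
        by (rule Cauchy_inequality[OF h1 h2 r(1) h3])
      moreover have "deriv ?g 0 = p z - p z0"
        using der[of 0] r by (auto intro: DERIV_imp_deriv)
      ultimately have "norm (p z - p z0) \<le> e / 2" using r(1) by simp
      then show ?thesis using e by (simp add: dist_norm)
    qed
    then show "\<exists>d>0. \<forall>x'. dist x' z0 < d \<longrightarrow> dist (p x') (p z0) < e"
      using d by blast
  qed
qed

text \<open>The increment is built up one coordinate at a time.  Each step stays on a line in a coordinate
  direction, where the mean value inequality controls the remainder because the partial derivatives are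
  continuous.\<close>

theorem osgood:
  fixes f :: "complex^'d \<Rightarrow> complex"
  assumes D: "open D" and cf: "continuous_on D f"
    and hol: "\<And>z j. z \<in> D \<Longrightarrow> (\<lambda>t. f (z + t *s axis j 1)) field_differentiable (at 0)"
  shows "holomorphic_fun D f"
  unfolding holomorphic_fun_def
proof
  fix z0 assume z0: "z0 \<in> D"
  define p where "p = (\<lambda>j z. deriv (\<lambda>t. f (z + t *s axis j 1)) 0)"
  have n1: "norm (axis j 1 :: complex^'d) = 1" for j by simp
  have cp: "isCont (p j) z0" for j
    unfolding p_def using partial_derivative_continuous(1)[OF D cf z0 n1 hol] .
  have dp: "((\<lambda>t. f (z + t *s axis j 1)) has_field_derivative p j (z + t *s axis j 1)) (at t)"
    if "z + t *s axis j 1 \<in> D" for z t j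
    unfolding p_def using partial_derivative_continuous(2)[OF D cf z0 n1 hol that] .
  define f' where "f' = (\<lambda>h. \<Sum>j\<in>UNIV. h $ j * p j z0)"
  have lin: "Vector_Spaces.linear (*s) (*) f'"
    unfolding f'_def
    by unfold_locales (auto simp: algebra_simps sum.distrib sum_distrib_left)
  have bl: "bounded_linear f'"
    by (rule linear_conv_bounded_linear[THEN iffD1], rule linearI)
       (simp_all add: f'_def algebra_simps sum.distrib scaleR_sum_right)
  have "(f has_derivative f') (at z0)"
    unfolding has_derivative_within_alt
  proof (intro conjI bl allI impI)
    fix e :: real assume e: "e > 0"
    define e' where "e' = e / CARD('d)"
    have e': "e' > 0" using e by (simp add: e'_def)
    have "\<forall>\<^sub>F z in nhds z0. z \<in> D \<and> (\<forall>j. dist (p j z) (p j z0) < e')"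
    proof (intro eventually_conj)
      show "\<forall>\<^sub>F z in nhds z0. z \<in> D" using D z0 eventually_nhds by blast
      have "\<forall>\<^sub>F z in nhds z0. dist (p j z) (p j z0) < e'" for j
        using cp[of j] e' by (simp add: continuous_at_eps_delta eventually_nhds_metric)
      then show "\<forall>\<^sub>F z in nhds z0. \<forall>j. dist (p j z) (p j z0) < e'"
        by (simp add: eventually_all_finite)
    qed
    then obtain d where d: "d > 0"
      "\<And>z. dist z z0 < d \<Longrightarrow> z \<in> D \<and> (\<forall>j. dist (p j z) (p j z0) < e')"
      unfolding eventually_nhds_metric by blast
    have "norm (f y - f z0 - f' (y - z0)) \<le> e * norm (y - z0)" if y: "norm (y - z0) < d" for y
    proof -
      define h where "h = y - z0"
      \<comment> \<open>\<open>hS S\<close> is the part of the increment in the coordinates of \<open>S\<close>.\<close>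
      define hS where "hS = (\<lambda>S. \<chi> i. if i \<in> S then h $ i else 0)"
      have main: "norm (f (z0 + hS S) - f z0 - (\<Sum>j\<in>S. h $ j * p j z0)) \<le> card S * e' * norm h"
        for S :: "'d set"
      proof -
        have "finite S" by simp
        then show ?thesis
        proof (induction S rule: finite_induct)
          case empty
          have "hS {} = 0" by (simp add: hS_def vec_eq_iff)
          then show ?case by simp
        next
          case (insert j S)
          let ?u = "z0 + hS S"
          let ?g = "\<lambda>t. f (?u + t *s axis j 1) - t * p j z0"
          let ?B = "cball 0 (cmod (h $ j)) :: complex set"
          have near: "dist (?u + t *s axis j 1) z0 < d" if "t \<in> ?B" for t
          proof -
            have "norm (hS S + t *s axis j 1) \<le> norm h"
              using that insert(2)
              by (intro norm_le_componentwise_cart) (auto simp: hS_def axis_def)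
            then show ?thesis using y by (simp add: dist_norm h_def add.assoc)
          qed
          have "norm (?g (h $ j) - ?g 0) \<le> e' * norm (h $ j - 0)"
          proof (rule field_differentiable_bound[of ?B])
            show "(?g has_field_derivative (p j (?u + t *s axis j 1) - p j z0)) (at t within ?B)"
              if "t \<in> ?B" for t
            proof -
              have "((\<lambda>t. t * p j z0) has_field_derivative p j z0) (at t)"
                by (auto intro!: derivative_eq_intros)
              then have "(?g has_field_derivative (p j (?u + t *s axis j 1) - p j z0)) (at t)"
                by (intro DERIV_diff dp) (use d near[OF that] in auto)
              then show ?thesis by (rule has_field_derivative_at_within)
            qed
            show "norm (p j (?u + t *s axis j 1) - p j z0) \<le> e'" if "t \<in> ?B" for t
              using d near[OF that] by (auto simp: dist_norm less_imp_le)
          qed auto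
          moreover have hins: "?u + (h $ j) *s axis j 1 = z0 + hS (insert j S)"
            using insert(2) by (auto simp: hS_def vec_eq_iff axis_def)
          moreover have "norm (h $ j - 0) \<le> norm h" by (simp add: Finite_Cartesian_Product.norm_nth_le)
          ultimately have "norm (?g (h $ j) - ?g 0) \<le> e' * norm h"
            using e' by (meson less_imp_le mult_left_mono order_trans)
          moreover have "?g (h $ j) - ?g 0 = f (z0 + hS (insert j S)) - h $ j * p j z0 - f ?u"
            by (simp add: hins[symmetric])
          ultimately have 1: "norm (f (z0 + hS (insert j S)) - h $ j * p j z0 - f ?u) \<le> e' * norm h"
            by simp
          have "f (z0 + hS (insert j S)) - f z0 - (\<Sum>j\<in>insert j S. h $ j * p j z0)
             = (f (z0 + hS (insert j S)) - h $ j * p j z0 - f ?u)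
               + (f ?u - f z0 - (\<Sum>j\<in>S. h $ j * p j z0))"
            using insert by simp
          then have "norm (f (z0 + hS (insert j S)) - f z0 - (\<Sum>j\<in>insert j S. h $ j * p j z0))
              \<le> e' * norm h + card S * e' * norm h"
            using norm_triangle_le[OF add_mono[OF 1 insert.IH]] by presburger
          then show ?case using insert by (simp add: algebra_simps)
        qed
      qed
      have "hS UNIV = h" by (simp add: hS_def vec_eq_iff)
      then show ?thesis using main[of UNIV] by (simp add: h_def f'_def e'_def)
    qed
    then show "\<exists>d>0. \<forall>y\<in>UNIV. norm (y - z0) < d \<longrightarrow> norm (f y - f z0 - f' (y - z0)) \<le> e * norm (y - z0)"
      using d by blast
  qed
  then show "\<exists>f'. (f has_derivative f') (at z0) \<and> Vector_Spaces.linear (*s) (*) f'"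
    using lin by blast
qed

lemma clinear_functionalI:
  fixes f :: "complex^'d \<Rightarrow> complex"
  assumes "\<And>x y. f (x + y) = f x + f y" "\<And>c x. f (c *s x) = c * f x"
  shows "Vector_Spaces.linear (*s) (*) f"
  by unfold_locales (use assms in \<open>auto simp: algebra_simps\<close>)

lemma clinear_mapI:
  fixes f :: "complex^'d \<Rightarrow> complex^'e"
  assumes "\<And>x y. f (x + y) = f x + f y" "\<And>c x. f (c *s x) = c *s f x"
  shows "Vector_Spaces.linear (*s) (*s) f"
  by unfold_locales (use assms in \<open>auto simp: vec_eq_iff algebra_simps\<close>)

lemma scaleR_eq_smult: "r *\<^sub>R (x::complex^'d) = complex_of_real r *s x"
  by (simp add: vec_eq_iff scaleR_conv_of_real[where 'a=complex])

lemma clinear_map_imp_bounded_linear: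
  fixes f :: "complex^'d \<Rightarrow> complex^'e"
  assumes "Vector_Spaces.linear (*s) (*s) f"
  shows "bounded_linear f"
  using assms
  by (intro linear_conv_bounded_linear[THEN iffD1] linearI)
     (simp_all add: Vector_Spaces.linear_iff scaleR_eq_smult)

lemma clinear_functional_imp_bounded_linear:
  fixes f :: "complex^'d \<Rightarrow> complex"
  assumes "Vector_Spaces.linear (*s) (*) f"
  shows "bounded_linear f"
  using assms
  by (intro linear_conv_bounded_linear[THEN iffD1] linearI)
     (simp_all add: Vector_Spaces.linear_iff scaleR_eq_smult scaleR_conv_of_real[where 'a=complex])

definition holomorphic_map :: "(complex^'d) set \<Rightarrow> (complex^'d \<Rightarrow> complex^'e) \<Rightarrow> bool" where
  "holomorphic_map D g \<longleftrightarrow>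
     (\<forall>z\<in>D. \<exists>g'. (g has_derivative g') (at z) \<and> Vector_Spaces.linear (*s) (*s) g')"

lemma holomorphic_fun_subset: "holomorphic_fun D f \<Longrightarrow> E \<subseteq> D \<Longrightarrow> holomorphic_fun E f"
  by (auto simp: holomorphic_fun_def)

lemma holomorphic_fun_local:
  "(\<And>z. z \<in> D \<Longrightarrow> \<exists>U. z \<in> U \<and> holomorphic_fun U f) \<Longrightarrow> holomorphic_fun D f"
  unfolding holomorphic_fun_def by blast

lemma holomorphic_fun_cong:
  assumes "open D" "holomorphic_fun D f" "\<And>z. z \<in> D \<Longrightarrow> f z = g z"
  shows "holomorphic_fun D g"
  unfolding holomorphic_fun_def
proof
  fix z assume z: "z \<in> D"
  then obtain f' where "(f has_derivative f') (at z)" "Vector_Spaces.linear (*s) (*) f'"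
    using assms(2) unfolding holomorphic_fun_def by blast
  then show "\<exists>f'. (g has_derivative f') (at z) \<and> Vector_Spaces.linear (*s) (*) f'"
    using has_derivative_transform_within_open[OF _ assms(1) z] assms(3) by blast
qed

lemma holomorphic_fun_const: "holomorphic_fun D (\<lambda>z. c)"
  unfolding holomorphic_fun_def
  by (auto intro!: exI[of _ "\<lambda>z. 0"] clinear_functionalI)

lemma holomorphic_fun_clinear:
  "Vector_Spaces.linear (*s) (*) f \<Longrightarrow> holomorphic_fun D f"
  unfolding holomorphic_fun_def
  using bounded_linear_imp_has_derivative clinear_functional_imp_bounded_linear by blast

lemma holomorphic_fun_nth: "holomorphic_fun D (\<lambda>z. z $ i)"
  by (intro holomorphic_fun_clinear clinear_functionalI) simp_all

lemma holomorphic_fun_add: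
  assumes "holomorphic_fun D f" "holomorphic_fun D g"
  shows "holomorphic_fun D (\<lambda>z. f z + g z)"
  unfolding holomorphic_fun_def
proof
  fix z assume "z \<in> D"
  then obtain f' g' where "(f has_derivative f') (at z)" "Vector_Spaces.linear (*s) (*) f'"
     "(g has_derivative g') (at z)" "Vector_Spaces.linear (*s) (*) g'"
    using assms unfolding holomorphic_fun_def by meson
  then show "\<exists>h. ((\<lambda>z. f z + g z) has_derivative h) (at z) \<and> Vector_Spaces.linear (*s) (*) h"
    by (intro exI[of _ "\<lambda>x. f' x + g' x"] conjI has_derivative_add clinear_functionalI)
       (auto simp: Vector_Spaces.linear_iff algebra_simps)
qed

lemma holomorphic_fun_mult:
  assumes "holomorphic_fun D f" "holomorphic_fun D g"
  shows "holomorphic_fun D (\<lambda>z. f z * g z)"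
  unfolding holomorphic_fun_def
proof
  fix z assume "z \<in> D"
  then obtain f' g' where "(f has_derivative f') (at z)" "Vector_Spaces.linear (*s) (*) f'"
     "(g has_derivative g') (at z)" "Vector_Spaces.linear (*s) (*) g'"
    using assms unfolding holomorphic_fun_def by meson
  then show "\<exists>h. ((\<lambda>z. f z * g z) has_derivative h) (at z) \<and> Vector_Spaces.linear (*s) (*) h"
    by (intro exI[of _ "\<lambda>x. f z * g' x + f' x * g z"] conjI has_derivative_mult clinear_functionalI)
       (auto simp: Vector_Spaces.linear_iff algebra_simps)
qed

lemma holomorphic_fun_power: "holomorphic_fun D f \<Longrightarrow> holomorphic_fun D (\<lambda>z. f z ^ n)"
  by (induction n) (auto intro: holomorphic_fun_const holomorphic_fun_mult)

lemma holomorphic_fun_compose: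
  assumes "holomorphic_fun E f" "holomorphic_map D g" "g ` D \<subseteq> E"
  shows "holomorphic_fun D (\<lambda>z. f (g z))"
  unfolding holomorphic_fun_def
proof
  fix z assume z: "z \<in> D"
  then obtain g' where g: "(g has_derivative g') (at z)" "Vector_Spaces.linear (*s) (*s) g'"
    using assms unfolding holomorphic_map_def by meson
  obtain f' where f: "(f has_derivative f') (at (g z))" "Vector_Spaces.linear (*s) (*) f'"
    using assms z unfolding holomorphic_fun_def by blast
  show "\<exists>h. ((\<lambda>z. f (g z)) has_derivative h) (at z) \<and> Vector_Spaces.linear (*s) (*) h"
    using has_derivative_compose[OF g(1) f(1)] f(2) g(2)
    by (intro exI[of _ "\<lambda>x. f' (g' x)"] conjI clinear_functionalI)
       (auto simp: Vector_Spaces.linear_iff algebra_simps)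
qed

lemma holomorphic_map_clinear:
  "Vector_Spaces.linear (*s) (*s) f \<Longrightarrow> holomorphic_map D f"
  unfolding holomorphic_map_def
  using bounded_linear_imp_has_derivative clinear_map_imp_bounded_linear by blast

lemma holomorphic_map_matrix: "holomorphic_map D ((*v) (A :: complex^'d^'e))"
  by (intro holomorphic_map_clinear clinear_mapI)
     (simp_all add: matrix_vector_right_distrib vector_scalar_commute)

lemma holomorphic_map_imp_continuous_on: "holomorphic_map D f \<Longrightarrow> continuous_on D f"
  unfolding holomorphic_map_def
  by (meson continuous_at_imp_continuous_on has_derivative_continuous)

text \<open>Osgood's lemma reduces this to the quotient rule in one variable.\<close>

lemma holomorphic_fun_divide:
  fixes f :: "complex^'d \<Rightarrow> complex"
  assumes D: "open D" and f: "holomorphic_fun D f" and g: "holomorphic_fun D g"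
    and nz: "\<And>z. z \<in> D \<Longrightarrow> g z \<noteq> 0"
  shows "holomorphic_fun D (\<lambda>z. f z / g z)"
proof (rule osgood[OF D])
  show "continuous_on D (\<lambda>z. f z / g z)"
    using assms by (intro continuous_on_divide holomorphic_fun_imp_continuous_on) auto
  fix z :: "complex^'d" and j assume z: "z \<in> D"
  let ?S = "{t. z + t *s axis j 1 \<in> D}"
  have "(\<lambda>t. f (z + t *s axis j 1) / g (z + t *s axis j 1)) holomorphic_on ?S"
    using f g nz by (intro holomorphic_on_divide holomorphic_fun_line) auto
  then show "(\<lambda>t. f (z + t *s axis j 1) / g (z + t *s axis j 1)) field_differentiable at 0"
    using open_line_slice[OF D, of z "axis j 1"] z
    by (auto simp: holomorphic_on_open field_differentiable_def)
qed

lemma holomorphic_fun_uniform_limit: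
  fixes f :: "nat \<Rightarrow> complex^'d \<Rightarrow> complex"
  assumes D: "open D" and hol: "\<And>n. holomorphic_fun D (f n)"
    and lim: "\<And>z. z \<in> D \<Longrightarrow> \<exists>d>0. cball z d \<subseteq> D \<and> uniform_limit (cball z d) f g sequentially"
  shows "holomorphic_fun D g"
proof (rule osgood[OF D])
  show "continuous_on D g"
  proof (rule continuous_at_imp_continuous_on, rule ballI)
    fix z assume "z \<in> D"
    then obtain d where d: "d > 0" "cball z d \<subseteq> D" "uniform_limit (cball z d) f g sequentially"
      using lim by blast
    have "continuous_on (cball z d) g"
      by (rule uniform_limit_theorem[OF _ d(3)])
         (use continuous_on_subset[OF holomorphic_fun_imp_continuous_on[OF hol] d(2)]
           in \<open>auto intro!: always_eventually\<close>)
    then show "isCont g z" using d(1)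
      by (meson ball_subset_cball centre_in_ball continuous_on_eq_continuous_at continuous_on_subset open_ball)
  qed
  fix z :: "complex^'d" and j assume z: "z \<in> D"
  let ?l = "\<lambda>t. z + t *s axis j 1" and ?S = "{t. z + t *s axis j 1 \<in> D}"
  have "(\<lambda>t. g (?l t)) holomorphic_on ?S"
  proof (rule holomorphic_uniform_sequence[of _ "\<lambda>n t. f n (?l t)"])
    show "open ?S" by (rule open_line_slice[OF D])
    show "(\<lambda>t. f n (?l t)) holomorphic_on ?S" for n by (rule holomorphic_fun_line[OF hol])
    fix t assume "t \<in> ?S"
    then obtain d where d: "d > 0" "cball (?l t) d \<subseteq> D" "uniform_limit (cball (?l t) d) f g sequentially"
      using lim by blast
    have sub: "?l s \<in> cball (?l t) d" if "s \<in> cball t d" for s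
    proof -
      have "?l t - ?l s = (t - s) *s axis j 1" by (simp add: vec_eq_iff algebra_simps)
      then have "norm (?l t - ?l s) = norm (t - s)" by (simp only: norm_vector_smult) simp
      then show ?thesis using that by (simp only: mem_cball dist_norm)
    qed
    have "uniform_limit (cball t d) (\<lambda>n s. f n (?l s)) (\<lambda>s. g (?l s)) sequentially"
      by (intro uniform_limit_compose'[OF d(3)] funcsetI sub)
    moreover have "cball t d \<subseteq> ?S" using sub d(2) by blast
    ultimately show "\<exists>d>0. cball t d \<subseteq> ?S \<and> uniform_limit (cball t d) (\<lambda>n t. f n (?l t)) (\<lambda>t. g (?l t)) sequentially"
      using d(1) by blast
  qed
  then show "(\<lambda>t. g (?l t)) field_differentiable at 0"
    using open_line_slice[OF D, of z "axis j 1"] z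
    by (auto simp: holomorphic_on_open field_differentiable_def)
qed

section \<open>Polynomial functions\<close>

text \<open>Polynomials as functions, so that identities between them need not be lifted to coefficients.\<close>

inductive polyfun :: "(complex^'d \<Rightarrow> complex) \<Rightarrow> bool" where
  const: "polyfun (\<lambda>z. c)"
| nth: "polyfun (\<lambda>z. z $ i)"
| add: "polyfun f \<Longrightarrow> polyfun g \<Longrightarrow> polyfun (\<lambda>z. f z + g z)"
| mult: "polyfun f \<Longrightarrow> polyfun g \<Longrightarrow> polyfun (\<lambda>z. f z * g z)"

lemma polyfun_sum:
  "(\<And>i. i \<in> I \<Longrightarrow> polyfun (f i)) \<Longrightarrow> polyfun (\<lambda>z. \<Sum>i\<in>I. f i z)"
  by (induction I rule: infinite_finite_induct) (auto intro: polyfun.intros)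

lemma polyfun_prod:
  "(\<And>i. i \<in> I \<Longrightarrow> polyfun (f i)) \<Longrightarrow> polyfun (\<lambda>z. \<Prod>i\<in>I. f i z)"
  by (induction I rule: infinite_finite_induct) (auto intro: polyfun.intros)

lemma polyfun_power: "polyfun f \<Longrightarrow> polyfun (\<lambda>z. f z ^ n)"
  by (induction n) (auto intro: polyfun.intros)

lemma polyfun_clinear:
  assumes "Vector_Spaces.linear (*s) (*) (f :: complex^'d \<Rightarrow> complex)"
  shows "polyfun f"
proof -
  interpret Vector_Spaces.linear "(*s)" "(*)" f by (rule assms)
  have "f z = (\<Sum>i\<in>UNIV. z $ i * f (axis i 1))" for z
  proof -
    have "f z = f (\<Sum>i\<in>UNIV. z $ i *s axis i 1)" by (simp add: basis_expansion)
    also have "\<dots> = (\<Sum>i\<in>UNIV. z $ i * f (axis i 1))"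
      by (simp add: sum scale)
    finally show ?thesis .
  qed
  then have "f = (\<lambda>z. \<Sum>i\<in>UNIV. z $ i * f (axis i 1))" by blast
  moreover have "polyfun (\<lambda>z. \<Sum>i\<in>UNIV. z $ i * f (axis i 1))"
    by (intro polyfun_sum polyfun.intros)
  ultimately show ?thesis by metis
qed

lemma polyfun_compose_matrix:
  "polyfun f \<Longrightarrow> polyfun (\<lambda>z. f ((A :: complex^'d^'e) *v z))"
proof (induction rule: polyfun.induct)
  case (nth i)
  then show ?case
    unfolding matrix_vector_mult_def by (auto intro!: polyfun_sum polyfun.intros)
qed (auto intro: polyfun.intros)

lemma polyfun_holomorphic: "polyfun f \<Longrightarrow> holomorphic_fun D f"
  by (induction rule: polyfun.induct)
     (auto intro: holomorphic_fun_const holomorphic_fun_nth holomorphic_fun_add holomorphic_fun_mult)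

lemma polyfun_continuous_on: "polyfun f \<Longrightarrow> continuous_on S f"
  using polyfun_holomorphic holomorphic_fun_imp_continuous_on by blast

lemma polyfun_line: "polyfun f \<Longrightarrow> \<exists>q. \<forall>t. f (z + t *s v) = poly q t"
proof (induction rule: polyfun.induct)
  case (const c)
  show ?case by (intro exI[of _ "[:c:]"]) simp
next
  case (nth i)
  show ?case by (intro exI[of _ "[:z $ i, v $ i:]"]) simp
next
  case (add f g)
  then obtain p q where "\<forall>t. f (z + t *s v) = poly p t" "\<forall>t. g (z + t *s v) = poly q t" by blast
  then show ?case by (intro exI[of _ "p + q"]) simp
next
  case (mult f g)
  then obtain p q where "\<forall>t. f (z + t *s v) = poly p t" "\<forall>t. g (z + t *s v) = poly q t" by blast
  then show ?case by (intro exI[of _ "p * q"]) simp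
qed

lemma polyfun_line_finite_zeros:
  assumes "polyfun f" "f (z + t0 *s v) \<noteq> 0"
  shows "finite {t. f (z + t *s v) = 0}"
proof -
  obtain q where q: "\<forall>t. f (z + t *s v) = poly q t" using polyfun_line[OF assms(1)] by blast
  then have "q \<noteq> 0" using assms(2) by auto
  then show ?thesis using poly_roots_finite q by simp
qed

lemma polyfun_field_differentiable_line:
  assumes "polyfun f" shows "(\<lambda>t. f (z + t *s v)) field_differentiable (at t)"
proof -
  obtain q where "\<forall>t. f (z + t *s v) = poly q t" using polyfun_line[OF assms(1)] by blast
  then have "(\<lambda>t. f (z + t *s v)) = poly q" by auto
  then show ?thesis
    unfolding field_differentiable_def using poly_DERIV[of q t] by metis
qed

lemma polyfun_partial:
  "polyfun f \<Longrightarrow> polyfun (\<lambda>z. deriv (\<lambda>t. f (z + t *s v)) 0)"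
proof (induction rule: polyfun.induct)
  case (const c)
  then show ?case by (simp add: polyfun.const)
next
  case (nth i)
  have "deriv (\<lambda>t. (z + t *s v) $ i) 0 = v $ i" for z
    by (rule DERIV_imp_deriv) (auto intro!: derivative_eq_intros)
  then show ?case by (simp add: polyfun.const del: vector_add_component vector_smult_component)
next
  case (add f g)
  then show ?case by (simp add: polyfun_field_differentiable_line polyfun.intros)
next
  case (mult f g)
  then show ?case by (simp add: polyfun_field_differentiable_line polyfun.intros)
qed

lemma polyfun_det:
  fixes M :: "complex^'d \<Rightarrow> complex^'e^'e"
  shows "(\<And>i j. polyfun (\<lambda>z. M z $ i $ j)) \<Longrightarrow> polyfun (\<lambda>z. det (M z))"
  unfolding det_def by (intro polyfun_sum polyfun.mult polyfun.const polyfun_prod)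

subsection \<open>Evaluation of formal polynomials\<close>

lemma poly_eval_superset:
  assumes "finite K" "Poly_Mapping.keys p \<subseteq> K"
  shows "poly_eval p z =
    (\<Sum>m\<in>K. Poly_Mapping.lookup p m * (\<Prod>i\<in>UNIV. (z $ i) ^ Poly_Mapping.lookup m i))"
  unfolding poly_eval_def insertion_def
  by (rule sum.mono_neutral_left) (use assms in \<open>auto simp: in_keys_iff\<close>)

lemma poly_eval_add: "poly_eval (p + q) z = poly_eval p z + poly_eval q z"
proof -
  let ?K = "Poly_Mapping.keys p \<union> Poly_Mapping.keys q"
  have "Poly_Mapping.keys (p + q) \<subseteq> ?K" by (rule Poly_Mapping.keys_add)
  then show ?thesis
    by (simp add: poly_eval_superset[of ?K] lookup_add sum.distrib algebra_simps)
qed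

lemma poly_eval_single:
  "poly_eval (Poly_Mapping.single m c) z = c * (\<Prod>i\<in>UNIV. (z $ i) ^ Poly_Mapping.lookup m i)"
  by (simp add: poly_eval_superset[of "{m}"])

lemma poly_eval_zero [simp]: "poly_eval 0 z = 0"
  by (simp add: poly_eval_def insertion_def)

lemma poly_eval_sum: "poly_eval (\<Sum>i\<in>I. f i) z = (\<Sum>i\<in>I. poly_eval (f i) z)"
  by (induction I rule: infinite_finite_induct) (auto simp: poly_eval_add)

lemma cpoly_expansion:
  "p = (\<Sum>m\<in>Poly_Mapping.keys p. Poly_Mapping.single m (Poly_Mapping.lookup p m))"
  for p :: "'d::finite cpoly"
  by (rule poly_mapping_eqI)
     (simp add: lookup_sum lookup_single when_def in_keys_iff sum.delta' cong: if_cong)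

lemma poly_eval_mult: "poly_eval (p * q) z = poly_eval p z * poly_eval q z"
proof -
  let ?s = "\<lambda>p m. Poly_Mapping.single m (Poly_Mapping.lookup p m)"
  have "p * q = (\<Sum>m\<in>Poly_Mapping.keys p. \<Sum>n\<in>Poly_Mapping.keys q. ?s p m * ?s q n)"
    by (subst (1) cpoly_expansion[of p], subst (1) cpoly_expansion[of q]) (rule sum_product)
  then have "poly_eval (p * q) z
      = (\<Sum>m\<in>Poly_Mapping.keys p. \<Sum>n\<in>Poly_Mapping.keys q. poly_eval (?s p m) z * poly_eval (?s q n) z)"
    by (simp add: poly_eval_sum mult_single poly_eval_single lookup_add power_add prod.distrib mult_ac)
  also have "\<dots> = poly_eval p z * poly_eval q z"
  proof -
    have "poly_eval r z = (\<Sum>m\<in>Poly_Mapping.keys r. poly_eval (?s r m) z)" for r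
      by (simp add: poly_eval_single poly_eval_superset[OF _ order_refl])
    note ev = this
    show ?thesis by (simp only: ev[of p] ev[of q] sum_product)
  qed
  finally show ?thesis .
qed

lemma poly_eval_one [simp]: "poly_eval 1 z = 1"
  using poly_eval_single[of 0 1 z] by (simp add: single_one)

lemma poly_eval_power: "poly_eval (p ^ n) z = poly_eval p z ^ n"
  by (induction n) (auto simp: poly_eval_mult)

lemma poly_eval_prod: "poly_eval (\<Prod>i\<in>I. f i) z = (\<Prod>i\<in>I. poly_eval (f i) z)"
  by (induction I rule: infinite_finite_induct) (auto simp: poly_eval_mult)

lemma poly_eval_subst:
  "poly_eval (poly_subst \<theta> q) z = poly_eval q (\<chi> i. poly_eval (\<theta> i) z)"
  unfolding poly_subst_def insertion_def
  by (simp add: poly_eval_sum poly_eval_mult poly_eval_single poly_eval_prod poly_eval_power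
      poly_eval_superset[OF _ order_refl])

lemma polyfun_iff_poly_eval: "polyfun f \<longleftrightarrow> (\<exists>p. f = poly_eval p)"
proof
  assume "polyfun f"
  then show "\<exists>p. f = poly_eval p"
  proof (induction rule: polyfun.induct)
    case (const c)
    show ?case by (intro exI[of _ "Poly_Mapping.single 0 c"]) (simp add: fun_eq_iff poly_eval_single)
  next
    case (nth i)
    have "z $ i = poly_eval (Poly_Mapping.single (Poly_Mapping.single i 1) 1) z" for z :: "complex^'a"
    proof -
      have "(\<Prod>j\<in>UNIV. z $ j ^ Poly_Mapping.lookup (Poly_Mapping.single i 1) j)
          = (\<Prod>j\<in>UNIV. if j = i then z $ j else 1)"
        by (rule prod.cong) (auto simp: lookup_single)
      then show ?thesis by (simp add: poly_eval_single)
    qed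
    then show ?case by blast
  next
    case (add f g)
    then show ?case by (metis (mono_tags, lifting) poly_eval_add ext)
  next
    case (mult f g)
    then show ?case by (metis (mono_tags, lifting) poly_eval_mult ext)
  qed
next
  assume "\<exists>p. f = poly_eval p"
  then obtain p where p: "f = poly_eval p" by blast
  have "f = (\<lambda>z. \<Sum>m\<in>Poly_Mapping.keys p. Poly_Mapping.lookup p m *
           (\<Prod>i\<in>UNIV. (z $ i) ^ Poly_Mapping.lookup m i))"
    by (simp add: p poly_eval_def insertion_def fun_eq_iff)
  then show "polyfun f"
    by (simp add: polyfun_sum polyfun.mult polyfun.const polyfun_prod polyfun_power polyfun.nth)
qed


subsection \<open>Zero sets\<close>

lemma polyfun_nonzero_near:
  assumes f: "polyfun f" and nz: "f (z + v) \<noteq> 0" and e: "e > 0"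
  obtains t where "t \<noteq> 0" "cmod t < e" "f (z + t *s v) \<noteq> 0"
proof -
  have fin: "finite {t. f (z + t *s v) = 0}"
    by (rule polyfun_line_finite_zeros[OF f, of z 1]) (simp add: nz)
  have "\<not> ball 0 e - {0} \<subseteq> {t. f (z + t *s v) = 0}"
  proof
    assume "ball 0 e - {0} \<subseteq> {t. f (z + t *s v) = 0}"
    then have "finite (ball 0 e - {0::complex})"
      using fin finite_subset by blast
    then have "finite (ball (0::complex) e)" by simp
    then show False
      using e open_ball[of "0::complex" e] finite_imp_not_open[of "ball (0::complex) e"] by simp
  qed
  then obtain t where "t \<in> ball 0 e" "t \<noteq> 0" "f (z + t *s v) \<noteq> 0" by blast
  then show thesis by (intro that) auto
qed

lemma polyfun_nonzero_dense:
  assumes f: "polyfun f" and nz: "f w \<noteq> 0" and U: "open U" "z \<in> U"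
  obtains y where "y \<in> U" "f y \<noteq> 0"
proof -
  let ?v = "w - z"
  obtain e where e: "e > 0" "ball z e \<subseteq> U" using U open_contains_ball by blast
  have "f (z + ?v) \<noteq> 0" using nz by simp
  then obtain t where t: "cmod t < e / (norm ?v + 1)" "f (z + t *s ?v) \<noteq> 0"
    using polyfun_nonzero_near[OF f, of z ?v "e / (norm ?v + 1)"] e
    by (metis add_nonneg_pos divide_pos_pos norm_ge_zero zero_less_one)
  have "norm (t *s ?v) \<le> cmod t * (norm ?v + 1)"
    unfolding norm_vector_smult by (intro mult_left_mono) auto
  also have "\<dots> < e" using t(1) by (simp add: pos_less_divide_eq add_nonneg_pos)
  finally have "z + t *s ?v \<in> ball z e" by (simp add: dist_norm del: vector_ssub_ldistrib)
  then show thesis using that e(2) t(2) by blast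
qed

text \<open>On each line through a point \<open>w\<close> outside the zero set there are only finitely many zeros, so the
  dilations of the zero set by infinitely many factors cover no point infinitely often.  If the zero
  set had positive measure, these dilations would have measures bounded below inside a
  bounded set, which continuity of the measure from above excludes.\<close>

lemma polyfun_zeros_negligible:
  fixes f :: "complex^'d \<Rightarrow> complex"
  assumes f: "polyfun f" and nz: "f w \<noteq> 0"
  shows "negligible {z. f z = 0}"
proof -
  let ?N = "{z. f z = 0}"
  have clN: "closed ?N"
    using continuous_closed_vimage[of "{0}" f] polyfun_continuous_on[OF f, of UNIV]
    by (simp add: vimage_def continuous_on_eq_continuous_at)
  have "negligible (?N \<inter> cball w (real R))" for R :: nat
  proof (rule ccontr)
    assume neg: "\<not> negligible (?N \<inter> cball w (real R))"
    define S where "S = (\<lambda>z. z - w) ` (?N \<inter> cball w (real R))"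
    have Sborel: "S \<in> sets borel"
      unfolding S_def using clN
      by (intro borel_closed closed_translation_subtract closed_Int) auto
    have Ssub: "S \<subseteq> cball 0 (real R)" by (auto simp: S_def dist_norm norm_minus_commute)
    have "\<not> negligible S"
      using neg negligible_translation_rev[of "- w" "?N \<inter> cball w (real R)"]
      by (auto simp: S_def)
    then have m: "emeasure lebesgue S > 0"
      using Sborel by (simp add: negligible_iff_emeasure0 sets_completionI_sets zero_less_iff_neq_zero)
    \<comment> \<open>Infinitely many dilation factors between 1 and 2.\<close>
    define c where "c = (\<lambda>n::nat. 1 + 1 / (real n + 1))"
    have c: "1 \<le> c n" "c n \<le> 2" for n by (auto simp: c_def field_simps)
    have c_inj: "inj c" by (auto simp: inj_def c_def)
    define A where "A = (\<lambda>n. (\<lambda>x. c n *\<^sub>R x + 0) ` S)"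
    define B where "B = (\<lambda>n. \<Union>k\<in>{n..}. A k)"
    have Am: "emeasure lebesgue S \<le> emeasure lebesgue (A n)" for n
    proof -
      have "emeasure lebesgue (A n) = ennreal (\<bar>c n\<bar> ^ DIM(complex^'d)) * emeasure lebesgue S"
        unfolding A_def by (rule emeasure_lebesgue_affine)
      moreover have "1 \<le> ennreal (\<bar>c n\<bar> ^ DIM(complex^'d))"
        using c(1)[of n] by (simp add: one_le_power del: DIM_cart)
      ultimately show ?thesis using mult_right_mono[of 1 _ "emeasure lebesgue S"] by simp
    qed
    have Asets: "A n \<in> sets lebesgue" for n
    proof -
      have "closed (A n)"
      proof -
        have "compact S" unfolding S_def using clN
          by (intro compact_translation_subtract) (simp add: closed_Int_compact)
        then show ?thesis unfolding A_def
          by (intro compact_imp_closed compact_continuous_image continuous_intros)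
      qed
      then show ?thesis by auto
    qed
    have Asub: "A n \<subseteq> cball 0 (2 * real R)" for n
    proof -
      have "c n * norm x \<le> 2 * real R" if "x \<in> S" for x
        using Ssub that c[of n] by (intro mult_mono) auto
      then show ?thesis using c(1)[of n] by (auto simp: A_def)
    qed
    have Bsub: "B n \<subseteq> cball 0 (2 * real R)" for n using Asub by (auto simp: B_def)
    have Bsets: "B n \<in> sets lebesgue" for n
      unfolding B_def by (intro sets.countable_UN') (auto simp: Asets)
    have "(\<lambda>n. emeasure lebesgue (B n)) \<longlonglongrightarrow> emeasure lebesgue (\<Inter>n. B n)"
    proof (rule Lim_emeasure_decseq)
      show "range B \<subseteq> sets lebesgue" using Bsets by blast
      show "decseq B" unfolding decseq_def B_def by (intro allI impI UN_mono) auto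
      have "emeasure lebesgue (B n) \<le> emeasure lebesgue (cball 0 (2 * real R) :: (complex^'d) set)" for n
        by (rule emeasure_mono[OF Bsub]) simp
      also have "\<dots> < \<infinity>" using emeasure_bounded_finite[OF bounded_cball[of "0 :: complex^'d" "2 * real R"]] by simp
      finally show "emeasure lebesgue (B n) \<noteq> \<infinity>" for n by (simp add: less_top)
    qed
    moreover have "(\<Inter>n. B n) = {}"
    proof (rule ccontr)
      assume "(\<Inter>n. B n) \<noteq> {}"
      then obtain x where x: "\<And>n. x \<in> B n" by blast
      have fin: "finite {t. f (w + t *s x) = 0}"
        by (rule polyfun_line_finite_zeros[OF f, of w 0]) (simp add: nz)
      have "infinite {n. x \<in> A n}"
        unfolding infinite_nat_iff_unbounded_le using x by (auto simp: B_def)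
      then have "infinite ((\<lambda>n. complex_of_real (1 / c n)) ` {n. x \<in> A n})"
      proof (subst finite_image_iff)
        show "inj_on (\<lambda>n. complex_of_real (1 / c n)) {n. x \<in> A n}"
          using c_inj by (auto simp: inj_on_def inj_def)
      qed
      moreover have "(\<lambda>n. complex_of_real (1 / c n)) ` {n. x \<in> A n} \<subseteq> {t. f (w + t *s x) = 0}"
      proof clarify
        fix n assume "x \<in> A n"
        then obtain y where y: "y \<in> S" "x = c n *\<^sub>R y" by (auto simp: A_def)
        have "complex_of_real (1 / c n) *s x = y"
          using c(1)[of n] y(2) by (simp add: scaleR_eq_smult)
        then show "f (w + complex_of_real (1 / c n) *s x) = 0"
          using y(1) by (auto simp: S_def)
      qed
      ultimately show False using fin finite_subset by blast
    qed
    ultimately have lim: "(\<lambda>n. emeasure lebesgue (B n)) \<longlonglongrightarrow> 0" by simp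
    have "emeasure lebesgue S \<le> emeasure lebesgue (B n)" for n
    proof -
      have "emeasure lebesgue (A n) \<le> emeasure lebesgue (B n)"
        by (rule emeasure_mono) (use Bsets in \<open>auto simp: B_def\<close>)
      then show ?thesis using Am[of n] by simp
    qed
    then have "emeasure lebesgue S \<le> 0" by (intro LIMSEQ_le_const[OF lim]) auto
    then show False using m by simp
  qed
  then have "negligible (\<Union>R::nat. ?N \<inter> cball w (real R))" by (intro negligible_Union_nat)
  moreover have "(\<Union>R::nat. ?N \<inter> cball w (real R)) = ?N"
    using real_arch_simple by (auto simp: mem_cball)
  ultimately show ?thesis by simp
qed

text \<open>Near a point \<open>u\<^sub>0\<close> of the zero set of \<open>\<delta>\<close> there is a basis of
  directions, obtained by perturbing one vector \<open>v\<close>, such that no line in one of these directions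
  that passes near \<open>u\<^sub>0\<close> lies in the zero set.  On each of these lines the zero set is finite and
  the singularities of a continuous function are removable, so that Osgood's lemma applies in the
  corresponding coordinates.\<close>

theorem removable_polyfun_zeros:
  fixes f :: "complex^'d \<Rightarrow> complex"
  assumes D: "open D" and cf: "continuous_on D f" and \<delta>: "polyfun \<delta>" and nz: "\<delta> w \<noteq> 0"
    and hol: "holomorphic_fun (D \<inter> {z. \<delta> z \<noteq> 0}) f"
  shows "holomorphic_fun D f"
proof (rule holomorphic_fun_local)
  fix u0 assume u0: "u0 \<in> D"
  define v where "v = w - u0"
  define T where "T = (\<Sum>j\<in>UNIV. v $ j)"
  have c\<delta>: "isCont \<delta> z" for z
    using polyfun_continuous_on[OF \<delta>, of UNIV] by (simp add: continuous_on_eq_continuous_at)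
  have "\<forall>\<^sub>F s in at (0::complex). \<forall>j. \<delta> (u0 + v + s *s axis j 1) \<noteq> 0"
  proof (intro eventually_all_finite allI)
    fix j
    have "((\<lambda>s. \<delta> (u0 + v + s *s axis j 1)) \<longlongrightarrow> \<delta> (u0 + v + 0 *s axis j 1)) (at 0)"
      using polyfun_field_differentiable_line[OF \<delta>, of "u0 + v" "axis j 1" 0]
      by (metis field_differentiable_imp_continuous_at isCont_def)
    then show "\<forall>\<^sub>F s in at 0. \<delta> (u0 + v + s *s axis j 1) \<noteq> 0"
      using tendsto_imp_eventually_ne nz by (fastforce simp: v_def)
  qed
  moreover have "\<forall>\<^sub>F s in at (0::complex). s \<noteq> 0 \<and> s \<noteq> - T"
    by (intro eventually_conj) (auto simp: eventually_neq_at_within eventually_at_filter)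
  ultimately have "\<forall>\<^sub>F s in at (0::complex). (\<forall>j. \<delta> (u0 + v + s *s axis j 1) \<noteq> 0) \<and> s \<noteq> 0 \<and> s \<noteq> - T"
    by (rule eventually_conj)
  then obtain s :: complex where s: "\<And>j. \<delta> (u0 + v + s *s axis j 1) \<noteq> 0" "s \<noteq> 0" "s + T \<noteq> 0"
    using eventually_happens'[OF at_neq_bot] by (force simp: eq_neg_iff_add_eq_0)
  \<comment> \<open>The vectors \<open>b j\<close> form a basis because \<open>s\<close> and \<open>s + T\<close> do not vanish; \<open>A\<close> is the change of
    coordinates to this basis and \<open>B\<close> its inverse.\<close>
  define b where "b = (\<lambda>j. v + s *s axis j 1)"
  have "\<forall>\<^sub>F u in nhds u0. u \<in> D \<and> (\<forall>j. \<delta> (u + b j) \<noteq> 0)"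
  proof (intro eventually_conj eventually_all_finite)
    show "\<forall>\<^sub>F u in nhds u0. u \<in> D" using D u0 eventually_nhds by blast
    fix j
    have "continuous_on UNIV (\<lambda>u. \<delta> (u + b j))"
      by (intro continuous_on_compose2[OF polyfun_continuous_on[OF \<delta>, of UNIV]] continuous_intros) auto
    then have "open {u. \<delta> (u + b j) \<noteq> 0}"
      using open_Collect_neq[of "\<lambda>u. \<delta> (u + b j)" "\<lambda>u. 0"] by simp
    moreover have "\<delta> (u0 + b j) \<noteq> 0" using s(1)[of j] by (simp add: b_def add.assoc)
    ultimately show "\<forall>\<^sub>F u in nhds u0. \<delta> (u + b j) \<noteq> 0"
      using eventually_nhds_in_open[of "{u. \<delta> (u + b j) \<noteq> 0}" u0] by simp
  qed
  then obtain U where U: "open U" "u0 \<in> U" "\<And>u. u \<in> U \<Longrightarrow> u \<in> D \<and> (\<forall>j. \<delta> (u + b j) \<noteq> 0)"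
    unfolding eventually_nhds by blast
  define A where "A = (\<lambda>z::complex^'d. s *s z + (\<Sum>j\<in>UNIV. z $ j) *s v)"
  define B where "B = (\<lambda>y::complex^'d. (1 / s) *s (y - ((\<Sum>j\<in>UNIV. y $ j) / (s + T)) *s v))"
  have linA: "Vector_Spaces.linear (*s) (*s) A" and linB: "Vector_Spaces.linear (*s) (*s) B"
    unfolding A_def B_def
    by (intro clinear_mapI; simp add: vec_eq_iff sum.distrib algebra_simps add_divide_distrib
         flip: sum_distrib_left)+
  have AB: "A (B y) = y" for y
  proof -
    define c where "c = (\<Sum>j\<in>UNIV. y $ j) / (s + T)"
    have Bj: "B y $ j = (y $ j - c * v $ j) / s" for j
      by (simp add: B_def c_def diff_divide_distrib)
    have "(\<Sum>j\<in>UNIV. B y $ j) = ((\<Sum>j\<in>UNIV. y $ j) - c * T) / s"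
      by (simp only: Bj T_def sum_distrib_left sum_subtractf[symmetric] sum_divide_distrib)
    also have "\<dots> = ((\<Sum>j\<in>UNIV. y $ j) - ((\<Sum>j\<in>UNIV. y $ j) / (s + T)) * T) / s"
      by (simp only: c_def)
    also have "\<dots> = (\<Sum>j\<in>UNIV. y $ j) / (s + T)"
    proof -
      have "T = (s + T) - s" by simp
      moreover have "(Y - Y / k * (k - s)) / s = Y / k" if "k \<noteq> 0" for Y k
        using that s(2) by (simp add: field_simps)
      ultimately show ?thesis using s(3) by metis
    qed
    finally have "(\<Sum>j\<in>UNIV. B y $ j) = c" by (simp only: c_def)
    then have "A (B y) $ i = s * B y $ i + c * v $ i" for i by (simp only: A_def) simp
    then show ?thesis using s(2) by (simp only: vec_eq_iff Bj) simp
  qed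
  let ?g = "\<lambda>z. f (A z)" and ?D' = "{z. A z \<in> U}"
  have cA: "continuous_on UNIV A"
    using linA holomorphic_map_clinear holomorphic_map_imp_continuous_on by blast
  have D': "open ?D'"
    using continuous_open_preimage[OF cA open_UNIV U(1)] by (simp add: vimage_def)
  have hol': "holomorphic_fun ?D' ?g"
  proof (rule osgood[OF D'])
    show "continuous_on ?D' ?g"
      by (intro continuous_on_compose2[OF cf continuous_on_subset[OF cA]]) (use U in auto)
    fix z :: "complex^'d" and j assume z: "z \<in> ?D'"
    have Aj: "A (z + t *s axis j 1) = A z + t *s b j" for t
    proof -
      have "(\<Sum>k\<in>UNIV. (axis j 1 :: complex^'d) $ k) = 1" by (simp add: axis_def)
      then show ?thesis
        by (simp add: A_def b_def vec_eq_iff sum.distrib algebra_simps flip: sum_distrib_left)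
    qed
    let ?S = "{t. A z + t *s b j \<in> U}" and ?K = "{t. \<delta> (A z + t *s b j) = 0}"
    have oS: "open ?S" by (rule open_line_slice[OF U(1)])
    have "finite ?K"
      by (rule polyfun_line_finite_zeros[OF \<delta>, of "A z" 1]) (use U z in simp)
    moreover have "continuous_on ?S (\<lambda>t. f (A z + t *s b j))"
      by (intro continuous_on_compose2[OF cf] continuous_intros) (use U in auto)
    moreover have "(\<lambda>t. f (A z + t *s b j)) holomorphic_on (?S - ?K)"
      by (rule holomorphic_on_subset[OF holomorphic_fun_line[OF hol]]) (use U in auto)
    ultimately have "(\<lambda>t. f (A z + t *s b j)) holomorphic_on ?S"
      using no_isolated_singularity oS by blast
    then show "(\<lambda>t. ?g (z + t *s axis j 1)) field_differentiable at 0"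
      using oS z by (auto simp: Aj holomorphic_on_open field_differentiable_def)
  qed
  have "holomorphic_fun U (\<lambda>y. ?g (B y))"
    by (rule holomorphic_fun_compose[OF hol' holomorphic_map_clinear[OF linB]]) (auto simp: AB)
  then show "\<exists>U. u0 \<in> U \<and> holomorphic_fun U f" using U(2) by (auto simp: AB)
qed

section \<open>Change of variables for holomorphic maps\<close>

subsection \<open>Real coordinates\<close>

text \<open>The type \<open>'d bit0\<close> has twice as many elements as \<open>'d\<close>, so \<open>real^('d bit0)\<close> carries the real
  coordinates of \<open>complex^'d\<close>.  The numbering of the coordinates is arbitrary.\<close>

definition real_index :: "complex^'d \<Rightarrow> 'd bit0" where
  "real_index = (SOME h. bij_betw h Basis UNIV)"

definition realify :: "complex^'d \<Rightarrow> real^('d bit0)" where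
  "realify x = (\<chi> i. x \<bullet> inv_into Basis real_index i)"

definition complexify :: "real^('d bit0) \<Rightarrow> complex^'d" where
  "complexify y = (\<Sum>b\<in>Basis. (y $ real_index b) *\<^sub>R b)"

lemma bij_real_index: "bij_betw real_index (Basis :: (complex^'d) set) UNIV"
proof -
  have "card (Basis :: (complex^'d) set) = card (UNIV :: 'd bit0 set)" by simp
  then have "\<exists>h. bij_betw h (Basis :: (complex^'d) set) (UNIV :: 'd bit0 set)"
    by (intro finite_same_card_bij) auto
  then show ?thesis unfolding real_index_def by (rule someI_ex)
qed

lemma realify_nth: "b \<in> Basis \<Longrightarrow> realify x $ real_index b = x \<bullet> b"
  by (simp add: realify_def inv_into_f_f[OF bij_betw_imp_inj_on[OF bij_real_index]])

lemma complexify_inner: "b \<in> Basis \<Longrightarrow> complexify y \<bullet> b = y $ real_index b"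
  by (simp add: complexify_def inner_sum_left_Basis)

lemma real_index_cases: obtains b :: "complex^'d" where "b \<in> Basis" "i = real_index b"
  using bij_real_index by (metis UNIV_I bij_betw_imp_surj_on imageE)

lemma realify_eqI: "(\<And>b. b \<in> Basis \<Longrightarrow> y $ real_index b = y' $ real_index b) \<Longrightarrow> y = y'"
  for y :: "real^('d::finite bit0)"
  by (metis real_index_cases vec_eq_iff)

lemma complexify_realify [simp]: "complexify (realify x) = x"
  by (rule euclidean_eqI) (simp add: complexify_inner realify_nth)

lemma realify_complexify [simp]: "realify (complexify y) = y"
  by (rule realify_eqI) (simp add: complexify_inner realify_nth)

lemma linear_realify: "linear realify"
  by (rule linearI) (simp_all add: realify_def vec_eq_iff inner_add_left)

lemma linear_complexify: "linear complexify"
  by (rule linearI) (simp_all add: complexify_def scaleR_add_left sum.distrib scaleR_sum_right)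

lemma bounded_linear_realify: "bounded_linear realify"
  using linear_realify linear_conv_bounded_linear by blast

lemma bounded_linear_complexify: "bounded_linear complexify"
  using linear_complexify linear_conv_bounded_linear by blast

lemma norm_realify: "norm (realify x) = norm (x :: complex^'d)"
proof -
  have "realify x \<bullet> realify x = (\<Sum>b\<in>Basis. (realify x $ real_index b) * (realify x $ real_index b))"
    unfolding inner_vec_def inner_real_def
    by (rule sum.reindex_bij_betw[OF bij_real_index, symmetric])
  also have "\<dots> = x \<bullet> x"
    unfolding euclidean_inner[of x x] by (rule sum.cong) (simp_all add: realify_nth)
  finally show ?thesis by (simp only: norm_eq_sqrt_inner)
qed

lemma norm_complexify: "norm (complexify y) = norm y"
  using norm_realify[of "complexify y"] by simp

lemma measurable_realify [measurable]: "realify \<in> borel_measurable borel"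
  by (intro borel_measurable_continuous_onI linear_continuous_on bounded_linear_realify)

lemma measurable_complexify [measurable]: "complexify \<in> borel_measurable borel"
  by (intro borel_measurable_continuous_onI linear_continuous_on bounded_linear_complexify)

lemma lborel_realify: "distr lborel borel (realify :: complex^'d \<Rightarrow> _) = lborel"
proof (rule lborel_eqI[symmetric])
  fix l u :: "real^('d bit0)"
  assume le: "\<And>b. b \<in> Basis \<Longrightarrow> l \<bullet> b \<le> u \<bullet> b"
  have le': "l $ i \<le> u $ i" for i
    using le[of "axis i 1"] by (simp add: inner_axis axis_in_Basis_iff)
  have vim: "realify -` box l u = box (complexify l) (complexify u)"
  proof -
    have "realify x \<in> box l u \<longleftrightarrow> (\<forall>b\<in>Basis. l $ real_index b < x \<bullet> b \<and> x \<bullet> b < u $ real_index b)"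
      for x :: "complex^'d"
      unfolding mem_box_cart by (metis real_index_cases realify_nth)
    then show ?thesis by (auto simp: mem_box complexify_inner)
  qed
  have "emeasure (distr lborel borel realify) (box l u)
      = emeasure lborel (box (complexify l) (complexify u))"
    by (simp add: emeasure_distr vim)
  also have "\<dots> = ennreal (\<Prod>b\<in>Basis. (complexify u - complexify l) \<bullet> b)"
    by (rule emeasure_lborel_box) (simp add: complexify_inner le')
  also have "(\<Prod>b\<in>Basis. (complexify u - complexify l) \<bullet> b)
      = (\<Prod>b\<in>Basis. (u - l) $ real_index b)"
    by (simp add: inner_diff_left complexify_inner)
  also have "\<dots> = (\<Prod>i\<in>UNIV. (u - l) $ i)"
    by (rule prod.reindex_bij_betw[OF bij_real_index])
  also have "\<dots> = (\<Prod>b\<in>Basis. (u - l) \<bullet> b)"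
  proof -
    have "measure lborel (cbox l u) = (\<Prod>i\<in>UNIV. u $ i - l $ i)"
      using content_cbox_cart[of l u] le' by (simp add: interval_ne_empty_cart)
    moreover have "measure lborel (cbox l u) = (\<Prod>b\<in>Basis. (u - l) \<bullet> b)"
      using content_cbox[of l u] le by (simp add: inner_diff_left)
    ultimately show ?thesis by simp
  qed
  finally show "emeasure (distr lborel borel realify) (box l u) = (\<Prod>b\<in>Basis. (u - l) \<bullet> b)" .
qed simp

subsection \<open>The real determinant of a complex matrix\<close>

text \<open>The factor by which a complex matrix multiplies the real volume.\<close>

definition rdet :: "complex^'d^'d \<Rightarrow> real" where
  "rdet A = \<bar>det (matrix (\<lambda>y. realify (A *v complexify y)))\<bar>"

lemma linear_matrix_vector: "linear (\<lambda>x. (A::complex^'d^'e) *v x)"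
  by (rule linearI) (simp_all add: matrix_vector_right_distrib scaleR_eq_smult vector_scalar_commute)

lemma linear_conj: "linear (\<lambda>y. realify ((A::complex^'d^'d) *v complexify y))"
  using linear_compose[OF linear_compose[OF linear_complexify linear_matrix_vector[of A]] linear_realify]
  by (simp add: o_def)

lemma rdet_mult: "rdet (A ** B) = rdet A * rdet B"
proof -
  have "(\<lambda>y. realify ((A ** B) *v complexify y))
      = (\<lambda>y. realify (A *v complexify y)) \<circ> (\<lambda>y. realify (B *v complexify y))"
    by (auto simp: fun_eq_iff matrix_vector_mul_assoc)
  then show ?thesis
    unfolding rdet_def by (simp add: matrix_compose[OF linear_conj linear_conj] det_mul abs_mult)
qed

lemma rdet_isometry:
  assumes "\<And>x. norm (A *v x) = norm x"
  shows "rdet A = 1"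
  unfolding rdet_def
  by (rule orthogonal_transformation_det)
     (simp add: orthogonal_transformation linear_conj norm_realify norm_complexify assms)

lemma rdet_one [simp]: "rdet (mat 1) = 1"
  by (rule rdet_isometry) simp

lemma rdet_nonneg: "0 \<le> rdet A"
  by (simp add: rdet_def)

text \<open>The identity matrix with column \<open>k\<close> replaced by \<open>w\<close>.\<close>

definition replace_column :: "'d \<Rightarrow> complex^'d \<Rightarrow> complex^'d^'d" where
  "replace_column k w = (\<chi> i j. if j = k then w $ i else if i = j then 1 else 0)"

lemma replace_column_vector:
  "replace_column k w *v x = x + (x $ k) *s (w - axis k 1)"
proof -
  have "(\<Sum>j\<in>UNIV. (if j = k then w $ i else if i = j then 1 else 0) * x $ j)
      = (\<Sum>j\<in>UNIV. (if j = k then (w $ i - (if i = k then 1 else 0)) * x $ j else 0)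
            + (if i = j then x $ j else 0))" for i
    by (rule sum.cong) (auto simp: left_diff_distrib)
  then show ?thesis
    by (auto simp: replace_column_def matrix_vector_mult_def vec_eq_iff sum.distrib axis_def algebra_simps)
qed

lemma det_replace_column: "det (replace_column k w) = w $ k"
  using cramer_lemma[of k "mat 1" w] unfolding matrix_vector_mul_lid det_I
  by (simp add: replace_column_def mat_def cong: if_cong)

lemma matrix_eqI: "(\<And>x. A *v x = B *v x) \<Longrightarrow> A = (B::complex^'d^'e)"
  by (simp add: matrix_eq)

lemma rdet_replace_column_real:
  fixes k :: "'d::finite"
  assumes "r > 0"
  shows "rdet (replace_column k (axis k (complex_of_real r))) = r\<^sup>2"
proof -
  let ?D = "replace_column k (axis k (complex_of_real r))"
  define c where "c = (\<lambda>b::complex^'d. if b \<in> {axis k 1, axis k \<i>} then r else 1)"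
  have Db: "?D *v b = c b *\<^sub>R b" if "b \<in> Basis" for b
  proof -
    obtain j u where b: "b = axis j u" "u \<in> {1, \<i>}"
      using \<open>b \<in> Basis\<close> by (auto simp: Basis_vec_def Basis_complex_def)
    show ?thesis
    proof (cases "j = k")
      case True
      have "c b = r" using b True by (auto simp: c_def)
      moreover have "?D *v b = complex_of_real r *s b"
        unfolding replace_column_vector vec_eq_iff
        by (simp add: b(1) True axis_def left_diff_distrib)
      ultimately show ?thesis by (simp add: scaleR_eq_smult)
    next
      case False
      have "c b = 1" using b False by (auto simp: c_def axis_eq_axis)
      moreover have "b $ k = 0" using b(1) False by (simp add: axis_def)
      ultimately show ?thesis by (simp add: replace_column_vector)
    qed
  qed
  have bi: "complexify (axis (real_index b) 1) = b" if "b \<in> Basis" for b :: "complex^'d"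
  proof (rule euclidean_eqI)
    fix b' :: "complex^'d" assume "b' \<in> Basis"
    then show "complexify (axis (real_index b) 1) \<bullet> b' = b \<bullet> b'"
      using that bij_real_index
      by (auto simp: complexify_inner axis_def inner_Basis bij_betw_def inj_on_def)
  qed
  have ent: "matrix (\<lambda>y. realify (?D *v complexify y)) $ real_index b' $ real_index b
      = (if b = b' then c b else 0)" if "b \<in> Basis" "b' \<in> Basis" for b b'
    using that by (simp add: matrix_def bi Db realify_nth inner_Basis)
  have "det (matrix (\<lambda>y. realify (?D *v complexify y)))
      = (\<Prod>i\<in>UNIV. matrix (\<lambda>y. realify (?D *v complexify y)) $ i $ i)"
  proof (rule det_diagonal)
    fix i j :: "'d bit0" assume "i \<noteq> j"
    then show "matrix (\<lambda>y. realify (?D *v complexify y)) $ i $ j = 0"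
      by (metis ent real_index_cases)
  qed
  also have "\<dots> = (\<Prod>b\<in>Basis. matrix (\<lambda>y. realify (?D *v complexify y)) $ real_index b $ real_index b)"
    by (rule prod.reindex_bij_betw[OF bij_real_index, symmetric])
  also have "\<dots> = (\<Prod>b\<in>Basis. c b)" by (simp add: ent)
  also have "\<dots> = (\<Prod>b\<in>{axis k 1, axis k \<i>}. c b)"
    by (rule prod.mono_neutral_right) (auto simp: c_def axis_in_Basis_iff Basis_complex_def)
  also have "\<dots> = r\<^sup>2"
    by (simp add: c_def axis_eq_axis power2_eq_square)
  finally show ?thesis by (simp add: rdet_def)
qed

text \<open>The matrix factors into a real dilation of one coordinate, a rotation of that coordinate and a
  shear \<open>U\<close>.  The shear is conjugate to its inverse under the reflection in the same coordinate, hence has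
  real determinant one.\<close>

lemma rdet_replace_column:
  assumes "w $ k \<noteq> 0"
  shows "rdet (replace_column k w) = (cmod (w $ k))\<^sup>2"
proof -
  define c where "c = w $ k"
  define r where "r = cmod c"
  have c: "c \<noteq> 0" "r > 0" using assms by (auto simp: c_def r_def)
  define w' where "w' = (\<chi> i. if i = k then 1 else w $ i)"
  let ?U = "replace_column k w'" and ?R = "replace_column k (- axis k 1)"
  have "?R ** ?R = mat 1"
    by (rule matrix_eqI) (simp add: matrix_vector_mul_assoc[symmetric] replace_column_vector vec_eq_iff axis_def)
  then have R: "rdet ?R * rdet ?R = 1"
    using rdet_mult[of ?R ?R] by simp
  have "?U ** (?R ** (?U ** ?R)) = mat 1"
    by (rule matrix_eqI)
       (simp add: matrix_vector_mul_assoc[symmetric] replace_column_vector vec_eq_iff axis_def w'_def algebra_simps)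
  then have "rdet ?U * (rdet ?R * (rdet ?U * rdet ?R)) = 1"
    using rdet_mult[of ?U "?R ** (?U ** ?R)"] by (simp only: rdet_mult rdet_one)
  then have "(rdet ?U)\<^sup>2 = 1" using R by (simp add: power2_eq_square algebra_simps)
  then have U: "rdet ?U = 1" using rdet_nonneg[of ?U] by (simp add: power2_eq_1_iff)
  let ?D1 = "replace_column k (axis k (complex_of_real r))" and ?D2 = "replace_column k (axis k (c / r))"
  have "norm (?D2 *v x) = norm x" for x
  proof -
    have "cmod ((?D2 *v x) $ i) = cmod (x $ i)" for i
    proof (cases "i = k")
      case True
      then have "(?D2 *v x) $ i = c / r * x $ i"
        by (simp add: replace_column_vector axis_def algebra_simps)
      then show ?thesis using c by (simp add: norm_mult norm_divide r_def)
    qed (simp add: replace_column_vector axis_def)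
    then show ?thesis by (simp add: norm_vec_def)
  qed
  then have D2: "rdet ?D2 = 1" by (rule rdet_isometry)
  have "replace_column k w = ?D1 ** (?D2 ** ?U)"
    using c
    by (intro matrix_eqI)
       (simp add: matrix_vector_mul_assoc[symmetric] replace_column_vector vec_eq_iff axis_def w'_def c_def algebra_simps)
  then have "rdet (replace_column k w) = rdet ?D1 * (rdet ?D2 * rdet ?U)"
    by (simp only: rdet_mult)
  then show ?thesis
    unfolding rdet_replace_column_real[OF c(2), of k] U D2 by (simp add: r_def c_def)
qed

text \<open>Every invertible matrix is a product of matrices that differ from the identity in a single
  column; the determinant and the real determinant are both multiplicative, and for such a factor
  both can be read off from the diagonal entry.\<close>

theorem rdet_eq: "rdet A = (cmod (det A))\<^sup>2"
proof (cases "det A = 0")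
  case True
  have "\<not> inj (\<lambda>y. realify (A *v complexify y))"
  proof
    assume inj: "inj (\<lambda>y. realify (A *v complexify y))"
    have "inj ((*v) A)"
    proof (rule injI)
      fix x y assume "A *v x = A *v y"
      then have "realify (A *v complexify (realify x)) = realify (A *v complexify (realify y))" by simp
      then have "realify x = realify y" by (rule injD[OF inj])
      then show "x = y" by (metis complexify_realify)
    qed
    then have "invertible A"
      using invertible_left_inverse matrix_left_invertible_injective by blast
    then show False using True invertible_det_nz by blast
  qed
  then have "rdet A = 0" unfolding rdet_def using det_nz_iff_inj[OF linear_conj] by auto
  then show ?thesis using True by simp
next
  case False
  have "rdet B = (cmod (det B))\<^sup>2"
    if "invertible B" "\<And>j. j \<notin> S \<Longrightarrow> B *v axis j 1 = axis j 1" for S :: "'a set" and B :: "complex^'a^'a"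
  proof -
    have "finite S" by simp
    then show ?thesis using that
    proof (induction S arbitrary: B rule: finite_induct)
      case empty
      have "B = mat 1"
      proof (rule matrix_eqI)
        fix x :: "complex^'a"
        have "B *v x = B *v (\<Sum>j\<in>UNIV. x $ j *s axis j 1)" by (simp add: basis_expansion)
        also have "\<dots> = (\<Sum>j\<in>UNIV. x $ j *s axis j 1)"
          using empty by (simp add: linear_sum[OF linear_matrix_vector] vector_scalar_commute)
        finally show "B *v x = mat 1 *v x" by (simp add: basis_expansion)
      qed
      then show ?case by simp
    next
      case (insert k S)
      have pivot: "rdet B = (cmod (det B))\<^sup>2"
        if B: "invertible B" "\<And>j. j \<notin> insert k S \<Longrightarrow> B *v axis j 1 = axis j 1"
          and w: "(B *v axis k 1) $ k \<noteq> 0" for B :: "complex^'a^'a"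
      proof -
        let ?E = "replace_column k (B *v axis k 1)"
        have "invertible ?E" using w by (simp add: invertible_det_nz det_replace_column)
        then obtain E' where E': "E' ** ?E = mat 1" "?E ** E' = mat 1"
          unfolding invertible_def by blast
        have E'E: "E' *v (?E *v x) = x" for x by (simp add: matrix_vector_mul_assoc E')
        have "rdet (E' ** B) = (cmod (det (E' ** B)))\<^sup>2"
        proof (rule insert.IH)
          show "invertible (E' ** B)"
            using B(1) E' by (metis invertible_def invertible_mult)
          fix j assume j: "j \<notin> S"
          have "?E *v axis j 1 = B *v axis j 1"
            using B(2)[of j] j by (cases "j = k") (auto simp: replace_column_vector axis_def vec_eq_iff)
          then show "(E' ** B) *v axis j 1 = axis j 1"
            using E'E[of "axis j 1"] by (simp add: matrix_vector_mul_assoc[symmetric])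
        qed
        moreover have "B = ?E ** (E' ** B)" by (simp add: matrix_mul_assoc E')
        ultimately show ?thesis
          using rdet_mult[of ?E "E' ** B"] det_mul[of ?E "E' ** B"] rdet_replace_column[OF w]
          by (metis det_replace_column norm_mult power_mult_distrib)
      qed
      show ?case
      proof (cases "(B *v axis k 1) $ k = 0")
        case False
        then show ?thesis using pivot insert.prems by blast
      next
        case True
        have "\<exists>m\<in>S. (B *v axis k 1) $ m \<noteq> 0"
        proof (rule ccontr)
          assume "\<not> ?thesis"
          then have z: "(B *v axis k 1) $ m = 0" if "m \<in> insert k S" for m using True that by auto
          let ?w = "B *v axis k 1"
          have "B *v ?w = B *v (\<Sum>j\<in>UNIV. ?w $ j *s axis j 1)" by (simp add: basis_expansion)
          also have "\<dots> = (\<Sum>j\<in>UNIV. ?w $ j *s (B *v axis j 1))"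
            by (simp add: linear_sum[OF linear_matrix_vector] vector_scalar_commute)
          also have "\<dots> = (\<Sum>j\<in>UNIV. ?w $ j *s axis j 1)"
          proof (rule sum.cong)
            fix j
            show "?w $ j *s (B *v axis j 1) = ?w $ j *s axis j 1"
              using z[of j] insert.prems(2)[of j] by (cases "j \<in> insert k S") auto
          qed simp
          also have "\<dots> = B *v axis k 1" by (simp add: basis_expansion)
          finally have "?w = axis k 1"
            using insert.prems(1) by (metis invertible_def matrix_vector_mul_assoc matrix_vector_mul_lid)
          then show False using True by (simp add: axis_def)
        qed
        then obtain m where m: "m \<in> S" "(B *v axis k 1) $ m \<noteq> 0" by blast
        \<comment> \<open>Adding row \<open>m\<close> to row \<open>k\<close> makes the pivot nonzero.\<close>
        have mk: "m \<noteq> k" using m insert.hyps by auto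
        let ?F = "replace_column m (axis m 1 + axis k 1)"
        have Fm: "(axis m 1 + axis k (1::complex)) $ m = 1" using mk by (simp add: axis_def)
        have "rdet (?F ** B) = (cmod (det (?F ** B)))\<^sup>2"
        proof (rule pivot)
          show "invertible (?F ** B)"
            by (intro invertible_mult insert.prems) (simp add: invertible_det_nz det_replace_column Fm del: vector_add_component)
          show "(?F ** B) *v axis j 1 = axis j 1" if "j \<notin> insert k S" for j
          proof -
            have "j \<noteq> m" using that m by auto
            then show ?thesis using insert.prems(2)[OF that]
              by (simp add: matrix_vector_mul_assoc[symmetric] replace_column_vector) (simp add: axis_def)
          qed
          show "((?F ** B) *v axis k 1) $ k \<noteq> 0"
            using m True mk
            by (simp add: matrix_vector_mul_assoc[symmetric] replace_column_vector axis_def)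
        qed
        then show ?thesis
          using rdet_replace_column[of "axis m 1 + axis k 1" m] Fm
          by (simp add: rdet_mult det_mul det_replace_column del: vector_add_component)
      qed
    qed
  qed
  from this[of A UNIV] False show ?thesis by (simp add: invertible_det_nz)
qed

subsection \<open>Images of sets under injective holomorphic maps\<close>

lemma emeasure_realify_image:
  assumes "T \<in> sets borel"
  shows "emeasure lborel (realify ` T) = emeasure lborel T" "realify ` T \<in> sets borel"
proof -
  have eq: "realify ` T = complexify -` T" by (force simp: image_iff)
  then show b: "realify ` T \<in> sets borel"
    using measurable_sets[OF measurable_complexify assms] by simp
  have "emeasure lborel (realify ` T) = emeasure lborel (realify -` realify ` T \<inter> space lborel)"
    by (subst lborel_realify[symmetric], subst emeasure_distr) (use b in auto)
  also have "realify -` realify ` T = T"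
    by (metis complexify_realify inj_on_inverseI inj_vimage_image_eq)
  finally show "emeasure lborel (realify ` T) = emeasure lborel T" by simp
qed

theorem emeasure_holomorphic_image:
  fixes g :: "complex^'d \<Rightarrow> complex^'d"
  assumes S: "S \<in> sets borel"
    and der: "\<And>x. x \<in> S \<Longrightarrow> (g has_derivative (\<lambda>h. A x *v h)) (at x)"
    and inj: "inj_on g S"
    and gS: "g ` S \<in> sets borel" "emeasure lborel (g ` S) < \<infinity>"
    and [measurable]: "(\<lambda>x. det (A x)) \<in> borel_measurable borel"
  shows "emeasure lborel (g ` S) = (\<integral>\<^sup>+x. ennreal ((cmod (det (A x)))\<^sup>2) * indicator S x \<partial>lborel)"
proof -
  note [measurable] = S
  let ?S = "realify ` S" and ?g = "\<lambda>y. realify (g (complexify y))"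
  let ?g' = "\<lambda>y h. realify (A (complexify y) *v complexify h)"
  have Sb [measurable]: "?S \<in> sets borel" using emeasure_realify_image[OF S] by simp
  have im: "?g ` ?S = realify ` (g ` S)" by (force simp: image_iff)
  have fin: "emeasure lborel (?g ` ?S) = emeasure lborel (g ` S)" "?g ` ?S \<in> sets borel"
    unfolding im using emeasure_realify_image[OF gS(1)] by auto
  have "?g ` ?S \<in> lmeasurable"
    using fin gS(2) by (simp add: fmeasurable_def)
  moreover have "(?g has_derivative ?g' y) (at y within ?S)" if y: "y \<in> ?S" for y
  proof -
    obtain x where x: "x \<in> S" "y = realify x" using y by blast
    have "(complexify has_derivative complexify) (at y within ?S)"
      by (rule bounded_linear_imp_has_derivative[OF bounded_linear_complexify])
    moreover have "(g has_derivative (\<lambda>h. A x *v h)) (at (complexify y))"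
      using der[OF x(1)] x by simp
    ultimately have "((\<lambda>y. g (complexify y)) has_derivative (\<lambda>h. A x *v complexify h)) (at y within ?S)"
      by (rule has_derivative_compose)
    from bounded_linear.has_derivative[OF bounded_linear_realify this]
    show ?thesis using x by simp
  qed
  moreover have "inj_on ?g ?S"
    using inj by (auto simp: inj_on_def) (metis complexify_realify)
  ultimately have "((\<lambda>y. \<bar>det (matrix (?g' y))\<bar>) has_integral measure lebesgue (?g ` ?S)) ?S"
    using has_measure_differentiable_image[of ?S ?g ?g' "measure lebesgue (?g ` ?S)"] Sb by auto
  then have "(\<integral>\<^sup>+y. ennreal \<bar>det (matrix (?g' y))\<bar> * indicator ?S y \<partial>lborel)
      = ennreal (measure lebesgue (?g ` ?S))"
    by (intro nn_integral_has_integral_lebesgue') auto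
  also have "\<dots> = emeasure lborel (g ` S)"
    using fin gS(2) by (simp add: measure_def)
  also have "(\<lambda>y. ennreal \<bar>det (matrix (?g' y))\<bar> * indicator ?S y)
      = (\<lambda>y. ennreal ((cmod (det (A (complexify y))))\<^sup>2) * indicator ?S y)"
    by (simp only: rdet_eq[symmetric] rdet_def)
  also have "(\<integral>\<^sup>+y. ennreal ((cmod (det (A (complexify y))))\<^sup>2) * indicator ?S y \<partial>lborel)
    = (\<integral>\<^sup>+x. ennreal ((cmod (det (A (complexify (realify x)))))\<^sup>2) * indicator ?S (realify x) \<partial>lborel)"
    by (subst lborel_realify[symmetric], subst nn_integral_distr) auto
  also have "\<dots> = (\<integral>\<^sup>+x. ennreal ((cmod (det (A x)))\<^sup>2) * indicator S x \<partial>lborel)"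
  proof (rule nn_integral_cong)
    fix x :: "complex^'d"
    have "realify x \<in> ?S \<longleftrightarrow> x \<in> S" by (metis complexify_realify imageE imageI)
    then show "ennreal ((cmod (det (A (complexify (realify x)))))\<^sup>2) * indicator ?S (realify x)
        = ennreal ((cmod (det (A x)))\<^sup>2) * indicator S x"
      by (simp add: indicator_def)
  qed
  finally show ?thesis by simp
qed

lemma has_derivative_matrix: "((*v) (A::complex^'d^'e) has_derivative (*v) A) F"
  by (intro bounded_linear_imp_has_derivative) (simp add: linear_matrix_vector linear_linear linear_conv_bounded_linear[symmetric])

lemma lborel_distr_matrix:
  fixes A :: "complex^'d^'d"
  assumes d: "cmod (det A) = 1"
  shows "distr lborel borel ((*v) A) = lborel"
proof (rule lborel_eqI[symmetric])
  have "invertible A" using d by (auto simp: invertible_det_nz)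
  then obtain B where B: "A ** B = mat 1" "B ** A = mat 1" unfolding invertible_def by blast
  have cont: "continuous_on UNIV ((*v) A)"
    using linear_matrix_vector[of A] by (simp add: linear_continuous_on linear_conv_bounded_linear)
  have meas [measurable]: "(*v) A \<in> borel_measurable borel"
    by (rule borel_measurable_continuous_onI[OF cont])
  fix l u :: "complex^'d"
  assume le: "\<And>b. b \<in> Basis \<Longrightarrow> l \<bullet> b \<le> u \<bullet> b"
  let ?Y = "(*v) A -` box l u"
  have Y: "?Y \<in> sets borel"
    using measurable_sets[OF meas, of "box l u"] by simp
  have AY: "(*v) A ` ?Y = box l u"
  proof -
    have "A *v (B *v y) = y" for y by (simp add: matrix_vector_mul_assoc B)
    then have "surj ((*v) A)" by (rule surjI)
    then show ?thesis by (rule surj_image_vimage_eq)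
  qed
  have inj: "inj_on ((*v) A) ?Y"
    by (rule inj_on_inverseI[of _ "(*v) B"]) (simp add: matrix_vector_mul_assoc B)
  have "emeasure lborel ((*v) A ` ?Y)
      = (\<integral>\<^sup>+x. ennreal ((cmod (det A))\<^sup>2) * indicator ?Y x \<partial>lborel)"
    by (rule emeasure_holomorphic_image[OF Y has_derivative_matrix inj])
       (simp_all only: AY emeasure_bounded_finite[OF bounded_box] borel_open[OF open_box] borel_measurable_const)
  then have "emeasure lborel (box l u) = emeasure lborel ?Y"
    unfolding AY d using Y by (simp add: AY)
  then show "emeasure (distr lborel borel ((*v) A)) (box l u) = (\<Prod>b\<in>Basis. (u - l) \<bullet> b)"
    using le by (simp add: emeasure_distr emeasure_lborel_box)
qed simp

section \<open>Mean values over balls\<close>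

lemma circle_mean_value:
  assumes U: "open U" "cball 0 1 \<subseteq> U" and h: "h holomorphic_on U"
  shows "((\<lambda>s. h (exp (2 * of_real pi * \<i> * of_real s))) has_integral h 0) {0..1}"
proof -
  have "((\<lambda>u. h u / (u - 0)) has_contour_integral 2 * of_real pi * \<i> * h 0) (circlepath 0 1)"
    by (rule Cauchy_integral_circlepath)
       (use continuous_on_subset[OF holomorphic_on_imp_continuous_on[OF h] U(2)]
          holomorphic_on_subset[OF h order_trans[OF ball_subset_cball U(2)]] in auto)
  then have "((\<lambda>s. h (circlepath 0 1 s) / (circlepath 0 1 s) *
        vector_derivative (circlepath 0 1) (at s within {0..1})) has_integral 2 * of_real pi * \<i> * h 0) {0..1}"
    by (simp only: has_contour_integral_def diff_0_right)
  then have "((\<lambda>s. 2 * of_real pi * \<i> * h (exp (2 * of_real pi * \<i> * of_real s)))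
      has_integral 2 * of_real pi * \<i> * h 0) {0..1}"
  proof (rule has_integral_eq[rotated])
    fix s :: real assume s: "s \<in> {0..1}"
    have "vector_derivative (circlepath 0 1) (at s within {0..1})
        = 2 * of_real pi * \<i> * exp (2 * of_real pi * \<i> * of_real s)"
      using vector_derivative_circlepath01[of s 0 1] s by simp
    then show "h (circlepath 0 1 s) / circlepath 0 1 s * vector_derivative (circlepath 0 1) (at s within {0..1})
        = 2 * of_real pi * \<i> * h (exp (2 * of_real pi * \<i> * of_real s))"
      by (simp only:) (simp add: circlepath)
  qed
  from has_integral_mult_right[OF this, of "1 / (2 * of_real pi * \<i>)"]
  show ?thesis by simp
qed

lemma circle_mean_value_bound:
  assumes U: "open U" "cball 0 1 \<subseteq> U" and h: "h holomorphic_on U"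
  shows "ennreal (cmod (h 0))
    \<le> (\<integral>\<^sup>+s. ennreal (cmod (h (exp (2 * of_real pi * \<i> * of_real s)))) * indicator {0..1} s \<partial>lborel)"
proof -
  let ?h = "\<lambda>s. h (exp (2 * of_real pi * \<i> * of_real s))"
  have cont: "continuous_on {0..1} ?h"
    by (intro continuous_on_compose2[OF holomorphic_on_imp_continuous_on[OF h]] continuous_intros)
       (use U in auto)
  have int: "(\<lambda>s. cmod (?h s)) integrable_on {0..1}"
    by (intro integrable_continuous_real continuous_on_norm cont)
  have "cmod (h 0) = cmod (integral {0..1} ?h)"
    using circle_mean_value[OF assms] by (simp add: integral_unique)
  also have "\<dots> \<le> integral {0..1} (\<lambda>s. cmod (?h s))"
    by (rule integral_norm_bound_integral) (use cont int integrable_continuous_real in auto)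
  also have "ennreal \<dots> = (\<integral>\<^sup>+s. ennreal (cmod (?h s)) * indicator {0..1} s \<partial>lborel)"
    by (rule nn_integral_has_integral_lebesgue'[symmetric]) (use int in auto)
  finally show ?thesis by (simp add: ennreal_leI)
qed

text \<open>The mean value inequality on circles is integrated over all centred circles, using that
  multiplication by a complex number of modulus one preserves both Lebesgue measure and the ball.\<close>

lemma ball_mean_value_bound:
  fixes f :: "complex^'d \<Rightarrow> complex"
  assumes f: "holomorphic_fun U f" and U: "open U" "ball z r \<subseteq> U"
  shows "ennreal (cmod (f z)) * emeasure lborel (ball (0::complex^'d) r)
     \<le> (\<integral>\<^sup>+y. ennreal (cmod (f (z + y))) * indicator (ball 0 r) y \<partial>lborel)"
proof -
  define e where "e = (\<lambda>s::real. exp (2 * of_real pi * \<i> * of_real s))"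
  have e1: "cmod (e s) = 1" for s by (simp add: e_def)
  have ce: "continuous_on UNIV e" unfolding e_def by (intro continuous_intros)
  define H where "H = (\<lambda>(y::complex^'d, s). ennreal (cmod (f (z + e s *s y))) * indicator (ball 0 r) y
                        * indicator {0..1} s)"
  have inU: "z + e s *s y \<in> U" if "y \<in> ball 0 r" for s y
    using that U(2) by (auto simp: dist_norm norm_vector_smult e1 subset_iff)
  have cf: "continuous_on U f" by (rule holomorphic_fun_imp_continuous_on[OF f])
  have H: "H \<in> borel_measurable (lborel \<Otimes>\<^sub>M lborel)"
  proof -
    let ?B = "ball (0::complex^'d) r \<times> (UNIV :: real set)"
    have sm: "continuous_on S (\<lambda>p. g p *s (h p :: complex^'d))"
      if "continuous_on S g" "continuous_on S h" for S :: "((complex^'d) \<times> real) set" and g h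
      using that by (simp add: vector_scalar_mult_def continuous_on_vec_lambda continuous_on_mult continuous_on_component)
    have "continuous_on ?B (\<lambda>p. z + e (snd p) *s fst p)"
      by (intro continuous_on_add continuous_on_const sm continuous_on_compose2[OF ce] continuous_on_fst
            continuous_on_snd continuous_on_id) auto
    then have "continuous_on ?B (\<lambda>p. cmod (f (z + e (snd p) *s fst p)))"
      by (intro continuous_on_norm continuous_on_compose2[OF cf]) (use inU in auto)
    then have "(\<lambda>p. indicator ?B p *\<^sub>R cmod (f (z + e (snd p) *s fst p))) \<in> borel_measurable borel"
      by (rule borel_measurable_continuous_on_indicator[rotated]) (simp add: open_Times)
    then have [measurable]: "(\<lambda>p. indicator ?B p *\<^sub>R cmod (f (z + e (snd p) *s fst p)))
         \<in> borel_measurable (borel \<Otimes>\<^sub>M borel)"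
      by (simp add: borel_prod)
    have sets: "borel_measurable (lborel \<Otimes>\<^sub>M lborel) = borel_measurable ((borel :: (complex^'d) measure) \<Otimes>\<^sub>M (borel :: real measure))"
      by (intro measurable_cong_sets sets_pair_measure_cong) auto
    have "(\<lambda>p. ennreal (indicator ?B p *\<^sub>R cmod (f (z + e (snd p) *s fst p))) * indicator {0..1} (snd p))
         \<in> borel_measurable (borel \<Otimes>\<^sub>M borel)" by measurable
    moreover have "H = (\<lambda>p. ennreal (indicator ?B p *\<^sub>R cmod (f (z + e (snd p) *s fst p))) * indicator {0..1} (snd p))"
      by (auto simp: H_def fun_eq_iff indicator_def)
    ultimately show ?thesis unfolding sets by metis
  qed
  have low: "ennreal (cmod (f z)) * indicator (ball 0 r) y \<le> (\<integral>\<^sup>+s. H (y, s) \<partial>lborel)" for y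
  proof (cases "y \<in> ball 0 r")
    case True
    let ?S = "{t. z + t *s y \<in> U}"
    have "z + t *s y \<in> U" if "cmod t \<le> 1" for t
    proof -
      have "norm (t *s y) \<le> norm y" using that mult_right_mono[of "cmod t" 1 "norm y"] by (simp add: norm_vector_smult)
      then show ?thesis using True U(2) by (auto simp: dist_norm subset_iff)
    qed
    then have sub: "cball 0 1 \<subseteq> ?S" by auto
    show ?thesis
      using circle_mean_value_bound[OF open_line_slice[OF U(1)] sub holomorphic_fun_line[OF f]] True
      by (simp add: H_def e_def)
  qed simp
  have rot: "(\<integral>\<^sup>+y. H (y, s) \<partial>lborel)
      = (\<integral>\<^sup>+y. ennreal (cmod (f (z + y))) * indicator (ball 0 r) y \<partial>lborel) * indicator {0..1} s" for s
  proof -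
    \<comment> \<open>Multiplication by \<open>e s\<close> is a complex linear map whose determinant has modulus one.\<close>
    let ?A = "\<chi> i j. if i = j then e s else 0 :: complex^'d^'d"
    have A: "?A *v y = e s *s y" for y
      by (simp add: matrix_vector_mult_def vec_eq_iff if_distrib if_distribR sum.delta cong: if_cong)
    have "det ?A = (\<Prod>i\<in>(UNIV::'d set). e s)" by (subst det_diagonal) auto
    then have dA: "cmod (det ?A) = 1" by (simp add: norm_power e1)
    let ?F = "\<lambda>y. ennreal (indicator (ball 0 r) y *\<^sub>R cmod (f (z + y)))"
    have F: "?F \<in> borel_measurable borel"
    proof -
      have "continuous_on (ball 0 r) (\<lambda>y. cmod (f (z + y)))"
        by (intro continuous_on_norm continuous_on_compose2[OF cf] continuous_intros)
           (use U(2) in \<open>auto simp: dist_norm subset_iff\<close>)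
      then have "(\<lambda>y. indicator (ball 0 r) y *\<^sub>R cmod (f (z + y))) \<in> borel_measurable borel"
        by (rule borel_measurable_continuous_on_indicator[rotated]) simp
      then show ?thesis by simp
    qed
    have mA: "(*v) ?A \<in> borel_measurable borel"
      by (intro borel_measurable_continuous_onI holomorphic_map_imp_continuous_on holomorphic_map_matrix)
    have "(\<integral>\<^sup>+y. ?F y \<partial>lborel) = (\<integral>\<^sup>+y. ?F (?A *v y) \<partial>lborel)"
      by (subst lborel_distr_matrix[OF dA, symmetric], subst nn_integral_distr) (use mA F in auto)
    also have "\<dots> = (\<integral>\<^sup>+y. ennreal (cmod (f (z + e s *s y))) * indicator (ball 0 r) y \<partial>lborel)"
      by (intro nn_integral_cong) (auto simp: A norm_vector_smult e1 indicator_def)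
    finally have 1: "(\<integral>\<^sup>+y. ennreal (cmod (f (z + e s *s y))) * indicator (ball 0 r) y \<partial>lborel)
        = (\<integral>\<^sup>+y. ?F y \<partial>lborel)" by simp
    have 2: "?F = (\<lambda>y. ennreal (cmod (f (z + y))) * indicator (ball 0 r) y)"
      by (auto simp: indicator_def fun_eq_iff)
    show ?thesis
      using 1 unfolding 2 by (cases "s \<in> {0..1}") (auto simp: H_def)
  qed
  have "ennreal (cmod (f z)) * emeasure lborel (ball (0::complex^'d) r)
      = (\<integral>\<^sup>+y. ennreal (cmod (f z)) * indicator (ball (0::complex^'d) r) y \<partial>lborel)"
    by (simp add: nn_integral_cmult_indicator)
  also have "\<dots> \<le> (\<integral>\<^sup>+y. \<integral>\<^sup>+s. H (y, s) \<partial>lborel \<partial>lborel)"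
    by (rule nn_integral_mono) (rule low)
  also have "\<dots> = (\<integral>\<^sup>+s. \<integral>\<^sup>+y. H (y, s) \<partial>lborel \<partial>lborel)"
    by (rule lborel_pair.Fubini[OF H, symmetric])
  also have "\<dots> = (\<integral>\<^sup>+y. ennreal (cmod (f (z + y))) * indicator (ball 0 r) y \<partial>lborel)"
    unfolding rot by (simp add: nn_integral_cmult_indicator)
  finally show ?thesis .
qed

section \<open>Existence of the weighted Bergman kernel\<close>

lemma scale_measure_eq_density: "scale_measure r M = density M (\<lambda>_. r)"
  by (rule measure_eqI) (auto simp: emeasure_density nn_integral_cmult_indicator)

text \<open>The volume is a multiple of Lebesgue measure.  The weight is locally bounded below by a positive
  constant only off the zero set of the polynomial \<open>\<delta>\<close>, because the weight on the quotient degenerates on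
  the image of the reflecting hyperplanes.\<close>

locale weighted_domain =
  fixes V :: "(complex^'d) measure" and D :: "(complex^'d) set" and \<nu> :: "complex^'d \<Rightarrow> real"
    and \<kappa> :: real and \<delta> :: "complex^'d \<Rightarrow> complex" and w0 :: "complex^'d"
  assumes V: "V = scale_measure (ennreal \<kappa>) lebesgue" and \<kappa>: "\<kappa> > 0"
    and D: "open D"
    and \<nu>: "set_borel_measurable V D \<nu>" "\<And>z. z \<in> D \<Longrightarrow> 0 \<le> \<nu> z"
    and \<delta>: "polyfun \<delta>" "\<delta> w0 \<noteq> 0"
    and below: "\<And>u. u \<in> D \<Longrightarrow> \<delta> u \<noteq> 0 \<Longrightarrow>
        \<exists>r>0. \<exists>c>0. ball u r \<subseteq> D \<and> (\<forall>x\<in>ball u r. c \<le> \<nu> x)"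
begin

text \<open>The square of the weighted norm.\<close>

definition sqn :: "(complex^'d \<Rightarrow> complex) \<Rightarrow> real" where
  "sqn f = (LINT w:D|V. (cmod (f w))\<^sup>2 * \<nu> w)"

definition ip :: "(complex^'d \<Rightarrow> complex) \<Rightarrow> (complex^'d \<Rightarrow> complex) \<Rightarrow> complex" where
  "ip f g = (LINT w:D|V. f w * cnj (g w) * complex_of_real (\<nu> w))"

lemma sets_V: "sets V = sets lebesgue" by (simp add: V)

lemma measurable_V: "borel_measurable V = borel_measurable lebesgue"
  by (rule measurable_cong_sets) (simp_all add: sets_V)

lemma continuous_set_borel_measurable:
  fixes f :: "complex^'d \<Rightarrow> 'b::real_normed_vector"
  assumes "continuous_on D f" shows "set_borel_measurable V D f"
proof -
  have "(\<lambda>x. indicator D x *\<^sub>R f x) \<in> borel_measurable borel"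
    by (rule borel_measurable_continuous_on_indicator[OF _ assms]) (use D in simp)
  then have "(\<lambda>x. indicator D x *\<^sub>R f x) \<in> borel_measurable lebesgue"
    by (intro measurable_completion) simp
  then show ?thesis by (simp add: set_borel_measurable_def measurable_V)
qed

lemma set_measurable_times:
  fixes f g :: "complex^'d \<Rightarrow> 'b::{real_normed_algebra,second_countable_topology}"
  assumes "set_borel_measurable V D f" "set_borel_measurable V D g"
  shows "set_borel_measurable V D (\<lambda>x. f x * g x)"
proof -
  have "(\<lambda>x. (indicator D x *\<^sub>R f x) * (indicator D x *\<^sub>R g x)) \<in> borel_measurable V"
    using assms unfolding set_borel_measurable_def by measurable
  moreover have "(\<lambda>x. (indicator D x *\<^sub>R f x) * (indicator D x *\<^sub>R g x)) = (\<lambda>x. indicator D x *\<^sub>R (f x * g x))"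
    by (auto simp: indicator_def)
  ultimately show ?thesis by (simp add: set_borel_measurable_def)
qed

lemma set_measurable_of_real_\<nu>: "set_borel_measurable V D (\<lambda>x. complex_of_real (\<nu> x))"
proof -
  have "(\<lambda>x. complex_of_real (indicator D x *\<^sub>R \<nu> x)) \<in> borel_measurable V"
    using \<nu>(1) unfolding set_borel_measurable_def by measurable
  moreover have "(\<lambda>x. complex_of_real (indicator D x *\<^sub>R \<nu> x)) = (\<lambda>x. indicator D x *\<^sub>R complex_of_real (\<nu> x))"
    by (auto simp: indicator_def)
  ultimately show ?thesis by (simp add: set_borel_measurable_def)
qed

lemma set_measurable_product:
  assumes f: "set_borel_measurable V D f" and g: "set_borel_measurable V D g"
  shows "set_borel_measurable V D (\<lambda>w. f w * cnj (g w) * complex_of_real (\<nu> w))"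
proof -
  have "set_borel_measurable V D (\<lambda>w. cnj (g w))"
  proof -
    have "(\<lambda>x. cnj (indicator D x *\<^sub>R g x)) \<in> borel_measurable V"
      using g unfolding set_borel_measurable_def
      by (intro borel_measurable_continuous_on[where f=cnj] continuous_intros) auto
    then show ?thesis by (simp add: set_borel_measurable_def complex_cnj_scaleR)
  qed
  then show ?thesis
    by (intro set_measurable_times f set_measurable_of_real_\<nu>)
qed

lemma L2_product_integrable:
  assumes f: "f \<in> L2 V D \<nu>" and g: "g \<in> L2 V D \<nu>"
  shows "set_integrable V D (\<lambda>w. f w * cnj (g w) * complex_of_real (\<nu> w))"
proof -
  have "set_integrable V D (\<lambda>w. (cmod (f w))\<^sup>2 * \<nu> w + (cmod (g w))\<^sup>2 * \<nu> w)"
    using f g by (intro set_integral_add) (auto simp: L2_def)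
  then show ?thesis
  proof (rule set_integrable_bound)
    show "set_borel_measurable V D (\<lambda>w. f w * cnj (g w) * complex_of_real (\<nu> w))"
      using f g by (intro set_measurable_product) (auto simp: L2_def)
    have "cmod (f w * cnj (g w) * complex_of_real (\<nu> w)) \<le> norm ((cmod (f w))\<^sup>2 * \<nu> w + (cmod (g w))\<^sup>2 * \<nu> w)"
      if w: "w \<in> D" for w
    proof -
      have "0 \<le> (cmod (f w) - cmod (g w))\<^sup>2" by simp
      then have "2 * (cmod (f w) * cmod (g w)) \<le> (cmod (f w))\<^sup>2 + (cmod (g w))\<^sup>2"
        by (simp add: power2_diff)
      then have "cmod (f w) * cmod (g w) \<le> (cmod (f w))\<^sup>2 + (cmod (g w))\<^sup>2"
        using mult_nonneg_nonneg[OF norm_ge_zero[of "f w"] norm_ge_zero[of "g w"]] by linarith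
      from mult_right_mono[OF this \<nu>(2)[OF w]] show ?thesis
        using \<nu>(2)[OF w] by (simp add: norm_mult distrib_right)
    qed
    then show "AE x in V. x \<in> D \<longrightarrow> norm (f x * cnj (g x) * complex_of_real (\<nu> x))
        \<le> norm ((cmod (f x))\<^sup>2 * \<nu> x + (cmod (g x))\<^sup>2 * \<nu> x)" by auto
  qed
qed

lemma A2_L2: "f \<in> A2 V D \<nu> \<Longrightarrow> f \<in> L2 V D \<nu>" by (simp add: A2_def)

lemma A2_product_integrable:
  "f \<in> A2 V D \<nu> \<Longrightarrow> g \<in> A2 V D \<nu> \<Longrightarrow> set_integrable V D (\<lambda>w. f w * cnj (g w) * complex_of_real (\<nu> w))"
  by (intro L2_product_integrable A2_L2)

lemma cmod2_conv: "complex_of_real ((cmod z)\<^sup>2 * x) = z * cnj z * complex_of_real x"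
  by (simp only: of_real_mult complex_norm_square)

lemma sqn_ip: "complex_of_real (sqn f) = ip f f"
proof -
  have "ip f f = (LINT w:D|V. complex_of_real ((cmod (f w))\<^sup>2 * \<nu> w))"
    unfolding ip_def cmod2_conv ..
  also have "\<dots> = (LINT w|V. complex_of_real (indicator D w *\<^sub>R ((cmod (f w))\<^sup>2 * \<nu> w)))"
    unfolding set_lebesgue_integral_def by (rule Bochner_Integration.integral_cong) (auto simp: indicator_def)
  also have "\<dots> = complex_of_real (sqn f)"
    unfolding sqn_def set_lebesgue_integral_def by (rule integral_complex_of_real)
  finally show ?thesis by simp
qed

lemma ip_cnj: "cnj (ip f g) = ip g f"
proof -
  have "cnj (ip f g) = (LINT w|V. cnj (indicator D w *\<^sub>R (f w * cnj (g w) * complex_of_real (\<nu> w))))"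
    unfolding ip_def set_lebesgue_integral_def by (rule Bochner_Integration.integral_cnj[symmetric])
  also have "\<dots> = ip g f"
    unfolding ip_def set_lebesgue_integral_def
    by (rule Bochner_Integration.integral_cong) (auto simp: complex_cnj_scaleR)
  finally show ?thesis .
qed

lemma sqn_nonneg: "0 \<le> sqn f"
  unfolding sqn_def set_lebesgue_integral_def
  by (intro integral_nonneg_AE) (auto simp: indicator_def \<nu>(2))

lemma A2_I:
  assumes f: "holomorphic_fun D f"
    and g: "set_integrable V D g" "\<And>w. w \<in> D \<Longrightarrow> (cmod (f w))\<^sup>2 * \<nu> w \<le> g w"
  shows "f \<in> A2 V D \<nu>"
proof -
  have cf: "continuous_on D f" using f holomorphic_fun_imp_continuous_on by blast
  have "set_integrable V D (\<lambda>w. (cmod (f w))\<^sup>2 * \<nu> w)"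
  proof (rule set_integrable_bound[OF g(1)])
    show "set_borel_measurable V D (\<lambda>w. (cmod (f w))\<^sup>2 * \<nu> w)"
      by (intro set_measurable_times \<nu>(1) continuous_set_borel_measurable continuous_intros cf)
    show "AE x in V. x \<in> D \<longrightarrow> norm ((cmod (f x))\<^sup>2 * \<nu> x) \<le> norm (g x)"
      using g(2) \<nu>(2) by (intro AE_I2) (auto simp: abs_mult intro: order_trans[OF _ abs_ge_self])
  qed
  then show ?thesis
    using f continuous_set_borel_measurable[OF cf] by (simp add: A2_def L2_def)
qed

lemma A2_zero: "(\<lambda>w. 0) \<in> A2 V D \<nu>"
  by (rule A2_I[OF holomorphic_fun_const, of "\<lambda>w. 0"]) (simp_all add: set_integrable_def)

lemma A2_add_smult:
  assumes f: "f \<in> A2 V D \<nu>" and g: "g \<in> A2 V D \<nu>"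
  shows "(\<lambda>w. f w + c * g w) \<in> A2 V D \<nu>"
proof (rule A2_I)
  show "holomorphic_fun D (\<lambda>w. f w + c * g w)"
    using f g by (intro holomorphic_fun_add holomorphic_fun_mult holomorphic_fun_const) (auto simp: A2_def)
  show "set_integrable V D (\<lambda>w. 2 * ((cmod (f w))\<^sup>2 * \<nu> w) + 2 * (cmod c)\<^sup>2 * ((cmod (g w))\<^sup>2 * \<nu> w))"
    using f g by (intro set_integral_add set_integrable_mult_right) (auto simp: A2_def L2_def)
  fix w assume w: "w \<in> D"
  have "(cmod (f w + c * g w))\<^sup>2 \<le> (cmod (f w) + cmod (c * g w))\<^sup>2"
    by (intro power_mono norm_triangle_ineq) simp
  also have "\<dots> \<le> 2 * (cmod (f w))\<^sup>2 + 2 * (cmod (c * g w))\<^sup>2"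
    using zero_le_power2[of "cmod (f w) - cmod (c * g w)"]
    unfolding power2_sum power2_diff by linarith
  finally have "(cmod (f w + c * g w))\<^sup>2 \<le> 2 * (cmod (f w))\<^sup>2 + 2 * ((cmod c)\<^sup>2 * (cmod (g w))\<^sup>2)"
    by (simp add: norm_mult power_mult_distrib)
  from mult_right_mono[OF this \<nu>(2)[OF w]]
  show "(cmod (f w + c * g w))\<^sup>2 * \<nu> w \<le> 2 * ((cmod (f w))\<^sup>2 * \<nu> w) + 2 * (cmod c)\<^sup>2 * ((cmod (g w))\<^sup>2 * \<nu> w)"
    by (simp add: algebra_simps)
qed

lemma A2_smult: "g \<in> A2 V D \<nu> \<Longrightarrow> (\<lambda>w. c * g w) \<in> A2 V D \<nu>"
  using A2_add_smult[OF A2_zero, of g c] by simp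

lemma ip_add_left:
  assumes "f \<in> A2 V D \<nu>" "g \<in> A2 V D \<nu>" "h \<in> A2 V D \<nu>"
  shows "ip (\<lambda>w. f w + c * g w) h = ip f h + c * ip g h"
proof -
  have "ip (\<lambda>w. f w + c * g w) h
     = (LINT w:D|V. f w * cnj (h w) * complex_of_real (\<nu> w) + c * (g w * cnj (h w) * complex_of_real (\<nu> w)))"
    unfolding ip_def by (simp add: algebra_simps)
  also have "\<dots> = ip f h + (LINT w:D|V. c * (g w * cnj (h w) * complex_of_real (\<nu> w)))"
    unfolding ip_def
    by (rule set_integral_add) (use assms A2_product_integrable set_integrable_mult_right in auto)
  finally show ?thesis unfolding ip_def by simp
qed

lemma ip_add_right:
  assumes "f \<in> A2 V D \<nu>" "g \<in> A2 V D \<nu>" "h \<in> A2 V D \<nu>"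
  shows "ip h (\<lambda>w. f w + c * g w) = ip h f + cnj c * ip h g"
  using ip_add_left[OF assms, of c] by (metis complex_cnj_add complex_cnj_mult ip_cnj)

lemma sqn_add_smult:
  assumes "f \<in> A2 V D \<nu>" "g \<in> A2 V D \<nu>"
  shows "sqn (\<lambda>w. f w + c * g w) = sqn f + 2 * Re (c * ip g f) + (cmod c)\<^sup>2 * sqn g"
proof -
  have "complex_of_real (sqn (\<lambda>w. f w + c * g w))
     = ip f f + cnj c * ip f g + c * (ip g f + cnj c * ip g g)"
    unfolding sqn_ip ip_add_left[OF assms A2_add_smult[OF assms]] ip_add_right[OF assms assms(1)]
      ip_add_right[OF assms assms(2)] ..
  also have "\<dots> = ip f f + (c * ip g f + cnj (c * ip g f)) + (c * cnj c) * ip g g"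
    using ip_cnj[of g f] by (simp add: algebra_simps)
  also have "\<dots> = complex_of_real (sqn f + 2 * Re (c * ip g f) + (cmod c)\<^sup>2 * sqn g)"
    by (simp only: of_real_add of_real_mult complex_norm_square complex_add_cnj sqn_ip)
  finally show ?thesis by (simp only: of_real_eq_iff)
qed

subsection \<open>Local boundedness of point evaluations\<close>

lemma nn_integral_sqn:
  assumes "f \<in> A2 V D \<nu>"
  shows "(\<integral>\<^sup>+w. ennreal (indicator D w * ((cmod (f w))\<^sup>2 * \<nu> w)) \<partial>V) = ennreal (sqn f)"
proof -
  have "integrable V (\<lambda>w. indicator D w *\<^sub>R ((cmod (f w))\<^sup>2 * \<nu> w))"
    using assms by (simp add: A2_def L2_def set_integrable_def)
  from nn_integral_eq_integral[OF this] show ?thesis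
    by (simp add: sqn_def set_lebesgue_integral_def \<nu>(2) indicator_def)
qed

text \<open>Mean value inequality for \<open>f\<^sup>2\<close> on a ball on which the weight is bounded below.\<close>

lemma point_evaluation_off_zeros:
  assumes u: "u \<in> D" "\<delta> u \<noteq> 0"
  shows "\<exists>r>0. \<exists>C\<ge>0. ball u r \<subseteq> D \<and> (\<forall>f\<in>A2 V D \<nu>. \<forall>w\<in>ball u r. (cmod (f w))\<^sup>2 \<le> C * sqn f)"
proof -
  obtain R c where R: "R > 0" "c > 0" "ball u R \<subseteq> D" "\<And>x. x \<in> ball u R \<Longrightarrow> c \<le> \<nu> x"
    using below[OF u] by blast
  define r where "r = R / 2"
  have r: "r > 0" "r + r = R" using R by (auto simp: r_def)
  define m where "m = measure lborel (ball (0::complex^'d) r)"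
  have m: "m > 0" "emeasure lborel (ball (0::complex^'d) r) = ennreal m"
  proof -
    have fin: "emeasure lborel (ball (0::complex^'d) r) < \<infinity>"
      by (rule emeasure_bounded_finite) simp
    then show e: "emeasure lborel (ball (0::complex^'d) r) = ennreal m"
      unfolding m_def by (simp add: emeasure_eq_ennreal_measure less_top)
    have "0 \<noteq> emeasure lborel (ball (0::complex^'d) r)"
      using r(1) open_not_negligible[of "ball (0::complex^'d) r"]
      by (auto simp: negligible_iff_emeasure0)
    then show "m > 0" unfolding e by (metis ennreal_0 m_def measure_nonneg order_le_less)
  qed
  have "(cmod (f w))\<^sup>2 \<le> 1 / (\<kappa> * c * m) * sqn f" if f: "f \<in> A2 V D \<nu>" and w: "w \<in> ball u r" for f w
  proof -
    have sub: "ball w r \<subseteq> ball u R"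
    proof
      fix x assume "x \<in> ball w r"
      then show "x \<in> ball u R" using w r dist_triangle[of u x w] by simp
    qed
    have hol: "holomorphic_fun D (\<lambda>w. (f w)\<^sup>2)" using f by (auto simp: A2_def intro: holomorphic_fun_power)
    let ?G = "\<lambda>y. ennreal ((cmod (f y))\<^sup>2) * indicator (ball w r) y"
    have cf: "continuous_on D f" using f by (auto simp: A2_def intro: holomorphic_fun_imp_continuous_on)
    have G: "?G \<in> borel_measurable borel"
    proof -
      have "(\<lambda>y. indicator (ball w r) y *\<^sub>R ((cmod (f y))\<^sup>2)) \<in> borel_measurable borel"
        by (intro borel_measurable_continuous_on_indicator continuous_intros continuous_on_subset[OF cf])
           (use sub R in auto)
      then have "(\<lambda>y. ennreal (indicator (ball w r) y *\<^sub>R ((cmod (f y))\<^sup>2))) \<in> borel_measurable borel" by simp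
      moreover have eq: "(\<lambda>y. ennreal (indicator (ball w r) y *\<^sub>R ((cmod (f y))\<^sup>2))) = ?G"
        by (auto simp: indicator_def fun_eq_iff)
      ultimately show ?thesis unfolding eq by blast
    qed
    have "ennreal ((cmod (f w))\<^sup>2) * ennreal m
        \<le> (\<integral>\<^sup>+y. ennreal ((cmod (f (w + y)))\<^sup>2) * indicator (ball 0 r) y \<partial>lborel)"
      using ball_mean_value_bound[OF hol D, of w r] sub R(3) by (simp add: m norm_power)
    also have "\<dots> = (\<integral>\<^sup>+y. ?G (w + y) \<partial>lborel)"
      by (intro nn_integral_cong) (auto simp: indicator_def dist_norm)
    also have "\<dots> = (\<integral>\<^sup>+y. ?G y \<partial>distr lborel borel ((+) w))"
      by (subst nn_integral_distr) (use G in auto)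
    also have "\<dots> = (\<integral>\<^sup>+y. ?G y \<partial>lborel)" by (simp add: lborel_distr_plus)
    finally have 1: "ennreal ((cmod (f w))\<^sup>2) * ennreal m \<le> (\<integral>\<^sup>+y. ?G y \<partial>lborel)" .
    have "ennreal c * (\<integral>\<^sup>+y. ?G y \<partial>lborel) = (\<integral>\<^sup>+y. ennreal c * ?G y \<partial>lborel)"
      by (rule nn_integral_cmult[symmetric]) (use G in simp)
    also have "\<dots> \<le> (\<integral>\<^sup>+y. ennreal (indicator D y * ((cmod (f y))\<^sup>2 * \<nu> y)) \<partial>lborel)"
    proof (rule nn_integral_mono)
      fix y
      show "ennreal c * ?G y \<le> ennreal (indicator D y * ((cmod (f y))\<^sup>2 * \<nu> y))"
      proof (cases "y \<in> ball w r")
        case True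
        then have y: "y \<in> D" "c \<le> \<nu> y" using sub R by auto
        have "c * (cmod (f y))\<^sup>2 \<le> (cmod (f y))\<^sup>2 * \<nu> y"
          using mult_left_mono[OF y(2), of "(cmod (f y))\<^sup>2"] by (simp add: mult.commute)
        then show ?thesis using True y R(2)
          by (simp add: ennreal_mult[symmetric] ennreal_leI)
      qed simp
    qed
    finally have 2: "ennreal c * (\<integral>\<^sup>+y. ?G y \<partial>lborel)
        \<le> (\<integral>\<^sup>+y. ennreal (indicator D y * ((cmod (f y))\<^sup>2 * \<nu> y)) \<partial>lebesgue)"
      by (simp add: nn_integral_completion)
    have meas: "(\<lambda>y. ennreal (indicator D y * ((cmod (f y))\<^sup>2 * \<nu> y))) \<in> borel_measurable lebesgue"
    proof -
      have "set_borel_measurable V D (\<lambda>w. (cmod (f w))\<^sup>2 * \<nu> w)"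
        by (intro set_measurable_times \<nu>(1) continuous_set_borel_measurable continuous_intros cf)
      then show ?thesis by (simp add: set_borel_measurable_def measurable_V)
    qed
    have 3: "ennreal \<kappa> * (\<integral>\<^sup>+y. ennreal (indicator D y * ((cmod (f y))\<^sup>2 * \<nu> y)) \<partial>lebesgue) = ennreal (sqn f)"
      using nn_integral_sqn[OF f] nn_integral_scale_measure[OF meas, of "ennreal \<kappa>"] by (simp add: V)
    have "ennreal (\<kappa> * c * ((cmod (f w))\<^sup>2 * m)) = ennreal \<kappa> * (ennreal c * (ennreal ((cmod (f w))\<^sup>2) * ennreal m))"
      using \<kappa> R(2) m(1) by (simp add: ennreal_mult[symmetric] mult.assoc)
    also have "\<dots> \<le> ennreal (sqn f)"
      unfolding 3[symmetric]
      by (intro mult_left_mono order_trans[OF mult_left_mono[OF 1] 2]) auto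
    finally have "\<kappa> * c * ((cmod (f w))\<^sup>2 * m) \<le> sqn f"
      using sqn_nonneg[of f] by (simp add: ennreal_le_iff)
    then show ?thesis using \<kappa> R(2) m(1) by (simp add: field_simps)
  qed
  moreover have "ball u r \<subseteq> D" using R r by (auto simp: subset_iff)
  moreover have "0 \<le> 1 / (\<kappa> * c * m)" using \<kappa> R(2) m(1) by simp
  ultimately show ?thesis using r(1) by blast
qed

text \<open>The maximum modulus principle on a small disc whose boundary circle avoids the zero set of
  \<open>\<delta>\<close> transfers the bound to the points of the zero set.\<close>

lemma point_evaluation_bound:
  assumes z: "z \<in> D"
  shows "\<exists>r>0. \<exists>C\<ge>0. ball z r \<subseteq> D \<and> (\<forall>f\<in>A2 V D \<nu>. \<forall>w\<in>ball z r. (cmod (f w))\<^sup>2 \<le> C * sqn f)"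
proof -
  \<comment> \<open>The line from \<open>z\<close> to \<open>w0\<close> is not contained in the zero set of \<open>\<delta>\<close> and meets it in finitely many points.\<close>
  define v where "v = w0 - z"
  obtain R where R: "R > 0" "ball z R \<subseteq> D" using D z open_contains_ball by blast
  let ?Z = "{t. \<delta> (z + t *s v) = 0}"
  have "finite ?Z" by (rule polyfun_line_finite_zeros[OF \<delta>(1), of z 1]) (simp add: v_def \<delta>(2))
  then have "open (- (?Z - {0}))" by (intro open_Compl finite_imp_closed finite_Diff)
  then obtain \<rho>1 where \<rho>1: "\<rho>1 > 0" "ball 0 \<rho>1 \<subseteq> - (?Z - {0})"
    by (metis ComplI Diff_iff open_contains_ball_eq singletonI)
  define \<rho> where "\<rho> = min (\<rho>1 / 2) (R / (2 * (norm v + 1)))"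
  have \<rho>: "\<rho> > 0" "\<rho> < \<rho>1" using \<rho>1 R by (auto simp: \<rho>_def add_nonneg_pos min_less_iff_disj)
  have tv: "norm (t *s v) < R / 2 + 0 \<or> norm (t *s v) \<le> R / 2" if "cmod t \<le> \<rho>" for t
  proof -
    have "norm (t *s v) \<le> \<rho> * (norm v + 1)"
      unfolding norm_vector_smult using that \<rho>(1) by (intro mult_mono) auto
    also have "\<dots> \<le> R / (2 * (norm v + 1)) * (norm v + 1)"
      by (intro mult_right_mono) (auto simp: \<rho>_def)
    also have "\<dots> = R / 2"
    proof -
      have "R / (2 * k) * k = R / 2" if "k > 0" for k :: real using that by simp
      from this[of "norm v + 1"] show ?thesis by (simp only: add_nonneg_pos norm_ge_zero zero_less_one)
    qed
    finally show ?thesis by simp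
  qed
  \<comment> \<open>The radius is chosen so that the circle \<open>\<Gamma>\<close> about \<open>z\<close> avoids the zero set; finitely many balls on which
    evaluation is bounded cover it and all circles parallel and close to it.\<close>
  define \<Gamma> where "\<Gamma> = (\<lambda>t. z + t *s v) ` sphere 0 \<rho>"
  have \<Gamma>c: "compact \<Gamma>" unfolding \<Gamma>_def by (intro compact_continuous_image continuous_intros) auto
  define P where "P = (\<lambda>(u, r, C). r > 0 \<and> C \<ge> 0 \<and> ball u r \<subseteq> D \<and>
      (\<forall>f\<in>A2 V D \<nu>. \<forall>w\<in>ball u r. (cmod (f w))\<^sup>2 \<le> C * sqn f))"
  have "\<exists>r C. P (u, r, C)" if u: "u \<in> \<Gamma>" for u
  proof -
    obtain t where t: "cmod t = \<rho>" "u = z + t *s v" using u by (auto simp: \<Gamma>_def)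
    have "t \<notin> ?Z" using \<rho>1(2) \<rho> t by (auto simp: subset_iff)
    moreover have "u \<in> D"
      using R tv[of t] t by (auto simp: subset_iff dist_norm)
    ultimately show ?thesis using point_evaluation_off_zeros[of u] t by (auto simp: P_def)
  qed
  then obtain r C where rC: "\<And>u. u \<in> \<Gamma> \<Longrightarrow> P (u, r u, C u)" by metis
  have "\<Gamma> \<subseteq> (\<Union>u\<in>\<Gamma>. ball u (r u))" using rC by (auto simp: P_def)
  then obtain T where T: "T \<subseteq> \<Gamma>" "finite T" "\<Gamma> \<subseteq> (\<Union>u\<in>T. ball u (r u))"
    using compactE_image[OF \<Gamma>c, of \<Gamma> "\<lambda>u. ball u (r u)"] by auto
  define K where "K = (\<Sum>u\<in>T. C u)"
  have C0: "C u \<ge> 0" if "u \<in> T" for u using rC T(1) that by (auto simp: P_def)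
  have K: "(cmod (f w))\<^sup>2 \<le> K * sqn f" if fw: "f \<in> A2 V D \<nu>" "w \<in> (\<Union>u\<in>T. ball u (r u))" for f w
  proof -
    obtain u where u: "u \<in> T" "w \<in> ball u (r u)" using fw(2) by blast
    then have "(cmod (f w))\<^sup>2 \<le> C u * sqn f" using rC[of u] T(1) fw(1) by (auto simp: P_def)
    also have "\<dots> \<le> K * sqn f"
      unfolding K_def using u(1) T(2) C0 by (intro mult_right_mono member_le_sum sqn_nonneg) auto
    finally show ?thesis .
  qed
  obtain \<epsilon> where \<epsilon>: "\<epsilon> > 0" "(\<Union>x\<in>\<Gamma>. ball x \<epsilon>) \<subseteq> (\<Union>u\<in>T. ball u (r u))"
    using compact_subset_open_imp_ball_epsilon_subset[OF \<Gamma>c _ T(3)] by blast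
  define s where "s = min \<epsilon> (R / 2)"
  have s: "s > 0" using \<epsilon> R by (simp add: s_def)
  have "(cmod (f w))\<^sup>2 \<le> K * sqn f" if f: "f \<in> A2 V D \<nu>" and w: "w \<in> ball z s" for f w
  proof -
    let ?g = "\<lambda>t. f (w + t *s v)"
    have inD: "w + t *s v \<in> D" if "cmod t \<le> \<rho>" for t
    proof -
      have "norm (w + t *s v - z) \<le> norm (w - z) + norm (t *s v)"
        using norm_triangle_ineq[of "w - z" "t *s v"] by (simp add: algebra_simps)
      also have "\<dots> < R" using tv[OF that] w by (auto simp: s_def dist_norm norm_minus_commute)
      finally show ?thesis using R(2) by (auto simp: dist_norm norm_minus_commute subset_iff)
    qed
    have hol: "?g holomorphic_on {t. w + t *s v \<in> D}"
      using f by (intro holomorphic_fun_line) (simp add: A2_def)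
    have "cmod (?g 0) \<le> sqrt (K * sqn f)"
    proof (rule maximum_modulus_frontier[of ?g "cball 0 \<rho>"])
      show "?g holomorphic_on interior (cball 0 \<rho>)"
        by (rule holomorphic_on_subset[OF hol]) (use inD in auto)
      show "continuous_on (closure (cball 0 \<rho>)) ?g"
        by (rule holomorphic_on_imp_continuous_on, rule holomorphic_on_subset[OF hol]) (use inD in auto)
      fix t assume "t \<in> frontier (cball 0 \<rho> :: complex set)"
      then have t: "cmod t = \<rho>" using \<rho>(1) by (simp add: frontier_cball)
      have "dist (z + t *s v) (w + t *s v) < \<epsilon>" using w by (simp add: s_def dist_norm)
      then have "w + t *s v \<in> (\<Union>x\<in>\<Gamma>. ball x \<epsilon>)" using t by (force simp: \<Gamma>_def)
      then have "w + t *s v \<in> (\<Union>u\<in>T. ball u (r u))" using \<epsilon>(2) by blast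
      from K[OF f this] show "norm (?g t) \<le> sqrt (K * sqn f)" by (rule real_le_rsqrt)
    qed (use \<rho> in auto)
    then have "(cmod (f w))\<^sup>2 \<le> (sqrt (K * sqn f))\<^sup>2" by (intro power_mono) auto
    moreover have "0 \<le> K" unfolding K_def by (intro sum_nonneg C0)
    ultimately show ?thesis using sqn_nonneg[of f] by simp
  qed
  moreover have "ball z s \<subseteq> D" using R s by (auto simp: s_def subset_iff)
  moreover have "0 \<le> K" unfolding K_def by (intro sum_nonneg C0)
  ultimately show ?thesis using s by blast
qed

subsection \<open>The kernel\<close>

lemma sqn_smult: "g \<in> A2 V D \<nu> \<Longrightarrow> sqn (\<lambda>w. c * g w) = (cmod c)\<^sup>2 * sqn g"
proof -
  assume g: "g \<in> A2 V D \<nu>"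
  have "ip g (\<lambda>w. 0) = 0" "sqn (\<lambda>w. 0) = 0" by (simp_all add: ip_def sqn_def)
  then show ?thesis using sqn_add_smult[OF A2_zero g, of c] by simp
qed

text \<open>A sequence that minimises the norm under the constraint \<open>f z = 1\<close> is Cauchy by the
  parallelogram law, hence converges locally uniformly; by Fatou's lemma the limit attains the
  minimum.\<close>

lemma minimal_norm_function:
  assumes z: "z \<in> D" and f0: "f0 \<in> A2 V D \<nu>" "f0 z \<noteq> 0"
  obtains f where "f \<in> A2 V D \<nu>" "f z = 1" "\<And>g. g \<in> A2 V D \<nu> \<Longrightarrow> g z = 1 \<Longrightarrow> sqn f \<le> sqn g"
proof -
  define S where "S = {g \<in> A2 V D \<nu>. g z = 1}"
  have S0: "(\<lambda>w. (1 / f0 z) * f0 w) \<in> S"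
    using A2_smult[OF f0(1), of "1 / f0 z"] f0(2) by (simp add: S_def)
  define I where "I = (INF g\<in>S. sqn g)"
  have bdd: "bdd_below (sqn ` S)" using sqn_nonneg by (intro bdd_belowI[of _ 0]) auto
  have I_le: "I \<le> sqn g" if "g \<in> S" for g
    unfolding I_def using that bdd by (rule cINF_lower[rotated])
  have "\<exists>g\<in>S. sqn g < I + 1 / (real n + 1)" for n :: nat
    using cINF_less_iff[of S sqn "I + 1 / (real n + 1)"] S0 bdd by (auto simp: I_def)
  then obtain g where g: "\<And>n. g n \<in> S" "\<And>n. sqn (g n) < I + 1 / (real n + 1)" by metis
  have gA: "g n \<in> A2 V D \<nu>" for n using g(1) by (simp add: S_def)
  have cauchy: "sqn (\<lambda>w. g n w + (- 1) * g m w) \<le> 2 / (real n + 1) + 2 / (real m + 1)" for n m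
  proof -
    let ?h = "\<lambda>w. (1/2) * (g n w + 1 * g m w)"
    have "?h \<in> A2 V D \<nu>" by (intro A2_smult A2_add_smult gA)
    then have "?h \<in> S" using g(1)[of n] g(1)[of m] by (simp add: S_def)
    then have "I \<le> (1/4) * sqn (\<lambda>w. g n w + 1 * g m w)"
      using I_le[of ?h] sqn_smult[OF A2_add_smult[OF gA gA], of "1/2" n 1 m] by (simp add: power2_eq_square)
    moreover have "sqn (\<lambda>w. g n w + 1 * g m w) + sqn (\<lambda>w. g n w + (- 1) * g m w) = 2 * sqn (g n) + 2 * sqn (g m)"
      using sqn_add_smult[OF gA gA, of n 1 m] sqn_add_smult[OF gA gA, of n "-1" m] by simp
    moreover have "2 * sqn (g n) < 2 * I + 2 / (real n + 1)" "2 * sqn (g m) < 2 * I + 2 / (real m + 1)"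
      using g(2)[of n] g(2)[of m] by auto
    ultimately show ?thesis by linarith
  qed
  have local: "\<exists>r>0. cball u r \<subseteq> D \<and> uniformly_Cauchy_on (cball u r) g" if u: "u \<in> D" for u
  proof -
    obtain r C where r: "r > 0" "C \<ge> 0" "ball u r \<subseteq> D"
      "\<And>f w. f \<in> A2 V D \<nu> \<Longrightarrow> w \<in> ball u r \<Longrightarrow> (cmod (f w))\<^sup>2 \<le> C * sqn f"
      using point_evaluation_bound[OF u] by blast
    have sub: "cball u (r/2) \<subseteq> ball u r" using r(1) by auto
    have "uniformly_Cauchy_on (cball u (r/2)) g"
      unfolding uniformly_Cauchy_on_def
    proof (intro allI impI)
      fix e :: real assume e: "e > 0"
      obtain M :: nat where M: "real M > 4 * (C + 1) / e\<^sup>2" using reals_Archimedean2 by blast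
      have "dist (g m x) (g n x) < e" if x: "x \<in> cball u (r/2)" and mn: "m \<ge> M" "n \<ge> M" for x m n
      proof -
        have "(cmod (g m x + (- 1) * g n x))\<^sup>2 \<le> C * sqn (\<lambda>w. g m w + (- 1) * g n w)"
          by (rule r(4)[OF A2_add_smult[OF gA gA]]) (use x sub in auto)
        also have "\<dots> \<le> C * (2 / (real m + 1) + 2 / (real n + 1))"
          by (rule mult_left_mono[OF cauchy r(2)])
        also have "\<dots> \<le> C * (2 / (real M + 1) + 2 / (real M + 1))"
          using mn r(2) by (intro mult_left_mono add_mono divide_left_mono) auto
        also have "\<dots> = C * (4 / (real M + 1))" by simp
        also have "\<dots> \<le> (C + 1) * (4 / (real M + 1))" by (intro mult_right_mono) auto
        also have "\<dots> < e\<^sup>2"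
        proof -
          have "4 * (C + 1) < e\<^sup>2 * real M" using M e by (simp add: field_simps)
          also have "\<dots> \<le> e\<^sup>2 * (real M + 1)" by (intro mult_left_mono) auto
          finally show ?thesis by (simp add: field_simps)
        qed
        finally have "cmod (g m x - g n x) < e"
          using e power2_less_imp_less[of "cmod (g m x - g n x)" e] by simp
        then show ?thesis by (simp add: dist_norm)
      qed
      then show "\<exists>M. \<forall>x\<in>cball u (r/2). \<forall>m\<ge>M. \<forall>n\<ge>M. dist (g m x) (g n x) < e" by blast
    qed
    then show ?thesis using sub r(1,3) by (intro exI[of _ "r/2"]) auto
  qed
  define f where "f = (\<lambda>w. lim (\<lambda>n. g n w))"
  have ulim: "\<exists>d>0. cball u d \<subseteq> D \<and> uniform_limit (cball u d) g f sequentially" if "u \<in> D" for u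
  proof -
    obtain r where r: "r > 0" "cball u r \<subseteq> D" "uniformly_Cauchy_on (cball u r) g" using local[OF \<open>u \<in> D\<close>] by blast
    then obtain l where l: "uniform_limit (cball u r) g l sequentially"
      using Cauchy_uniformly_convergent uniformly_convergent_on_def by blast
    have "l x = f x" if "x \<in> cball u r" for x
      using tendsto_uniform_limitI[OF l that] by (simp add: f_def limI)
    then have "uniform_limit (cball u r) g f sequentially"
      using uniform_limit_cong'[of "cball u r" g g l f sequentially] l by blast
    then show ?thesis using r by blast
  qed
  have lim: "(\<lambda>n. g n w) \<longlonglongrightarrow> f w" if "w \<in> D" for w
    using ulim[OF that] tendsto_uniform_limitI by (metis centre_in_cball less_imp_le)
  have hol: "holomorphic_fun D f"
    by (rule holomorphic_fun_uniform_limit[OF D _ ulim]) (use gA in \<open>auto simp: A2_def\<close>)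
  have fz: "f z = 1"
    using lim[OF z] g(1) by (simp add: S_def LIMSEQ_const_iff)
  let ?q = "\<lambda>h w. ennreal (indicator D w * ((cmod (h w))\<^sup>2 * \<nu> w))"
  have meas: "?q h \<in> borel_measurable V" if "holomorphic_fun D h" for h
  proof -
    have "set_borel_measurable V D (\<lambda>w. (cmod (h w))\<^sup>2 * \<nu> w)"
      by (intro set_measurable_times \<nu>(1) continuous_set_borel_measurable continuous_intros
            holomorphic_fun_imp_continuous_on that)
    then show ?thesis by (simp add: set_borel_measurable_def)
  qed
  have "(\<integral>\<^sup>+w. ?q f w \<partial>V) = (\<integral>\<^sup>+w. liminf (\<lambda>n. ?q (g n) w) \<partial>V)"
  proof (rule nn_integral_cong)
    fix w
    have "(\<lambda>n. ?q (g n) w) \<longlonglongrightarrow> ?q f w"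
    proof (cases "w \<in> D")
      case True
      then show ?thesis by (intro tendsto_intros tendsto_ennrealI lim)
    qed simp
    then show "?q f w = liminf (\<lambda>n. ?q (g n) w)"
      by (simp add: lim_imp_Liminf)
  qed
  also have "\<dots> \<le> liminf (\<lambda>n. \<integral>\<^sup>+w. ?q (g n) w \<partial>V)"
    by (rule nn_integral_liminf) (use meas gA in \<open>auto simp: A2_def\<close>)
  also have "\<dots> = liminf (\<lambda>n. ennreal (sqn (g n)))"
    by (simp add: nn_integral_sqn[OF gA])
  also have "\<dots> \<le> liminf (\<lambda>n. ennreal (I + 1 / (real n + 1)))"
    by (intro Liminf_mono always_eventually allI ennreal_leI less_imp_le g(2))
  also have "\<dots> = ennreal I"
  proof (rule lim_imp_Liminf)
    have "(\<lambda>n. 1 / (real n + 1)) \<longlonglongrightarrow> 0"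
      using LIMSEQ_inverse_real_of_nat by (simp add: inverse_eq_divide add.commute)
    then have "(\<lambda>n. I + 1 / (real n + 1)) \<longlonglongrightarrow> I + 0" by (intro tendsto_intros)
    then show "(\<lambda>n. ennreal (I + 1 / (real n + 1))) \<longlonglongrightarrow> ennreal I" by (intro tendsto_ennrealI) simp
  qed simp
  finally have le: "(\<integral>\<^sup>+w. ?q f w \<partial>V) \<le> ennreal I" .
  have mf: "(\<lambda>w. indicator D w * ((cmod (f w))\<^sup>2 * \<nu> w)) \<in> borel_measurable V"
  proof -
    have "set_borel_measurable V D (\<lambda>w. (cmod (f w))\<^sup>2 * \<nu> w)"
      by (intro set_measurable_times \<nu>(1) continuous_set_borel_measurable continuous_intros
            holomorphic_fun_imp_continuous_on hol)
    then show ?thesis by (simp add: set_borel_measurable_def)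
  qed
  have "integrable V (\<lambda>w. indicator D w * ((cmod (f w))\<^sup>2 * \<nu> w))"
    using le mf by (intro integrableI_nonneg) (auto simp: indicator_def \<nu>(2) intro: le_less_trans)
  then have fA: "f \<in> A2 V D \<nu>"
    by (intro A2_I[OF hol, of "\<lambda>w. (cmod (f w))\<^sup>2 * \<nu> w"]) (simp_all add: set_integrable_def)
  have "I \<ge> 0" unfolding I_def by (rule cINF_greatest) (use S0 sqn_nonneg in auto)
  then have "sqn f \<le> I" using le nn_integral_sqn[OF fA] by (simp add: ennreal_le_iff)
  then show thesis using that[OF fA fz] I_le by (force simp: S_def)
qed

text \<open>Unless all functions vanish at \<open>z\<close>, the function of norm minimal among those with value one at \<open>z\<close> is orthogonal to all functions that
  vanish at \<open>z\<close>, so a multiple of it reproduces the value at \<open>z\<close>.\<close>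

lemma reproducing_element:
  assumes z: "z \<in> D"
  shows "\<exists>k\<in>A2 V D \<nu>. \<forall>h\<in>A2 V D \<nu>. h z = ip h k"
proof (cases "\<forall>h\<in>A2 V D \<nu>. h z = 0")
  case True
  then show ?thesis by (intro bexI[OF _ A2_zero]) (simp add: ip_def)
next
  case False
  then obtain f where f: "f \<in> A2 V D \<nu>" "f z = 1"
    and min: "\<And>g. g \<in> A2 V D \<nu> \<Longrightarrow> g z = 1 \<Longrightarrow> sqn f \<le> sqn g"
    using minimal_norm_function[OF z] by blast
  obtain C where "C \<ge> 0" "(cmod (f z))\<^sup>2 \<le> C * sqn f"
    using point_evaluation_bound[OF z] f(1) by (metis centre_in_ball)
  then have pos: "sqn f > 0" using f(2) sqn_nonneg[of f]
    by (cases "sqn f = 0") auto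
  have orth: "ip g f = 0" if g: "g \<in> A2 V D \<nu>" "g z = 0" for g
  proof (rule ccontr)
    define b where "b = ip g f"
    assume "ip g f \<noteq> 0"
    then have b: "(cmod b)\<^sup>2 > 0" by (simp add: b_def)
    define s where "s = 1 / (sqn g + 1)"
    have s: "s > 0" "s * sqn g < 1" using sqn_nonneg[of g] by (auto simp: s_def field_simps)
    define c where "c = - complex_of_real s * cnj b"
    have "c * b = complex_of_real (- s * (cmod b)\<^sup>2)"
      unfolding c_def of_real_mult complex_norm_square by simp
    then have "Re (c * b) = - s * (cmod b)\<^sup>2" by (simp only: Re_complex_of_real)
    moreover have "(cmod c)\<^sup>2 = s\<^sup>2 * (cmod b)\<^sup>2"
      by (simp add: c_def norm_mult power_mult_distrib)
    moreover have "sqn f \<le> sqn (\<lambda>w. f w + c * g w)"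
      by (rule min) (use A2_add_smult[OF f(1) g(1)] f(2) g(2) in auto)
    ultimately have "0 \<le> 2 * (- s * (cmod b)\<^sup>2) + s\<^sup>2 * (cmod b)\<^sup>2 * sqn g"
      using sqn_add_smult[OF f(1) g(1), of c] by (simp add: b_def)
    also have "\<dots> = s * (cmod b)\<^sup>2 * (s * sqn g - 2)"
      by (simp add: algebra_simps power2_eq_square)
    also have "\<dots> < 0" using s b by (intro mult_pos_neg) auto
    finally show False by simp
  qed
  let ?c = "complex_of_real (1 / sqn f)"
  have "h z = ip h (\<lambda>w. ?c * f w)" if h: "h \<in> A2 V D \<nu>" for h
  proof -
    have "ip (\<lambda>w. h w + (- h z) * f w) f = 0"
      by (rule orth) (use A2_add_smult[OF h f(1), of "- h z"] f(2) in auto)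
    then have "ip h f = h z * complex_of_real (sqn f)"
      using ip_add_left[OF h f(1) f(1), of "- h z"] by (simp add: sqn_ip)
    moreover have "ip h (\<lambda>w. 0 + ?c * f w) = ip h (\<lambda>w. 0) + cnj ?c * ip h f"
      by (rule ip_add_right[OF A2_zero f(1) h])
    moreover have "ip h (\<lambda>w. 0) = 0" by (simp add: ip_def)
    ultimately show ?thesis using pos by simp
  qed
  then show ?thesis using A2_smult[OF f(1)] by blast
qed

theorem reproducing_kernel_bergman_kernel: "reproducing_kernel V D \<nu> (bergman_kernel V D \<nu>)"
proof -
  obtain k where k: "\<And>z. z \<in> D \<Longrightarrow> k z \<in> A2 V D \<nu>" "\<And>z h. z \<in> D \<Longrightarrow> h \<in> A2 V D \<nu> \<Longrightarrow> h z = ip h (k z)"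
    using reproducing_element by metis
  then have "reproducing_kernel V D \<nu> (\<lambda>w z. k z w)"
    unfolding reproducing_kernel_def ip_def by auto
  then show ?thesis unfolding bergman_kernel_def by (rule someI[of "reproducing_kernel V D \<nu>"])
qed

abbreviation K :: "complex^'d \<Rightarrow> complex^'d \<Rightarrow> complex" where "K \<equiv> bergman_kernel V D \<nu>"

lemma kernel_A2: "z \<in> D \<Longrightarrow> (\<lambda>w. K w z) \<in> A2 V D \<nu>"
  using reproducing_kernel_bergman_kernel by (simp add: reproducing_kernel_def)

lemma kernel_reproduces: "f \<in> A2 V D \<nu> \<Longrightarrow> z \<in> D \<Longrightarrow> f z = ip f (\<lambda>w. K w z)"
  using reproducing_kernel_bergman_kernel by (simp add: reproducing_kernel_def ip_def)

lemma kernel_symmetric: "z \<in> D \<Longrightarrow> w \<in> D \<Longrightarrow> K z w = cnj (K w z)"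
  using kernel_reproduces[OF kernel_A2, of w z] kernel_reproduces[OF kernel_A2, of z w] ip_cnj by metis

lemma bergman_projection_eq_ip:
  assumes "z \<in> D" shows "bergman_projection V D \<nu> \<phi> z = ip \<phi> (\<lambda>w. K w z)"
  unfolding bergman_projection_def ip_def set_lebesgue_integral_def
  by (rule Bochner_Integration.integral_cong)
     (use kernel_symmetric assms in \<open>auto simp: indicator_def\<close>)

lemma A2_orthogonal_imp_zero:
  assumes g: "g \<in> A2 V D \<nu>" and orth: "\<And>h. h \<in> A2 V D \<nu> \<Longrightarrow> ip h g = 0" and u: "u \<in> D"
  shows "g u = 0"
  using kernel_reproduces[OF g u] orth[OF kernel_A2[OF u]] ip_cnj by (metis complex_cnj_zero)

end

section \<open>Division by linear forms\<close>

lemma clinear_functional_props: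
  assumes "Vector_Spaces.linear (*s) (*) (l :: complex^'d \<Rightarrow> complex)"
  shows "l (x + y) = l x + l y" "l (c *s x) = c * l x" "l (x - y) = l x - l y" "l 0 = 0"
    "bounded_linear l" "polyfun l"
proof -
  interpret Vector_Spaces.linear "(*s)" "(*)" l by (rule assms)
  show "l (x + y) = l x + l y" "l (c *s x) = c * l x" "l (x - y) = l x - l y" "l 0 = 0"
    by (simp_all add: add scale diff)
qed (use assms clinear_functional_imp_bounded_linear polyfun_clinear in auto)

lemma clinear_functional_proportional:
  fixes f g :: "complex^'d \<Rightarrow> complex"
  assumes f: "Vector_Spaces.linear (*s) (*) f" and g: "Vector_Spaces.linear (*s) (*) g"
    and sub: "\<And>z. f z = 0 \<Longrightarrow> g z = 0" and y: "f y \<noteq> 0"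
  shows "g z = (g y / f y) * f z"
proof -
  have "f (z - (f z / f y) *s y) = 0"
    using y by (simp add: clinear_functional_props[OF f])
  then have "g (z - (f z / f y) *s y) = 0" by (rule sub)
  then show ?thesis by (simp add: clinear_functional_props[OF g])
qed

lemma continuous_zero_by_density:
  fixes f :: "complex^'d \<Rightarrow> complex"
  assumes D: "open D" and cf: "continuous_on D f" and p: "polyfun p" "p w \<noteq> 0"
    and zero: "\<And>z. z \<in> D \<Longrightarrow> p z \<noteq> 0 \<Longrightarrow> f z = 0" and z: "z \<in> D"
  shows "f z = 0"
proof (rule ccontr)
  assume nz: "f z \<noteq> 0"
  have "open (D \<inter> f -` (- {0}))"
    by (rule continuous_open_preimage[OF cf D]) auto
  then obtain y where "y \<in> D \<inter> f -` (- {0})" "p y \<noteq> 0"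
    using polyfun_nonzero_dense[OF p, of "D \<inter> f -` (- {0})" z] nz z by auto
  then show False using zero by auto
qed

text \<open>The quotient \<open>F / l\<close>, completed on the zero set of \<open>l\<close> by a directional derivative of \<open>F\<close>, is continuous by the mean value inequality.
  Its singularities are then removable.\<close>

lemma holomorphic_divide_linear_form:
  fixes F :: "complex^'d \<Rightarrow> complex"
  assumes D: "open D" and F: "holomorphic_fun D F"
    and l: "Vector_Spaces.linear (*s) (*) l" and w: "l w \<noteq> 0"
    and zero: "\<And>z. z \<in> D \<Longrightarrow> l z = 0 \<Longrightarrow> F z = 0"
  obtains q where "holomorphic_fun D q" "\<And>z. z \<in> D \<Longrightarrow> F z = l z * q z"
proof -
  note lp = clinear_functional_props[OF l]
  \<comment> \<open>A unit vector transversal to the zero set of \<open>l\<close>.\<close>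
  define v where "v = complex_of_real (1 / norm w) *s w"
  define c where "c = l v"
  have "norm w \<noteq> 0" using w lp(4) by auto
  then have v: "norm v = 1" by (simp add: v_def norm_vector_smult norm_divide)
  have c: "c \<noteq> 0" using w \<open>norm w \<noteq> 0\<close> by (simp add: c_def v_def lp)
  have cF: "continuous_on D F" by (rule holomorphic_fun_imp_continuous_on[OF F])
  have fd: "(\<lambda>t. F (z + t *s v)) field_differentiable at 0" if "z \<in> D" for z
    using holomorphic_fun_line[OF F, of z v] open_line_slice[OF D, of z v] that
    by (auto simp: holomorphic_on_open field_differentiable_def)
  define p where "p = (\<lambda>z. deriv (\<lambda>t. F (z + t *s v)) 0)"
  have pc: "isCont p z" if "z \<in> D" for z
    unfolding p_def by (rule partial_derivative_continuous(1)[OF D cF that v fd])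
  have dF: "((\<lambda>t. F (z + t *s v)) has_field_derivative p (z + t *s v)) (at t)" if "z + t *s v \<in> D" for z t
    unfolding p_def by (rule partial_derivative_continuous(2)[OF D cF that v fd that])
  define q where "q = (\<lambda>z. if l z = 0 then p z / c else F z / l z)"
  have lc: "isCont l z" for z
    using polyfun_continuous_on[OF lp(6), of UNIV] by (simp add: continuous_on_eq_continuous_at)
  have "isCont q z0" if z0: "z0 \<in> D" for z0
  proof (cases "l z0 = 0")
    case False
    have "isCont (\<lambda>z. F z / l z) z0"
      using cF D z0 lc False by (intro continuous_divide) (auto simp: continuous_on_eq_continuous_at)
    moreover have "\<forall>\<^sub>F z in nhds z0. q z = F z / l z"
    proof -
      have "open {z. l z \<noteq> 0}"
        using open_Collect_neq[of l "\<lambda>u. 0"] polyfun_continuous_on[OF lp(6)] by simp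
      then have "\<forall>\<^sub>F z in nhds z0. z \<in> {z. l z \<noteq> 0}"
        using False by (intro eventually_nhds_in_open) auto
      then show ?thesis by eventually_elim (simp add: q_def)
    qed
    ultimately show ?thesis using isCont_cong[of q "\<lambda>z. F z / l z" z0] by simp
  next
    case True
    show ?thesis
      unfolding continuous_at_eps_delta
    proof (intro allI impI)
      fix e :: real assume e: "e > 0"
      define e' where "e' = e * cmod c / 2"
      have e': "e' > 0" using e c by (simp add: e'_def)
      obtain r1 where r1: "r1 > 0" "\<And>z. dist z z0 < r1 \<Longrightarrow> dist (p z) (p z0) < e'"
        using pc[OF z0] e' unfolding continuous_at_eps_delta by blast
      obtain r2 where r2: "r2 > 0" "ball z0 r2 \<subseteq> D" using D z0 open_contains_ball by blast
      define r where "r = min r1 r2"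
      obtain L where L: "L > 0" "\<And>z. cmod (l z) \<le> L * norm z"
        using bounded_linear.pos_bounded[OF lp(5)] by (metis mult.commute)
      define d where "d = r / (1 + 2 * L / cmod c)"
      have den: "1 + 2 * L / cmod c > 0" using L c by (simp add: add_pos_nonneg)
      have d: "d > 0" using r1 r2 den by (simp add: d_def r_def)
      have "dist (q z) (q z0) < e" if z: "dist z z0 < d" for z
      proof -
        \<comment> \<open>\<open>z'\<close> is the point of the zero set reached from \<open>z\<close> in the direction \<open>v\<close>.\<close>
        define t where "t = l z / c"
        define z' where "z' = z - t *s v"
        have zz: "z' + t *s v = z" by (simp add: z'_def)
        have lz': "l z' = 0" using c by (simp add: z'_def t_def lp c_def[symmetric])
        have lzt: "l z = t * c" using c by (simp add: t_def)
        have "cmod (l z) \<le> L * norm (z - z0)"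
          using L(2)[of "z - z0"] True by (simp add: lp)
        then have t: "cmod t \<le> L / cmod c * norm (z - z0)"
          using c by (simp add: t_def norm_divide divide_right_mono)
        have near: "dist (z' + s *s v) z0 < r" if s: "cmod s \<le> cmod t" for s
        proof -
          have "z' + s *s v - z0 = (z - z0) + (s - t) *s v"
            by (simp add: z'_def vec_eq_iff algebra_simps)
          then have "norm (z' + s *s v - z0) \<le> norm (z - z0) + cmod (s - t)"
            using norm_triangle_ineq[of "z - z0" "(s - t) *s v"] v by (simp only: norm_vector_smult)
          also have "\<dots> \<le> norm (z - z0) + 2 * (L / cmod c * norm (z - z0))"
            using norm_triangle_ineq4[of s t] s t by linarith
          also have "\<dots> = norm (z - z0) * (1 + 2 * L / cmod c)" by (simp add: algebra_simps)
          also have "\<dots> < r" using z den by (simp add: d_def dist_norm pos_less_divide_eq)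
          finally show ?thesis by (simp add: dist_norm)
        qed
        have inD: "z' + s *s v \<in> D" if "cmod s \<le> cmod t" for s
          using near[OF that] r2(2) by (auto simp: r_def dist_commute subset_iff)
        have pn: "dist (p (z' + s *s v)) (p z0) < e'" if "cmod s \<le> cmod t" for s
          using near[OF that] r1(2)[of "z' + s *s v"] by (simp add: r_def)
        show ?thesis
        proof (cases "l z = 0")
          case lz: True
          have "dist (p z) (p z0) < e'" using pn[of t] zz by simp
          then have "dist (q z) (q z0) < e' / cmod c"
            using c by (simp add: q_def True lz dist_norm norm_divide divide_strict_right_mono flip: diff_divide_distrib)
          also have "\<dots> \<le> e" using c e by (simp add: e'_def)
          finally show ?thesis .
        next
          case lz: False
          let ?g = "\<lambda>s. F (z' + s *s v) - s * p z0"
          have t0: "t \<noteq> 0" using lz lzt by auto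
          have "norm (?g t - ?g 0) \<le> e' * norm (t - 0)"
          proof (rule field_differentiable_bound[of "cball 0 (cmod t)"])
            show "(?g has_field_derivative p (z' + s *s v) - p z0) (at s within cball 0 (cmod t))"
              if "s \<in> cball 0 (cmod t)" for s
            proof -
              have "((\<lambda>s. s * p z0) has_field_derivative p z0) (at s)"
                by (auto intro!: derivative_eq_intros)
              then have "(?g has_field_derivative p (z' + s *s v) - p z0) (at s)"
                by (intro DERIV_diff dF) (use inD that in auto)
              then show ?thesis by (rule has_field_derivative_at_within)
            qed
            show "norm (p (z' + s *s v) - p z0) \<le> e'" if "s \<in> cball 0 (cmod t)" for s
              using pn[of s] that by (simp add: dist_norm less_imp_le)
          qed auto
          moreover have "F (z' + 0 *s v) = 0"
            using zero[of z'] inD[of 0] lz' by simp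
          ultimately have le: "cmod (F z - t * p z0) \<le> e' * cmod t" by (simp add: zz)
          have "q z - q z0 = (F z - t * p z0) / (t * c)"
            using t0 c lz True by (simp add: q_def lzt field_simps)
          then have "cmod (q z - q z0) = cmod (F z - t * p z0) / (cmod t * cmod c)"
            by (simp only: norm_divide norm_mult)
          also have "\<dots> \<le> e' * cmod t / (cmod t * cmod c)"
            by (intro divide_right_mono le) simp
          also have "\<dots> = e / 2" using t0 c by (simp add: e'_def)
          also have "\<dots> < e" using e by simp
          finally show ?thesis by (simp add: dist_norm)
        qed
      qed
      then show "\<exists>d>0. \<forall>z. dist z z0 < d \<longrightarrow> dist (q z) (q z0) < e" using d by blast
    qed
  qed
  then have cq: "continuous_on D q" by (intro continuous_at_imp_continuous_on) auto
  have "holomorphic_fun D q"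
  proof (rule removable_polyfun_zeros[OF D cq lp(6) w])
    have o: "open (D \<inter> {z. l z \<noteq> 0})"
      using D open_Collect_neq[of l "\<lambda>u. 0"] polyfun_continuous_on[OF lp(6)] by (intro open_Int) auto
    have "holomorphic_fun (D \<inter> {z. l z \<noteq> 0}) (\<lambda>z. F z / l z)"
      by (intro holomorphic_fun_divide[OF o] holomorphic_fun_subset[OF F] polyfun_holomorphic lp) auto
    then show "holomorphic_fun (D \<inter> {z. l z \<noteq> 0}) q"
      by (rule holomorphic_fun_cong[OF o]) (auto simp: q_def)
  qed
  moreover have "F z = l z * q z" if "z \<in> D" for z
    using zero[OF that] by (auto simp: q_def)
  ultimately show thesis by (rule that)
qed

text \<open>The transformation rule under \<open>b\<close> forces the quotients of \<open>F\<close> by \<open>l, l\<^sup>2, \<dots>, l\<^sup>e\<^sup>-\<^sup>1\<close> to vanish on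
  the zero set of \<open>l\<close>, which \<open>b\<close> fixes pointwise.\<close>

lemma semi_invariant_divisible:
  fixes F :: "complex^'d \<Rightarrow> complex" and b :: "complex^'d^'d"
  assumes D: "open D" and F: "holomorphic_fun D F"
    and l: "Vector_Spaces.linear (*s) (*) l" and w: "l w \<noteq> 0"
    and b: "\<And>z. z \<in> D \<Longrightarrow> b *v z \<in> D" "\<And>z. l (b *v z) = \<epsilon> * l z" "\<And>z. l z = 0 \<Longrightarrow> b *v z = z"
    and \<epsilon>: "\<epsilon> \<noteq> 0" "\<And>k. 0 < k \<Longrightarrow> k \<le> e \<Longrightarrow> \<epsilon> ^ k \<noteq> 1"
    and Fb: "\<And>z. z \<in> D \<Longrightarrow> F (b *v z) = \<epsilon> ^ e * F z"
  shows "\<exists>q. holomorphic_fun D q \<and> (\<forall>z\<in>D. F z = l z ^ e * q z)"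
proof -
  note lp = clinear_functional_props[OF l]
  have "\<exists>q. holomorphic_fun D q \<and> (\<forall>z\<in>D. F z = l z ^ j * q z)" if "j \<le> e" for j
    using that
  proof (induction j)
    case 0
    then show ?case using F by auto
  next
    case (Suc j)
    then obtain q where q: "holomorphic_fun D q" "\<And>z. z \<in> D \<Longrightarrow> F z = l z ^ j * q z" by auto
    have cq: "continuous_on D q" by (rule holomorphic_fun_imp_continuous_on[OF q(1)])
    have cqb: "continuous_on D (\<lambda>z. q (b *v z) - \<epsilon> ^ (e - j) * q z)"
      by (intro continuous_intros cq continuous_on_compose2[OF cq]
           holomorphic_map_imp_continuous_on[OF holomorphic_map_matrix]) (use b in auto)
    have eq: "q (b *v z) - \<epsilon> ^ (e - j) * q z = 0" if z: "z \<in> D" for z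
    proof (rule continuous_zero_by_density[OF D cqb lp(6) w _ z])
      fix z assume z: "z \<in> D" "l z \<noteq> 0"
      have "\<epsilon> ^ j * l z ^ j * q (b *v z) = \<epsilon> ^ e * (l z ^ j * q z)"
        using Fb[OF z(1)] q(2)[OF z(1)] q(2)[OF b(1)[OF z(1)]] b(2)
        by (simp add: power_mult_distrib mult_ac)
      also have "\<epsilon> ^ e = \<epsilon> ^ j * \<epsilon> ^ (e - j)" using Suc.prems by (simp flip: power_add)
      finally show "q (b *v z) - \<epsilon> ^ (e - j) * q z = 0" using \<epsilon>(1) z(2) by (simp add: mult_ac)
    qed
    have "q z = 0" if z: "z \<in> D" "l z = 0" for z
    proof -
      have "q z = \<epsilon> ^ (e - j) * q z" using eq[OF z(1)] b(3)[OF z(2)] by simp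
      moreover have "\<epsilon> ^ (e - j) \<noteq> 1" using \<epsilon>(2)[of "e - j"] Suc.prems by simp
      ultimately show ?thesis by simp
    qed
    then obtain q' where q': "holomorphic_fun D q'" "\<And>z. z \<in> D \<Longrightarrow> q z = l z * q' z"
      using holomorphic_divide_linear_form[OF D q(1) l w] by blast
    then show ?case using q(2) by (intro exI[of _ q']) (auto simp: mult_ac)
  qed
  then show ?thesis by blast
qed

text \<open>The factor \<open>l\<^sup>k\<close> on the right must divide \<open>r\<close>, because \<open>p\<close> vanishes on no open piece of the zero set
  of \<open>l\<close>.\<close>

lemma coprime_factor_divisible:
  fixes r :: "complex^'d \<Rightarrow> complex"
  assumes D: "open D" and r: "holomorphic_fun D r"
    and l: "Vector_Spaces.linear (*s) (*) l" and w: "l w \<noteq> 0"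
    and p: "polyfun p"
    and dense: "\<And>z U. open U \<Longrightarrow> z \<in> U \<Longrightarrow> l z = 0 \<Longrightarrow> \<exists>y\<in>U. l y = 0 \<and> p y \<noteq> 0"
    and q: "holomorphic_fun D q" and eq: "\<And>z. z \<in> D \<Longrightarrow> p z * r z = l z ^ k * q z"
  shows "\<exists>r'. holomorphic_fun D r' \<and> (\<forall>z\<in>D. r z = l z ^ k * r' z)"
proof -
  note lp = clinear_functional_props[OF l]
  have cq: "continuous_on D q" by (rule holomorphic_fun_imp_continuous_on[OF q])
  have "\<exists>r'. holomorphic_fun D r' \<and> (\<forall>z\<in>D. r z = l z ^ j * r' z)" if "j \<le> k" for j
    using that
  proof (induction j)
    case 0
    then show ?case using r by auto
  next
    case (Suc j)
    then obtain r' where r': "holomorphic_fun D r'" "\<And>z. z \<in> D \<Longrightarrow> r z = l z ^ j * r' z" by auto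
    have cr: "continuous_on D r'" by (rule holomorphic_fun_imp_continuous_on[OF r'(1)])
    have eq': "p z * r' z - l z ^ (k - j) * q z = 0" if z: "z \<in> D" for z
    proof (rule continuous_zero_by_density[OF D _ lp(6) w _ z])
      show "continuous_on D (\<lambda>z. p z * r' z - l z ^ (k - j) * q z)"
        by (intro continuous_intros cr cq polyfun_continuous_on p lp)
      fix z assume z: "z \<in> D" "l z \<noteq> 0"
      have "l z ^ j * (p z * r' z) = l z ^ k * q z" using eq[OF z(1)] r'(2)[OF z(1)] by (simp add: mult_ac)
      also have "l z ^ k = l z ^ j * l z ^ (k - j)" using Suc.prems by (simp flip: power_add)
      finally show "p z * r' z - l z ^ (k - j) * q z = 0" using z(2) by (simp add: mult_ac)
    qed
    have "r' z = 0" if z: "z \<in> D" "l z = 0" for z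
    proof (rule ccontr)
      assume "r' z \<noteq> 0"
      moreover have "open (D \<inter> r' -` (- {0}))" by (rule continuous_open_preimage[OF cr D]) auto
      ultimately obtain y where y: "y \<in> D" "r' y \<noteq> 0" "l y = 0" "p y \<noteq> 0"
        using dense[of "D \<inter> r' -` (- {0})" z] z by auto
      then show False using eq'[OF y(1)] Suc.prems by (auto simp: power_0_left split: if_splits)
    qed
    then obtain q' where q': "holomorphic_fun D q'" "\<And>z. z \<in> D \<Longrightarrow> r' z = l z * q' z"
      using holomorphic_divide_linear_form[OF D r'(1) l w] by blast
    then show ?case using r'(2) by (intro exI[of _ q']) (auto simp: mult_ac)
  qed
  then show ?thesis by blast
qed

lemma polyfun_prod_nonzero:
  assumes "finite I" "\<And>i. i \<in> I \<Longrightarrow> polyfun (f i) \<and> (\<exists>w. f i w \<noteq> 0)"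
  shows "\<exists>w. \<forall>i\<in>I. f i w \<noteq> 0"
  using assms
proof (induction I rule: finite_induct)
  case (insert i I)
  then obtain w where w: "\<forall>i\<in>I. f i w \<noteq> 0" by auto
  have pp: "polyfun (\<lambda>z. \<Prod>i\<in>I. f i z)" using insert.prems by (intro polyfun_prod) auto
  have "open {z. (\<Prod>i\<in>I. f i z) \<noteq> 0}"
    using open_Collect_neq[of "\<lambda>z. \<Prod>i\<in>I. f i z" "\<lambda>u. 0"] polyfun_continuous_on[OF pp] by simp
  moreover have "(\<Prod>i\<in>I. f i w) \<noteq> 0" using w insert.hyps by simp
  then have "w \<in> {z. (\<Prod>i\<in>I. f i z) \<noteq> 0}" by simp
  moreover obtain w' where w': "polyfun (f i)" "f i w' \<noteq> 0" using insert.prems[of i] by blast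
  ultimately obtain y where "y \<in> {z. (\<Prod>i\<in>I. f i z) \<noteq> 0}" "f i y \<noteq> 0"
    using polyfun_nonzero_dense[OF w'] by blast
  then show ?case using insert.hyps by auto
qed simp

section \<open>The group and its reflecting hyperplanes\<close>

lemma GL_simps [simp]:
  "carrier GL = {A. invertible A}" "A \<otimes>\<^bsub>GL\<^esub> B = A ** B" "\<one>\<^bsub>GL\<^esub> = mat 1"
  by (simp_all add: GL_def)

lemma invertible_mat_1: "invertible (mat 1 :: complex^'d^'d)"
  by (simp add: invertible_det_nz)

lemma matrix_inv_works:
  fixes A :: "complex^'d^'d"
  assumes "invertible A" shows "A ** matrix_inv A = mat 1" "matrix_inv A ** A = mat 1"
proof -
  have "\<exists>A'. A ** A' = mat 1 \<and> A' ** A = mat 1" using assms by (simp add: invertible_def)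
  then have "A ** matrix_inv A = mat 1 \<and> matrix_inv A ** A = mat 1"
    unfolding matrix_inv_def by (rule someI_ex)
  then show "A ** matrix_inv A = mat 1" "matrix_inv A ** A = mat 1" by auto
qed

lemma matrix_inv_unique:
  fixes A B :: "complex^'d^'d"
  assumes "A ** B = mat 1" "B ** A = mat 1" shows "matrix_inv A = B"
proof -
  have "invertible A" using assms by (auto simp: invertible_def)
  then show ?thesis
    using matrix_inv_works[of A] assms by (metis matrix_mul_assoc matrix_mul_lid matrix_mul_rid)
qed

lemma group_GL: "group (GL :: (complex^'d^'d) monoid)"
proof (rule groupI)
  fix A :: "complex^'d^'d" assume "A \<in> carrier GL"
  then have A: "invertible A" by simp
  show "\<exists>y\<in>carrier GL. y \<otimes>\<^bsub>GL\<^esub> A = \<one>\<^bsub>GL\<^esub>"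
    using matrix_inv_works[OF A] by (intro bexI[of _ "matrix_inv A"]) (auto simp: invertible_def)
qed (auto simp: invertible_mult invertible_mat_1 matrix_mul_assoc)

lemma inv_GL: "invertible A \<Longrightarrow> inv\<^bsub>GL\<^esub> A = matrix_inv A"
  for A :: "complex^'d^'d"
  by (rule group.inv_equality[OF group_GL])
     (use matrix_inv_works[of A] in \<open>auto simp: invertible_def\<close>)

text \<open>This form of the rank condition is visibly stable under conjugation.\<close>

lemma rank_one_iff:
  fixes M :: "complex^'d^'d"
  shows "rank M = 1 \<longleftrightarrow>
    M \<noteq> 0 \<and> (\<exists>c f. Vector_Spaces.linear (*s) (*) f \<and> (\<forall>x. M *v x = f x *s c))"
proof
  assume r1: "rank M = 1"
  obtain B where B: "B \<subseteq> rows M" "vec.independent B" "rows M \<subseteq> vec.span B" "card B = vec.dim (rows M)"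
    using vec.basis_exists by blast
  have "card B = 1" using B(4) r1 by (simp add: row_rank_def_gen)
  then obtain r where r: "B = {r}" by (rule card_1_singletonE)
  have "M \<noteq> 0"
  proof
    assume "M = 0"
    then have "rows M \<subseteq> {0}" by (auto simp: rows_def row_def vec_eq_iff)
    then have "r = 0" using B(1) r by auto
    then show False using B(2) r vec.dependent_zero[of B] by simp
  qed
  have "\<exists>k. row i M = k *s r" for i
  proof -
    have "row i M \<in> vec.span {r}" using B(3) r by (auto simp: rows_def)
    then show ?thesis by (auto simp: vec.span_singleton)
  qed
  then obtain c where c: "\<And>i. row i M = c i *s r" by metis
  have M: "M $ i $ j = c i * r $ j" for i j
    using c[of i] by (simp add: row_def vec_eq_iff)
  let ?f = "\<lambda>x. \<Sum>j\<in>UNIV. r $ j * x $ j"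
  have "Vector_Spaces.linear (*s) (*) ?f"
    by (rule clinear_functionalI) (simp_all add: algebra_simps sum.distrib sum_distrib_left)
  moreover have "M *v x = ?f x *s (\<chi> i. c i)" for x
  proof -
    have "(\<Sum>j\<in>UNIV. M $ i $ j * x $ j) = (\<Sum>j\<in>UNIV. r $ j * x $ j) * c i" for i
      unfolding sum_distrib_right by (rule sum.cong) (simp_all only: M mult_ac)
    then show ?thesis
      unfolding vec_eq_iff matrix_vector_mult_def vec_lambda_beta vector_smult_component by blast
  qed
  ultimately show "M \<noteq> 0 \<and> (\<exists>c f. Vector_Spaces.linear (*s) (*) f \<and> (\<forall>x. M *v x = f x *s c))"
    using \<open>M \<noteq> 0\<close> by blast
next
  assume "M \<noteq> 0 \<and> (\<exists>c f. Vector_Spaces.linear (*s) (*) f \<and> (\<forall>x. M *v x = f x *s c))"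
  then obtain c f where M0: "M \<noteq> 0" and M: "\<And>x. M *v x = f x *s c" by blast
  define r :: "complex^'d" where "r = (\<chi> j. f (axis j 1))"
  have entry: "M $ i $ j = c $ i * r $ j" for i j
  proof -
    have "M $ i $ j = (M *v axis j 1) $ i"
      by (simp add: matrix_vector_mult_def axis_def if_distrib cong: if_cong)
    then show ?thesis by (simp add: M r_def mult.commute)
  qed
  have "rows M \<subseteq> vec.span {r}"
    by (auto simp: rows_def row_def vec.span_singleton entry vec_eq_iff intro!: exI[of _ "c $ _"])
  then have "vec.dim (rows M) \<le> card {r}" by (rule vec.dim_le_card) simp
  then have "vec.dim (rows M) \<le> 1" by simp
  moreover have "vec.dim (rows M) \<noteq> 0"
  proof
    assume "vec.dim (rows M) = 0"
    then have "rows M \<subseteq> {0}" by (simp add: vec.dim_eq_0)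
    then have "row i M = 0" for i by (auto simp: rows_def)
    then have "M = 0" by (simp add: row_def vec_eq_iff)
    then show False using M0 by simp
  qed
  ultimately show "rank M = 1" unfolding row_rank_def_gen by linarith
qed

subsection \<open>Maps of finite order that fix a hyperplane\<close>

text \<open>The map \<open>B\<close> differs from the identity by \<open>z \<mapsto> l z v\<close>.  A change of coordinates \<open>T\<close> that makes \<open>l\<close> a
  coordinate turns it into a matrix that differs from the identity in a single column.\<close>

lemma det_fixing_hyperplane:
  fixes B :: "complex^'d^'d"
  assumes l: "Vector_Spaces.linear (*s) (*) l" and y0: "l y0 \<noteq> 0"
    and fixed: "\<And>z. l z = 0 \<Longrightarrow> B *v z = z"
  shows "\<exists>v. (\<forall>z. B *v z = z + l z *s v) \<and> det B = 1 + l v"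
proof -
  note lp = clinear_functional_props[OF l]
  define v where "v = (1 / l y0) *s (B *v y0 - y0)"
  have Bz: "B *v z = z + l z *s v" for z
  proof -
    have "l (z - (l z / l y0) *s y0) = 0" using y0 by (simp add: lp)
    then have "B *v (z - (l z / l y0) *s y0) = z - (l z / l y0) *s y0" by (rule fixed)
    then have "B *v z = z + (l z / l y0) *s (B *v y0 - y0)"
      by (simp add: matrix_vector_mult_diff_distrib vector_scalar_commute algebra_simps)
    also have "(l z / l y0) *s (B *v y0 - y0) = l z *s v" by (simp add: v_def vec_eq_iff)
    finally show ?thesis .
  qed
  have lexp: "l z = (\<Sum>j\<in>UNIV. l (axis j 1) * z $ j)" for z
  proof -
    interpret Vector_Spaces.linear "(*s)" "(*)" l by (rule l)
    have "l z = l (\<Sum>j\<in>UNIV. z $ j *s axis j 1)" by (simp add: basis_expansion)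
    also have "\<dots> = (\<Sum>j\<in>UNIV. z $ j * l (axis j 1))" by (simp only: sum scale)
    finally show ?thesis by (simp add: mult.commute)
  qed
  obtain p where p: "l (axis p 1) \<noteq> 0"
    using y0 lexp[of y0] by (metis (no_types, lifting) mult_zero_left sum.neutral)
  define T :: "complex^'d^'d" where "T = transpose (replace_column p (\<chi> j. l (axis j 1)))"
  have T: "(T *v x) $ i = (if i = p then l x else x $ i)" for x i
  proof (cases "i = p")
    case True
    then show ?thesis
      by (simp add: T_def transpose_def replace_column_def matrix_vector_mult_def lexp[of x])
  next
    case False
    have "(T *v x) $ i = (\<Sum>j\<in>UNIV. (if j = i then 1 else 0) * x $ j)"
      using False by (simp add: T_def transpose_def replace_column_def matrix_vector_mult_def)
    also have "\<dots> = (\<Sum>j\<in>UNIV. if j = i then x $ j else 0)" by (rule sum.cong) auto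
    finally show ?thesis using False by simp
  qed
  have "det T = l (axis p 1)" by (simp add: T_def det_transpose det_replace_column)
  then have dT: "det T \<noteq> 0" using p by simp
  let ?E = "replace_column p (T *v v + axis p 1)"
  have "T ** B = ?E ** T"
  proof (rule matrix_eqI)
    fix x
    have "T *v (x + l x *s v) = T *v x + l x *s (T *v v)"
      by (simp add: matrix_vector_right_distrib vector_scalar_commute)
    then show "(T ** B) *v x = (?E ** T) *v x"
      by (simp add: matrix_vector_mul_assoc[symmetric] Bz replace_column_vector T)
  qed
  then have "det T * det B = det ?E * det T" by (metis det_mul)
  moreover have "det ?E = l v + 1" by (simp add: det_replace_column T axis_def)
  ultimately have "det B = 1 + l v" using dT by simp
  then show ?thesis using Bz by blast
qed

lemma funpow_matrix: "((\<lambda>B. A ** B) ^^ n) C *v z = (((*v) A) ^^ n) (C *v z)"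
  for A C :: "complex^'d^'d"
  by (induction n) (auto simp: matrix_vector_mul_assoc[symmetric])

text \<open>If the determinant is one, then \<open>l v = 0\<close> and the \<open>n\<close>-th power of \<open>z \<mapsto> z + l z v\<close> is
  \<open>z \<mapsto> z + n l z v\<close>.\<close>

lemma finite_order_fixing_hyperplane:
  fixes B :: "complex^'d^'d"
  assumes l: "Vector_Spaces.linear (*s) (*) l" and y0: "l y0 \<noteq> 0"
    and fixed: "\<And>z. l z = 0 \<Longrightarrow> B *v z = z"
    and ord: "n > 0" "((\<lambda>C. B ** C) ^^ n) (mat 1) = mat 1" and d: "det B = 1"
  shows "B = mat 1"
proof -
  note lp = clinear_functional_props[OF l]
  obtain v where v: "\<And>z. B *v z = z + l z *s v" "det B = 1 + l v"
    using det_fixing_hyperplane[OF l y0 fixed] by blast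
  then have lv: "l v = 0" using d by simp
  have "(((*v) B) ^^ k) z = z + (of_nat k * l z) *s v" for k z
  proof (induction k)
    case (Suc k)
    have "(((*v) B) ^^ Suc k) z = B *v (z + (of_nat k * l z) *s v)" using Suc by simp
    also have "\<dots> = z + (of_nat (Suc k) * l z) *s v"
      by (simp add: v(1) lp lv vec_eq_iff algebra_simps)
    finally show ?case .
  qed simp
  moreover have "(((*v) B) ^^ n) y0 = y0"
    using funpow_matrix[of n B "mat 1" y0] ord(2) by simp
  ultimately have "(of_nat n * l y0) *s v = 0" by (metis add_cancel_right_right)
  then have "v = 0" using ord(1) y0 by (simp add: vec_eq_iff)
  then show ?thesis by (intro matrix_eqI) (simp add: v(1))
qed

subsection \<open>Finite reflection groups\<close>

locale reflection_group =
  fixes G :: "(complex^'d^'d) set"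
  assumes finite_reflection_group: "finite_reflection_group G"
begin

abbreviation R :: "(complex^'d) set set" where "R \<equiv> reflecting_hyperplanes G"

lemma finite_G: "finite G" and subgroup_G: "subgroup G GL"
  using finite_reflection_group by (auto simp: finite_reflection_group_def)

lemma invertible_G: "A \<in> G \<Longrightarrow> invertible A"
  using subgroup.subset[OF subgroup_G] by auto

lemma one_G: "mat 1 \<in> G"
  using subgroup.one_closed[OF subgroup_G] by simp

lemma mult_G: "A \<in> G \<Longrightarrow> B \<in> G \<Longrightarrow> A ** B \<in> G"
  using subgroup.m_closed[OF subgroup_G, of A B] by simp

lemma inv_G: "A \<in> G \<Longrightarrow> matrix_inv A \<in> G"
  using subgroup.m_inv_closed[OF subgroup_G, of A] inv_GL[OF invertible_G] by simp

lemma inv_left: "A \<in> G \<Longrightarrow> matrix_inv A ** A = mat 1"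
  and inv_right: "A \<in> G \<Longrightarrow> A ** matrix_inv A = mat 1"
  using matrix_inv_works[OF invertible_G] by auto

lemma inv_cancel:
  "A \<in> G \<Longrightarrow> matrix_inv A *v (A *v z) = z" "A \<in> G \<Longrightarrow> A *v (matrix_inv A *v z) = z"
  by (simp_all add: matrix_vector_mul_assoc inv_left inv_right)

lemma inv_inv: "A \<in> G \<Longrightarrow> matrix_inv (matrix_inv A) = A"
  by (intro matrix_inv_unique inv_left inv_right)

lemma act_inv: "A \<in> G \<Longrightarrow> act (matrix_inv A) z = A *v z"
  by (simp add: act_def inv_inv)

lemma funpow_G: "A \<in> G \<Longrightarrow> ((\<lambda>B. A ** B) ^^ n) (mat 1) \<in> G"
  by (induction n) (auto simp: one_G mult_G)

lemma finite_order:
  assumes A: "A \<in> G" obtains n where "n > 0" "((\<lambda>B. A ** B) ^^ n) (mat 1) = mat 1"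
proof -
  let ?p = "\<lambda>n. ((\<lambda>B. A ** B) ^^ n) (mat 1)"
  have "\<not> inj ?p"
  proof
    assume "inj ?p"
    then have "infinite (range ?p)" by (simp add: finite_image_iff)
    moreover have "range ?p \<subseteq> G" using funpow_G[OF A] by blast
    ultimately show False using finite_G finite_subset by blast
  qed
  then obtain m n where mn: "m < n" "?p m = ?p n" using linorder_injI[of ?p] by blast
  have cancel: "?p (m + k) = ?p m \<Longrightarrow> ?p k = mat 1" for m k
  proof (induction m)
    case (Suc m)
    then have "A ** ?p (m + k) = A ** ?p m" by simp
    then have "matrix_inv A ** (A ** ?p (m + k)) = matrix_inv A ** (A ** ?p m)" by simp
    then have "?p (m + k) = ?p m" by (simp add: matrix_mul_assoc inv_left[OF A])
    then show ?case by (rule Suc.IH)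
  qed simp
  have "?p (n - m) = mat 1" using cancel[of m "n - m"] mn by simp
  then show thesis using that[of "n - m"] mn by simp
qed

lemma det_funpow: "det (((\<lambda>B. A ** B) ^^ n) (mat 1)) = det A ^ n"
  for A :: "complex^'d^'d"
  by (induction n) (auto simp: det_mul)

lemma det_G: "A \<in> G \<Longrightarrow> cmod (det A) = 1"
proof -
  assume "A \<in> G"
  then obtain n where n: "n > 0" "((\<lambda>B. A ** B) ^^ n) (mat 1) = mat 1" by (rule finite_order)
  then have "det A ^ n = 1" using det_funpow[of n A] by simp
  then show ?thesis using n(1) power_eq_1_iff by blast
qed

lemma finite_R: "finite R"
proof -
  have "R \<subseteq> (\<lambda>\<sigma>. {z. (mat 1 - \<sigma>) *v z = 0}) ` G" by (auto simp: reflecting_hyperplanes_def)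
  then show ?thesis using finite_G finite_subset by blast
qed

lemma hyperplane_cases:
  assumes "H \<in> R" obtains \<tau> where "\<tau> \<in> G" "complex_reflection \<tau>" "H = {z. \<tau> *v z = z}"
proof -
  obtain \<tau> where t: "\<tau> \<in> G" "complex_reflection \<tau>" "H = {z. (mat 1 - \<tau>) *v z = 0}"
    using assms by (auto simp: reflecting_hyperplanes_def)
  have "(mat 1 - \<tau>) *v z = z - \<tau> *v z" for z by (simp add: matrix_vector_mult_diff_rdistrib)
  then have "H = {z. \<tau> *v z = z}" using t(3) by auto
  then show thesis using t that by blast
qed

lemma hyperplane_proper: "H \<in> R \<Longrightarrow> H \<noteq> UNIV"
proof
  assume H: "H \<in> R" "H = UNIV"
  obtain \<tau> where t: "complex_reflection \<tau>" "H = {z. \<tau> *v z = z}"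
    using hyperplane_cases[OF H(1)] by blast
  have "\<tau> *v z = z" for z using H(2) t(2) by blast
  then have "mat 1 - \<tau> = 0"
    by (intro matrix_eqI) (simp add: matrix_vector_mult_diff_rdistrib)
  moreover have "rank (mat 1 - \<tau>) = 1" using t(1) unfolding complex_reflection_def by blast
  ultimately show False unfolding rank_one_iff by blast
qed

lemma stabilizer_iff: "\<sigma> \<in> pointwise_stabilizer G H \<longleftrightarrow> \<sigma> \<in> G \<and> (\<forall>z\<in>H. \<sigma> *v z = z)"
  unfolding pointwise_stabilizer_def act_def by (auto simp: inv_cancel) (metis inv_cancel)+

text \<open>Conjugation by \<open>\<sigma>\<close> turns a reflection with mirror \<open>H\<close> into one with mirror \<open>\<sigma> H\<close>.\<close>

lemma hyperplane_image:
  assumes H: "H \<in> R" and s: "\<sigma> \<in> G" shows "(*v) \<sigma> ` H \<in> R"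
proof -
  obtain \<tau> where t: "\<tau> \<in> G" "complex_reflection \<tau>" "H = {z. \<tau> *v z = z}"
    using hyperplane_cases[OF H] by blast
  let ?t = "\<sigma> ** \<tau> ** matrix_inv \<sigma>"
  have tG: "?t \<in> G" using s t by (intro mult_G inv_G)
  have eq: "mat 1 - ?t = \<sigma> ** (mat 1 - \<tau>) ** matrix_inv \<sigma>"
    by (rule matrix_eqI)
       (simp add: matrix_vector_mul_assoc[symmetric] matrix_vector_mult_diff_rdistrib
         matrix_vector_mult_diff_distrib inv_cancel[OF s])
  have "rank (mat 1 - ?t) = 1"
  proof -
    have "rank (mat 1 - \<tau>) = 1" using t(2) unfolding complex_reflection_def by blast
    then obtain c f where M0: "mat 1 - \<tau> \<noteq> 0" and f: "Vector_Spaces.linear (*s) (*) f"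
      and M: "\<And>x. (mat 1 - \<tau>) *v x = f x *s c"
      unfolding rank_one_iff by blast
    note fp = clinear_functional_props[OF f]
    have "mat 1 - ?t \<noteq> 0"
    proof
      assume z: "mat 1 - ?t = 0"
      have "mat 1 - \<tau> = 0"
      proof (rule matrix_eqI)
        fix x
        have "\<sigma> *v ((mat 1 - \<tau>) *v x) = (mat 1 - ?t) *v (\<sigma> *v x)"
          unfolding eq by (simp add: matrix_vector_mul_assoc[symmetric] inv_cancel[OF s])
        also have "\<dots> = 0" by (simp add: z)
        finally have "matrix_inv \<sigma> *v (\<sigma> *v ((mat 1 - \<tau>) *v x)) = 0" by simp
        then show "(mat 1 - \<tau>) *v x = 0 *v x" by (simp add: inv_cancel[OF s])
      qed
      then show False using M0 by blast
    qed
    moreover have "(mat 1 - ?t) *v x = f (matrix_inv \<sigma> *v x) *s (\<sigma> *v c)" for x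
      unfolding eq by (simp add: matrix_vector_mul_assoc[symmetric] M vector_scalar_commute)
    moreover have "Vector_Spaces.linear (*s) (*) (\<lambda>x. f (matrix_inv \<sigma> *v x))"
      by (rule clinear_functionalI) (simp_all add: fp matrix_vector_right_distrib vector_scalar_commute)
    ultimately show ?thesis unfolding rank_one_iff by blast
  qed
  moreover have "\<exists>n::nat. n > 0 \<and> ?t [^]\<^bsub>GL\<^esub> n = \<one>\<^bsub>GL\<^esub>"
  proof -
    obtain n where n: "n > 0" "((\<lambda>B. ?t ** B) ^^ n) (mat 1) = mat 1" using finite_order[OF tG] .
    interpret group "GL :: (complex^'d^'d) monoid" by (rule group_GL)
    have "?t [^]\<^bsub>GL\<^esub> k = ((\<lambda>B. ?t ** B) ^^ k) (mat 1)" for k :: nat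
    proof (induction k)
      case (Suc k)
      have "?t [^]\<^bsub>GL\<^esub> Suc k = ?t \<otimes>\<^bsub>GL\<^esub> ?t [^]\<^bsub>GL\<^esub> k"
        by (rule nat_pow_Suc2) (use invertible_G[OF tG] in simp)
      then show ?case using Suc by simp
    qed simp
    then show ?thesis using n by (intro exI[of _ n]) simp
  qed
  ultimately have "complex_reflection ?t"
    using invertible_G[OF tG] by (simp add: complex_reflection_def)
  moreover have "(*v) \<sigma> ` H = {z. (mat 1 - ?t) *v z = 0}"
  proof (rule Set.set_eqI)
    fix z
    have "z \<in> (*v) \<sigma> ` H \<longleftrightarrow> matrix_inv \<sigma> *v z \<in> H"
      by (metis (no_types, lifting) image_iff inv_cancel[OF s])
    also have "\<dots> \<longleftrightarrow> \<sigma> *v (\<tau> *v (matrix_inv \<sigma> *v z)) = z"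
      using t(3) by (metis (mono_tags, lifting) inv_cancel[OF s] mem_Collect_eq)
    also have "\<dots> \<longleftrightarrow> z \<in> {z. (mat 1 - ?t) *v z = 0}"
      by (auto simp: matrix_vector_mult_diff_rdistrib matrix_vector_mul_assoc[symmetric])
    finally show "z \<in> (*v) \<sigma> ` H \<longleftrightarrow> z \<in> {z. (mat 1 - ?t) *v z = 0}" .
  qed
  ultimately show ?thesis using tG by (auto simp: reflecting_hyperplanes_def)
qed

lemma bij_betw_hyperplanes:
  assumes s: "\<sigma> \<in> G" shows "bij_betw (\<lambda>H. (*v) \<sigma> ` H) R R"
proof (rule bij_betwI[where g = "\<lambda>H. (*v) (matrix_inv \<sigma>) ` H"])
  show "(*v) (matrix_inv \<sigma>) ` (*v) \<sigma> ` H = H" if "H \<in> R" for H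
    by (simp add: image_image inv_cancel[OF s])
  show "(*v) \<sigma> ` (*v) (matrix_inv \<sigma>) ` H = H" if "H \<in> R" for H
    by (simp add: image_image inv_cancel[OF s])
qed (use hyperplane_image s inv_G in auto)

end

section \<open>The polynomial of a one-dimensional representation\<close>

locale reflection_rep = reflection_group G for G :: "(complex^'d^'d) set" +
  fixes \<rho> :: "complex^'d^'d \<Rightarrow> complex"
    and l :: "(complex^'d) set \<Rightarrow> complex^'d \<Rightarrow> complex" and a :: "(complex^'d) set \<Rightarrow> complex^'d^'d"
  assumes rep: "one_dim_rep G \<rho>" and forms: "defining_forms G l" and gens: "stabilizer_generators G a"
begin

abbreviation e :: "(complex^'d) set \<Rightarrow> nat" where "e H \<equiv> rep_exponent \<rho> (a H)"
abbreviation \<l> :: "complex^'d \<Rightarrow> complex" where "\<l> \<equiv> rep_poly G l a \<rho>"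

lemma rho_mult: "A \<in> G \<Longrightarrow> B \<in> G \<Longrightarrow> \<rho> (A ** B) = \<rho> A * \<rho> B"
  and rho_nz: "A \<in> G \<Longrightarrow> \<rho> A \<noteq> 0"
  using rep by (auto simp: one_dim_rep_def hom_def Pi_iff)

lemma rho_one: "\<rho> (mat 1) = 1"
  using rho_mult[OF one_G one_G] rho_nz[OF one_G] by simp

lemma rho_inv: "A \<in> G \<Longrightarrow> \<rho> (matrix_inv A) = inverse (\<rho> A)"
  using rho_mult[of "matrix_inv A" A] inv_G[of A] inv_left[of A] rho_one
    inverse_unique[of "\<rho> A" "\<rho> (matrix_inv A)"] by (simp add: mult.commute)

lemma det_inv: "A \<in> G \<Longrightarrow> det (matrix_inv A) = inverse (det A)"
  using det_mul[of "matrix_inv A" A] inv_left[of A] inverse_unique[of "det A" "det (matrix_inv A)"]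
  by (simp add: mult.commute)

lemma l_linear: "H \<in> R \<Longrightarrow> Vector_Spaces.linear (*s) (*) (l H)"
  and l_zero: "H \<in> R \<Longrightarrow> l H z = 0 \<longleftrightarrow> z \<in> H"
  using forms by (auto simp: defining_forms_def)

lemma l_nonzero: "H \<in> R \<Longrightarrow> \<exists>w. l H w \<noteq> 0"
  using l_zero hyperplane_proper by blast

lemma a_G: "H \<in> R \<Longrightarrow> a H \<in> G"
  and a_generates: "H \<in> R \<Longrightarrow> generate GL {a H} = pointwise_stabilizer G H"
  using gens by (auto simp: stabilizer_generators_def)

lemma a_fixes: "H \<in> R \<Longrightarrow> z \<in> H \<Longrightarrow> a H *v z = z"
  using a_generates[of H] generate.incl[of "a H" "{a H}" GL] stabilizer_iff by auto

text \<open>The exponent of \<open>H\<close> in \<open>\<l>\<close> depends only on the stabilizer of \<open>H\<close> and not on the chosen generator.\<close>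

lemma rho_det_stabilizer:
  assumes H: "H \<in> R"
  shows "\<rho> (a H) = det (a H) ^ c \<longleftrightarrow> (\<forall>x\<in>pointwise_stabilizer G H. \<rho> x = det x ^ c)"
proof
  assume eq: "\<rho> (a H) = det (a H) ^ c"
  have "x \<in> G \<and> \<rho> x = det x ^ c" if "x \<in> generate GL {a H}" for x
    using that
  proof (induction rule: generate.induct)
    case one
    then show ?case using one_G rho_one by simp
  next
    case (incl h)
    then show ?case using eq a_G[OF H] by simp
  next
    case (inv h)
    then show ?case
      using eq a_G[OF H] inv_GL[OF invertible_G[OF a_G[OF H]]] inv_G rho_inv det_inv
      by (simp add: power_inverse)
  next
    case (eng h1 h2)
    then show ?case by (simp add: mult_G rho_mult det_mul power_mult_distrib)
  qed
  then show "\<forall>x\<in>pointwise_stabilizer G H. \<rho> x = det x ^ c" using a_generates[OF H] by auto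
next
  assume "\<forall>x\<in>pointwise_stabilizer G H. \<rho> x = det x ^ c"
  then show "\<rho> (a H) = det (a H) ^ c"
    using a_generates[OF H] generate.incl[of "a H" "{a H}" GL] by auto
qed

text \<open>Conjugation by \<open>\<sigma>\<close> maps the stabilizer of \<open>H\<close> onto that of \<open>\<sigma> H\<close>, and neither \<open>\<rho>\<close> nor the
  determinant changes under conjugation.\<close>

lemma exponent_image:
  assumes H: "H \<in> R" and s: "\<sigma> \<in> G"
  shows "e ((*v) \<sigma> ` H) = e H"
proof -
  have imp: "\<forall>x\<in>pointwise_stabilizer G ((*v) \<sigma> ` H). \<rho> x = det x ^ c"
    if s: "\<sigma> \<in> G" and c: "\<forall>x\<in>pointwise_stabilizer G H. \<rho> x = det x ^ c" for \<sigma> H c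
  proof
    fix x assume "x \<in> pointwise_stabilizer G ((*v) \<sigma> ` H)"
    then have x: "x \<in> G" "\<And>z. z \<in> H \<Longrightarrow> x *v (\<sigma> *v z) = \<sigma> *v z" by (auto simp: stabilizer_iff)
    let ?y = "matrix_inv \<sigma> ** (x ** \<sigma>)"
    have "?y \<in> pointwise_stabilizer G H"
      using x s by (auto simp: stabilizer_iff mult_G inv_G matrix_vector_mul_assoc[symmetric] inv_cancel)
    then have "\<rho> ?y = det ?y ^ c" using c by blast
    moreover have "\<rho> ?y = \<rho> x"
      using s x(1) rho_nz[OF s] by (simp add: rho_mult mult_G inv_G rho_inv)
    moreover have "det ?y = det x"
    proof -
      have "det \<sigma> \<noteq> 0" using det_G[OF s] by auto
      then show ?thesis using s by (simp add: det_mul det_inv)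
    qed
    ultimately show "\<rho> x = det x ^ c" by simp
  qed
  let ?H' = "(*v) \<sigma> ` H"
  have bk: "(*v) (matrix_inv \<sigma>) ` ?H' = H" by (simp add: image_image inv_cancel[OF s])
  have "\<rho> (a ?H') = det (a ?H') ^ c \<longleftrightarrow> \<rho> (a H) = det (a H) ^ c" for c
    unfolding rho_det_stabilizer[OF H] rho_det_stabilizer[OF hyperplane_image[OF H s]]
  proof
    assume "\<forall>x\<in>pointwise_stabilizer G ?H'. \<rho> x = det x ^ c"
    from imp[OF inv_G[OF s] this] show "\<forall>x\<in>pointwise_stabilizer G H. \<rho> x = det x ^ c"
      unfolding bk .
  qed (rule imp[OF s])
  then show ?thesis by (simp add: rep_exponent_def)
qed

text \<open>Both sides are linear forms with kernel \<open>H\<close>.\<close>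

lemma l_transform:
  assumes H: "H \<in> R" and s: "\<sigma> \<in> G"
  shows "\<exists>\<kappa>. \<kappa> \<noteq> 0 \<and> (\<forall>z. l ((*v) \<sigma> ` H) (\<sigma> *v z) = \<kappa> * l H z)"
proof -
  let ?H' = "(*v) \<sigma> ` H"
  have H': "?H' \<in> R" by (rule hyperplane_image[OF H s])
  note lp = clinear_functional_props[OF l_linear[OF H']]
  let ?g = "\<lambda>z. l ?H' (\<sigma> *v z)"
  have lin: "Vector_Spaces.linear (*s) (*) ?g"
    by (rule clinear_functionalI) (simp_all add: lp matrix_vector_right_distrib vector_scalar_commute)
  have zero: "?g z = 0 \<longleftrightarrow> l H z = 0" for z
    unfolding l_zero[OF H'] l_zero[OF H] by (metis (no_types, lifting) image_iff inv_cancel(1)[OF s])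
  obtain y where y: "l H y \<noteq> 0" using l_nonzero[OF H] by blast
  have "?g z = (?g y / l H y) * l H z" for z
    by (rule clinear_functional_proportional[OF l_linear[OF H] lin _ y]) (simp add: zero)
  moreover have "?g y / l H y \<noteq> 0" using zero[of y] y by simp
  ultimately show ?thesis by (intro exI[of _ "?g y / l H y"] conjI allI)
qed

lemma rep_poly_transform:
  assumes s: "\<sigma> \<in> G" shows "\<exists>c. \<forall>z. \<l> (\<sigma> *v z) = c * \<l> z"
proof -
  obtain \<kappa> where \<kappa>: "\<And>H z. H \<in> R \<Longrightarrow> l ((*v) \<sigma> ` H) (\<sigma> *v z) = \<kappa> H * l H z"
    using l_transform[OF _ s] by metis
  have "\<l> (\<sigma> *v z) = (\<Prod>H\<in>R. \<kappa> H ^ e H) * \<l> z" for z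
  proof -
    have "\<l> (\<sigma> *v z) = (\<Prod>H\<in>R. l ((*v) \<sigma> ` H) (\<sigma> *v z) ^ e ((*v) \<sigma> ` H))"
      unfolding rep_poly_def by (rule prod.reindex_bij_betw[OF bij_betw_hyperplanes[OF s], symmetric])
    also have "\<dots> = (\<Prod>H\<in>R. (\<kappa> H * l H z) ^ e H)"
      by (rule prod.cong) (simp_all add: \<kappa> exponent_image s)
    finally show ?thesis by (simp add: rep_poly_def power_mult_distrib prod.distrib)
  qed
  then show ?thesis by blast
qed

lemma polyfun_rep_poly: "polyfun \<l>"
  unfolding rep_poly_def[abs_def]
  by (intro polyfun_prod polyfun_power clinear_functional_props(6) l_linear)

lemma all_forms_nonzero: "\<exists>w. \<forall>H\<in>R. l H w \<noteq> 0"
  using polyfun_prod_nonzero[OF finite_R, of l] clinear_functional_props(6)[OF l_linear] l_nonzero by blast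

lemma rep_poly_nonzero: "\<exists>w. \<l> w \<noteq> 0"
  using all_forms_nonzero finite_R by (auto simp: rep_poly_def)

text \<open>The character of \<open>\<l>\<close>; it is unique because \<open>\<l>\<close> does not vanish identically.\<close>

definition \<chi>\<^sub>l :: "complex^'d^'d \<Rightarrow> complex" where
  "\<chi>\<^sub>l \<sigma> = (SOME c. \<forall>z. \<l> (\<sigma> *v z) = c * \<l> z)"

lemma char: "\<sigma> \<in> G \<Longrightarrow> \<l> (\<sigma> *v z) = \<chi>\<^sub>l \<sigma> * \<l> z"
  using someI_ex[OF rep_poly_transform] unfolding \<chi>\<^sub>l_def by blast

lemma char_mult: "\<sigma> \<in> G \<Longrightarrow> \<tau> \<in> G \<Longrightarrow> \<chi>\<^sub>l (\<sigma> ** \<tau>) = \<chi>\<^sub>l \<sigma> * \<chi>\<^sub>l \<tau>"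
proof -
  assume s: "\<sigma> \<in> G" "\<tau> \<in> G"
  obtain w where w: "\<l> w \<noteq> 0" using rep_poly_nonzero by blast
  have "\<chi>\<^sub>l (\<sigma> ** \<tau>) * \<l> w = \<l> (\<sigma> *v (\<tau> *v w))"
    using char[OF mult_G[OF s], of w] by (simp add: matrix_vector_mul_assoc)
  also have "\<dots> = \<chi>\<^sub>l \<sigma> * \<chi>\<^sub>l \<tau> * \<l> w" using char s by simp
  finally show ?thesis using w by simp
qed

lemma char_one: "\<chi>\<^sub>l (mat 1) = 1"
proof -
  obtain w where "\<l> w \<noteq> 0" using rep_poly_nonzero by blast
  then show ?thesis using char[OF one_G, of w] by simp
qed

lemma cmod_char: "\<sigma> \<in> G \<Longrightarrow> cmod (\<chi>\<^sub>l \<sigma>) = 1"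
proof -
  assume s: "\<sigma> \<in> G"
  then obtain n where n: "n > 0" "((\<lambda>B. \<sigma> ** B) ^^ n) (mat 1) = mat 1" by (rule finite_order)
  have "\<chi>\<^sub>l (((\<lambda>B. \<sigma> ** B) ^^ k) (mat 1)) = \<chi>\<^sub>l \<sigma> ^ k" for k
    by (induction k) (simp_all add: char_one char_mult[OF s funpow_G[OF s]])
  then have "\<chi>\<^sub>l \<sigma> ^ n = 1" using n char_one by metis
  then show ?thesis using n(1) power_eq_1_iff by blast
qed

lemma stabilizer_det_one:
  assumes H: "H \<in> R" and x: "x \<in> G" "\<And>z. z \<in> H \<Longrightarrow> x *v z = z" and d: "det x = 1"
  shows "x = mat 1"
proof -
  obtain y0 where y0: "l H y0 \<noteq> 0" using l_nonzero[OF H] by blast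
  obtain n where n: "n > 0" "((\<lambda>B. x ** B) ^^ n) (mat 1) = mat 1" using finite_order[OF x(1)] .
  show ?thesis
    by (rule finite_order_fixing_hyperplane[OF l_linear[OF H] y0 _ n d]) (use x(2) l_zero[OF H] in auto)
qed

lemma l_generator: "H \<in> R \<Longrightarrow> l H (a H *v z) = det (a H) * l H z"
proof -
  assume H: "H \<in> R"
  note lp = clinear_functional_props[OF l_linear[OF H]]
  obtain y0 where y0: "l H y0 \<noteq> 0" using l_nonzero[OF H] by blast
  obtain v where "\<And>z. a H *v z = z + l H z *s v" "det (a H) = 1 + l H v"
    using det_fixing_hyperplane[OF l_linear[OF H] y0, of "a H"] a_fixes[OF H] l_zero[OF H] by blast
  then show ?thesis by (simp add: lp algebra_simps)
qed

lemma det_generator_power: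
  assumes H: "H \<in> R" and k: "det (a H) ^ k = 1" shows "((\<lambda>B. a H ** B) ^^ k) (mat 1) = mat 1"
proof (rule stabilizer_det_one[OF H])
  show "((\<lambda>B. a H ** B) ^^ k) (mat 1) \<in> G" by (rule funpow_G[OF a_G[OF H]])
  show "((\<lambda>B. a H ** B) ^^ k) (mat 1) *v z = z" if "z \<in> H" for z
    unfolding funpow_matrix by (induction k) (use that a_fixes[OF H] in auto)
  show "det (((\<lambda>B. a H ** B) ^^ k) (mat 1)) = 1" using k by (simp add: det_funpow)
qed

text \<open>The determinant \<open>\<epsilon>\<close> of the generator has the same order \<open>m\<close> as the generator, so \<open>\<rho> (a H)\<close> is an
  \<open>m\<close>-th root of unity and thus a power of the primitive \<open>m\<close>-th root \<open>\<epsilon>\<close>; the least exponent is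
  smaller than \<open>m\<close>.\<close>

lemma exponent_minimal:
  assumes H: "H \<in> R" and k: "0 < k" "k \<le> e H"
  shows "det (a H) ^ k \<noteq> 1"
proof
  let ?\<epsilon> = "det (a H)"
  assume 1: "?\<epsilon> ^ k = 1"
  define m where "m = (LEAST m. 0 < m \<and> ?\<epsilon> ^ m = 1)"
  have m: "0 < m" "?\<epsilon> ^ m = 1"
    using LeastI[of "\<lambda>m. 0 < m \<and> ?\<epsilon> ^ m = 1" k] k(1) 1 by (auto simp: m_def)
  have \<epsilon>0: "?\<epsilon> \<noteq> 0" using det_G[OF a_G[OF H]] by auto
  have inj: "inj_on (\<lambda>i. ?\<epsilon> ^ i) {..<m}"
  proof (rule linorder_inj_onI)
    fix i j assume ij: "i < j" "i \<in> {..<m}" "j \<in> {..<m}"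
    show "?\<epsilon> ^ i \<noteq> ?\<epsilon> ^ j"
    proof
      assume "?\<epsilon> ^ i = ?\<epsilon> ^ j"
      also have "?\<epsilon> ^ j = ?\<epsilon> ^ i * ?\<epsilon> ^ (j - i)" using ij by (simp flip: power_add)
      finally have "?\<epsilon> ^ (j - i) = 1" using \<epsilon>0 by simp
      then have "m \<le> j - i" unfolding m_def using ij(1) by (intro Least_le) auto
      then show False using ij by auto
    qed
  qed auto
  have "(\<lambda>i. ?\<epsilon> ^ i) ` {..<m} = {z. z ^ m = 1}"
  proof (rule card_subset_eq)
    show "finite {z::complex. z ^ m = 1}" using m(1) by (intro card_ge_0_finite) (simp add: card_roots_unity_eq)
    show "(\<lambda>i. ?\<epsilon> ^ i) ` {..<m} \<subseteq> {z. z ^ m = 1}"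
      using m(2) by (auto simp: power_mult[symmetric] mult.commute[of _ m]) (simp add: power_mult)
    show "card ((\<lambda>i. ?\<epsilon> ^ i) ` {..<m}) = card {z::complex. z ^ m = 1}"
      using m(1) by (simp add: card_image[OF inj] card_roots_unity_eq)
  qed
  moreover have "\<rho> (a H) ^ m = 1"
  proof -
    have "\<rho> (((\<lambda>B. a H ** B) ^^ i) (mat 1)) = \<rho> (a H) ^ i" for i
      by (induction i) (simp_all add: rho_one rho_mult[OF a_G[OF H] funpow_G[OF a_G[OF H]]])
    then show ?thesis using det_generator_power[OF H m(2)] rho_one by metis
  qed
  ultimately have ex: "\<exists>c. \<rho> (a H) = ?\<epsilon> ^ c" by blast
  then have "\<rho> (a H) = ?\<epsilon> ^ e H" unfolding rep_exponent_def by (rule LeastI_ex)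
  also have "\<dots> = ?\<epsilon> ^ (e H - k) * ?\<epsilon> ^ k" using k by (simp flip: power_add)
  finally have "\<rho> (a H) = ?\<epsilon> ^ (e H - k)" using 1 by simp
  then have "e H \<le> e H - k" unfolding rep_exponent_def by (rule Least_le)
  then show False using k by simp
qed

lemma hyperplane_subset_imp_eq: "H \<in> R \<Longrightarrow> H' \<in> R \<Longrightarrow> H \<subseteq> H' \<Longrightarrow> H = H'"
proof -
  assume H: "H \<in> R" "H' \<in> R" "H \<subseteq> H'"
  obtain y where y: "l H y \<noteq> 0" using l_nonzero[OF H(1)] by blast
  obtain y' where y': "l H' y' \<noteq> 0" using l_nonzero[OF H(2)] by blast
  have "l H' z = (l H' y / l H y) * l H z" for z
    by (rule clinear_functional_proportional[OF l_linear[OF H(1)] l_linear[OF H(2)] _ y])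
       (use H l_zero in auto)
  then have "l H z = 0" if "l H' z = 0" for z using y' that by (metis divisors_zero mult_zero_left)
  then show ?thesis using H l_zero by blast
qed

text \<open>A point of \<open>H\<close> on a further hyperplane can be moved off it inside \<open>H\<close>, since distinct hyperplanes
  do not contain each other.\<close>

lemma other_forms_nonzero_dense:
  assumes H: "H \<in> R" and S: "finite S" "S \<subseteq> R" "H \<notin> S" and U: "open U" "z \<in> U" "z \<in> H"
  shows "\<exists>y\<in>U. y \<in> H \<and> (\<forall>H'\<in>S. l H' y \<noteq> 0)"
  using S U
proof (induction S arbitrary: U z rule: finite_induct)
  case (insert H' S)
  note lH = clinear_functional_props[OF l_linear[OF H]]
  have H': "H' \<in> R" using insert.prems by auto
  note lH' = clinear_functional_props[OF l_linear[OF H']]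
  obtain y where y: "y \<in> U" "y \<in> H" "\<forall>K\<in>S. l K y \<noteq> 0"
    using insert.IH[of U z] insert.prems by auto
  let ?P = "\<lambda>x. \<Prod>K\<in>S. l K x"
  have P: "polyfun ?P" using insert.prems by (intro polyfun_prod clinear_functional_props(6) l_linear) auto
  have "open (U \<inter> {x. ?P x \<noteq> 0})"
    using insert.prems open_Collect_neq[of ?P "\<lambda>u. 0"] polyfun_continuous_on[OF P] by (intro open_Int) auto
  moreover have "y \<in> U \<inter> {x. ?P x \<noteq> 0}" using y insert.hyps by simp
  ultimately obtain r where r: "r > 0" "ball y r \<subseteq> U \<inter> {x. ?P x \<noteq> 0}"
    using open_contains_ball by blast
  show ?case
  proof (cases "l H' y = 0")
    case False
    then show ?thesis using y by auto
  next
    case True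
    obtain v where v: "v \<in> H" "l H' v \<noteq> 0"
      using hyperplane_subset_imp_eq[OF H H'] insert.prems l_zero[OF H'] by auto
    have vn: "norm v > 0" using v(2) lH'(4) by auto
    let ?t = "complex_of_real (r / (2 * norm v))"
    let ?y = "y + ?t *s v"
    have "norm (?t *s v) < r" using r(1) vn by (simp add: norm_vector_smult norm_divide norm_mult)
    then have "?y \<in> U \<inter> {x. ?P x \<noteq> 0}" using r(2) by (auto simp: dist_norm subset_iff)
    moreover have "l H' ?y \<noteq> 0" using True v r(1) vn by (simp add: lH')
    moreover have "?y \<in> H"
    proof -
      have "l H y = 0" "l H v = 0" using y(2) v(1) l_zero[OF H] by blast+
      then have "l H ?y = 0" by (simp only: lH) simp
      then show ?thesis using l_zero[OF H] by blast
    qed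
    ultimately show ?thesis using insert.hyps by (intro bexI[of _ ?y]) auto
  qed
qed auto

text \<open>The generator \<open>a H\<close> acts on \<open>\<l>\<close>, and hence on \<open>F\<close>, through the power of its determinant that belongs
  to \<open>H\<close>, so \<open>F\<close> is divisible by that power of the form of \<open>H\<close>.  The powers of different forms have no
  common factor and can be split off one after the other.\<close>

theorem relative_invariant_divisible:
  assumes D: "open D" and inv: "\<And>\<sigma> z. \<sigma> \<in> G \<Longrightarrow> z \<in> D \<Longrightarrow> \<sigma> *v z \<in> D"
    and F: "holomorphic_fun D F"
    and rel: "\<And>\<sigma> z. \<sigma> \<in> G \<Longrightarrow> z \<in> D \<Longrightarrow> F (\<sigma> *v z) = \<chi>\<^sub>l \<sigma> * F z"
  shows "\<exists>q. holomorphic_fun D q \<and> (\<forall>z\<in>D. F z = \<l> z * q z)"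
proof -
  have dense: "\<exists>y\<in>U. l H y = 0 \<and> (\<Prod>H'\<in>S. l H' y ^ e H') \<noteq> 0"
    if "H \<in> R" "S \<subseteq> R" "H \<notin> S" "open U" "z \<in> U" "l H z = 0" for H S U z
    using other_forms_nonzero_dense[of H S U z] that l_zero[OF that(1)] finite_subset[OF _ finite_R]
    by (auto simp: prod_zero_iff)
  have pS: "polyfun (\<lambda>z. \<Prod>H'\<in>S. l H' z ^ e H')" if "S \<subseteq> R" for S
    using that by (intro polyfun_prod polyfun_power clinear_functional_props(6) l_linear) auto
  \<comment> \<open>The product of the other forms does not vanish identically on \<open>H\<close>, which \<open>a H\<close> fixes pointwise.\<close>
  have charH: "\<chi>\<^sub>l (a H) = det (a H) ^ e H" if H: "H \<in> R" for H
  proof -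
    let ?p = "\<lambda>z. \<Prod>H'\<in>R - {H}. l H' z ^ e H'" and ?b = "a H"
    have split: "\<l> z = l H z ^ e H * ?p z" for z
      unfolding rep_poly_def by (rule prod.remove[OF finite_R H])
    obtain w where w: "l H w \<noteq> 0" using l_nonzero[OF H] by blast
    have p: "polyfun ?p" by (rule pS) auto
    have cp: "continuous_on UNIV (\<lambda>z. det ?b ^ e H * ?p (?b *v z) - \<chi>\<^sub>l ?b * ?p z)"
      by (intro continuous_on_diff continuous_on_mult continuous_on_const polyfun_continuous_on[OF p]
            polyfun_continuous_on[OF polyfun_compose_matrix[OF p]])
    have zero: "det ?b ^ e H * ?p (?b *v z) - \<chi>\<^sub>l ?b * ?p z = 0" for z
    proof (rule continuous_zero_by_density[OF open_UNIV cp clinear_functional_props(6)[OF l_linear[OF H]] w])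
      fix z assume nz: "l H z \<noteq> 0"
      have "l H z ^ e H * (det ?b ^ e H * ?p (?b *v z)) = \<l> (?b *v z)"
        by (simp only: split l_generator[OF H] power_mult_distrib mult_ac)
      also have "\<dots> = l H z ^ e H * (\<chi>\<^sub>l ?b * ?p z)"
        unfolding char[OF a_G[OF H]] split[of z] by (rule mult.left_commute)
      finally show "det ?b ^ e H * ?p (?b *v z) - \<chi>\<^sub>l ?b * ?p z = 0" using nz by simp
    qed simp
    have "l H 0 = 0" by (rule clinear_functional_props(4)[OF l_linear[OF H]])
    then obtain y where y: "l H y = 0" "?p y \<noteq> 0"
      using dense[OF H, of "R - {H}" UNIV 0] by auto
    have "?b *v y = y" using a_fixes[OF H] l_zero[OF H] y(1) by blast
    then show ?thesis using zero[of y] y(2) by simp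
  qed
  have single: "\<exists>q. holomorphic_fun D q \<and> (\<forall>z\<in>D. F z = l H z ^ e H * q z)" if H: "H \<in> R" for H
  proof -
    obtain w where w: "l H w \<noteq> 0" using l_nonzero[OF H] by blast
    show ?thesis
    proof (rule semi_invariant_divisible[OF D F l_linear[OF H] w, of "a H" "det (a H)"])
      show "a H *v z \<in> D" if "z \<in> D" for z by (rule inv[OF a_G[OF H] that])
      show "l H (a H *v z) = det (a H) * l H z" for z by (rule l_generator[OF H])
      show "a H *v z = z" if "l H z = 0" for z using a_fixes[OF H] l_zero[OF H] that by blast
      show "det (a H) \<noteq> 0" using det_G[OF a_G[OF H]] by auto
      show "det (a H) ^ k \<noteq> 1" if "0 < k" "k \<le> e H" for k by (rule exponent_minimal[OF H that])
      show "F (a H *v z) = det (a H) ^ e H * F z" if "z \<in> D" for z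
        using rel[OF a_G[OF H] that] charH[OF H] by simp
    qed
  qed
  have "\<exists>q. holomorphic_fun D q \<and> (\<forall>z\<in>D. F z = (\<Prod>H\<in>S. l H z ^ e H) * q z)" if "S \<subseteq> R" for S
  proof -
    have "finite S" using that finite_R finite_subset by blast
    then show ?thesis using that
    proof (induction S rule: finite_induct)
      case empty
      then show ?case using F by auto
    next
      case (insert H S)
      then obtain r where r: "holomorphic_fun D r" "\<And>z. z \<in> D \<Longrightarrow> F z = (\<Prod>H\<in>S. l H z ^ e H) * r z" by auto
      have H: "H \<in> R" "S \<subseteq> R" using insert.prems by auto
      obtain q where q: "holomorphic_fun D q" "\<And>z. z \<in> D \<Longrightarrow> F z = l H z ^ e H * q z" using single[OF H(1)] by blast
      obtain w where w: "l H w \<noteq> 0" using l_nonzero[OF H(1)] by blast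
      have "\<exists>r'. holomorphic_fun D r' \<and> (\<forall>z\<in>D. r z = l H z ^ e H * r' z)"
      proof (rule coprime_factor_divisible[OF D r(1) l_linear[OF H(1)] w pS[OF H(2)] _ q(1)])
        show "\<exists>y\<in>U. l H y = 0 \<and> (\<Prod>H\<in>S. l H y ^ e H) \<noteq> 0" if "open U" "z \<in> U" "l H z = 0" for z U
          by (rule dense[OF H insert.hyps(2) that])
        show "(\<Prod>H\<in>S. l H z ^ e H) * r z = l H z ^ e H * q z" if "z \<in> D" for z
          using r(2) q(2) that by metis
      qed
      then obtain r' where r': "holomorphic_fun D r'" "\<forall>z\<in>D. r z = l H z ^ e H * r' z" by blast
      have "F z = (\<Prod>H\<in>insert H S. l H z ^ e H) * r' z" if "z \<in> D" for z
        using r(2)[OF that] r'(2) that insert.hyps by (simp add: mult_ac)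
      then show ?case using r'(1) by blast
    qed
  qed
  from this[of R] show ?thesis by (simp add: rep_poly_def)
qed

end

section \<open>The basic polynomial map\<close>

text \<open>The complex line through two points of the set cuts a convex plane region out of the ball, and only
  finitely many points of it are zeros.\<close>

lemma connected_ball_minus_zeros:
  fixes x0 :: "complex^'d"
  assumes f: "polyfun f"
  shows "connected (ball x0 r \<inter> {z. f z \<noteq> 0})" (is "connected ?W")
  unfolding connected_iff_connected_component
proof (intro ballI)
  fix x y assume x: "x \<in> ?W" and y: "y \<in> ?W"
  let ?l = "\<lambda>t. x + t *s (y - x)"
  let ?T = "{t. ?l t \<in> ball x0 r}" and ?Z = "{t. f (?l t) = 0}"
  have oT: "open ?T" by (rule open_line_slice) simp
  have "convex ?T"
  proof (rule convexI)
    fix s t u v assume st: "s \<in> ?T" "t \<in> ?T" "0 \<le> (u::real)" "0 \<le> v" "u + v = 1"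
    have uv: "complex_of_real u = 1 - complex_of_real v" using st(5) by (metis add_diff_cancel_right' of_real_1 of_real_diff)
    have "?l (u *\<^sub>R s + v *\<^sub>R t) = u *\<^sub>R ?l s + v *\<^sub>R ?l t"
      by (simp add: vec_eq_iff scaleR_conv_of_real[where 'a=complex] scaleR_eq_smult uv algebra_simps)
    moreover have "u *\<^sub>R ?l s + v *\<^sub>R ?l t \<in> ball x0 r"
      by (rule convexD[OF convex_ball]) (use st in auto)
    ultimately show "u *\<^sub>R s + v *\<^sub>R t \<in> ?T" by simp
  qed
  then have conn: "connected ?T" by (rule convex_connected)
  have fin: "finite ?Z" by (rule polyfun_line_finite_zeros[OF f, of x 0]) (use x in simp)
  have "path_connected (?T - ?Z)"
    by (rule path_connected_open_diff_countable[OF _ oT conn countable_finite[OF fin]]) simp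
  then have "connected (?T - ?Z)" by (rule path_connected_imp_connected)
  then have "connected (?l ` (?T - ?Z))"
    by (intro connected_continuous_image continuous_intros)
  moreover have "?l ` (?T - ?Z) \<subseteq> ?W" by auto
  moreover have "x \<in> ?l ` (?T - ?Z)"
    using x by (intro image_eqI[of _ _ 0]) auto
  moreover have "y \<in> ?l ` (?T - ?Z)"
    using y by (intro image_eqI[of _ _ 1]) auto
  ultimately show "connected_component ?W x y" by (rule connected_componentI)
qed

locale reflection_quotient = reflection_rep G \<rho> l a
  for G :: "(complex^'d^'d) set" and \<rho> l a +
  fixes \<Omega> :: "(complex^'d) set" and \<theta> :: "complex^'d \<Rightarrow> complex^'d"
  assumes domain: "domain_set \<Omega>" and bounded_\<Omega>: "bounded \<Omega>" and invariant_\<Omega>: "invariant_set G \<Omega>"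
    and basic: "basic_polynomial_map G \<theta>"
begin

lemma open_\<Omega>: "open \<Omega>" and nonempty_\<Omega>: "\<Omega> \<noteq> {}"
  using domain by (auto simp: domain_set_def)

lemma G_\<Omega>: "\<sigma> \<in> G \<Longrightarrow> z \<in> \<Omega> \<Longrightarrow> \<sigma> *v z \<in> \<Omega>"
proof -
  assume s: "\<sigma> \<in> G" and z: "z \<in> \<Omega>"
  have "act (matrix_inv \<sigma>) ` \<Omega> = \<Omega>" using invariant_\<Omega> inv_G[OF s] by (simp add: invariant_set_def)
  then have "act (matrix_inv \<sigma>) z \<in> \<Omega>" using z by blast
  then show ?thesis by (simp only: act_inv[OF s])
qed

lemma G_\<Omega>_iff: "\<sigma> \<in> G \<Longrightarrow> \<sigma> *v z \<in> \<Omega> \<longleftrightarrow> z \<in> \<Omega>"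
  using G_\<Omega>[of \<sigma> z] G_\<Omega>[of "matrix_inv \<sigma>" "\<sigma> *v z"] inv_G inv_cancel(1) by metis

subsection \<open>Invariance and separation of orbits\<close>

lemma polyfun_theta: "polyfun (\<lambda>z. \<theta> z $ i)"
  and theta_invariant: "\<sigma> \<in> G \<Longrightarrow> \<theta> (\<sigma> *v z) = \<theta> z"
  and invariant_polyfun: "polyfun f \<Longrightarrow> (\<And>\<sigma> z. \<sigma> \<in> G \<Longrightarrow> f (\<sigma> *v z) = f z) \<Longrightarrow>
      \<exists>g. polyfun g \<and> (\<forall>z. f z = g (\<theta> z))"
proof -
  obtain \<theta>' where b: "basic_polys G \<theta>'" and \<theta>: "\<theta> = (\<lambda>z. \<chi> i. poly_eval (\<theta>' i) z)"
    using basic by (auto simp: basic_polynomial_map_def)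
  have inv: "invariant_polys G = range (poly_subst \<theta>')" using b by (simp add: basic_polys_def)
  show "polyfun (\<lambda>z. \<theta> z $ i)" by (auto simp: \<theta> polyfun_iff_poly_eval)
  have ti: "poly_eval (\<theta>' i) (act \<sigma> z) = poly_eval (\<theta>' i) z" if "\<sigma> \<in> G" for \<sigma> z i
  proof -
    obtain p where p: "(\<lambda>z::complex^'d. z $ i) = poly_eval p"
      using polyfun.nth polyfun_iff_poly_eval by blast
    have "poly_eval (poly_subst \<theta>' p) z = poly_eval (\<theta>' i) z" for z
      by (simp add: poly_eval_subst p[symmetric])
    moreover have "poly_subst \<theta>' p \<in> invariant_polys G" using inv by blast
    ultimately show ?thesis using that by (simp add: invariant_polys_def)
  qed
  show "\<theta> (\<sigma> *v z) = \<theta> z" if s: "\<sigma> \<in> G" for \<sigma> z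
    using ti[OF inv_G[OF s], of _ z] by (simp add: \<theta> act_inv[OF s])
  show "\<exists>g. polyfun g \<and> (\<forall>z. f z = g (\<theta> z))"
    if f: "polyfun f" "\<And>\<sigma> z. \<sigma> \<in> G \<Longrightarrow> f (\<sigma> *v z) = f z" for f
  proof -
    obtain p where p: "f = poly_eval p" using f(1) polyfun_iff_poly_eval by blast
    have "p \<in> invariant_polys G"
      using f(2)[OF inv_G] by (simp add: invariant_polys_def p act_def)
    then obtain q where q: "p = poly_subst \<theta>' q" using inv by blast
    have "f z = poly_eval q (\<theta> z)" for z
      by (simp add: p q poly_eval_subst \<theta>)
    moreover have "polyfun (poly_eval q)" using polyfun_iff_poly_eval by blast
    ultimately show ?thesis by blast
  qed
qed

lemma continuous_theta: "continuous_on S \<theta>"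
proof -
  have "continuous_on S (\<lambda>z. \<chi> i. \<theta> z $ i)"
    by (intro continuous_on_vec_lambda polyfun_continuous_on polyfun_theta)
  then show ?thesis by simp
qed

lemma polyfun_orbit_product:
  assumes "polyfun f" shows "\<exists>g. polyfun g \<and> (\<forall>z. (\<Prod>\<sigma>\<in>G. f (\<sigma> *v z)) = g (\<theta> z))"
proof (rule invariant_polyfun)
  show "polyfun (\<lambda>z. \<Prod>\<sigma>\<in>G. f (\<sigma> *v z))" by (intro polyfun_prod polyfun_compose_matrix assms)
  fix \<tau> z assume t: "\<tau> \<in> G"
  have "bij_betw (\<lambda>\<sigma>. \<sigma> ** \<tau>) G G"
  proof (rule bij_betwI[where g = "\<lambda>\<sigma>. \<sigma> ** matrix_inv \<tau>"])
    show "\<sigma> ** \<tau> ** matrix_inv \<tau> = \<sigma>" for \<sigma> by (simp add: matrix_mul_assoc[symmetric] inv_right[OF t])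
    show "\<sigma> ** matrix_inv \<tau> ** \<tau> = \<sigma>" for \<sigma> by (simp add: matrix_mul_assoc[symmetric] inv_left[OF t])
  qed (use t in \<open>auto intro: mult_G inv_G\<close>)
  from prod.reindex_bij_betw[OF this, of "\<lambda>\<sigma>. f (\<sigma> *v z)"]
  show "(\<Prod>\<sigma>\<in>G. f (\<sigma> *v (\<tau> *v z))) = (\<Prod>\<sigma>\<in>G. f (\<sigma> *v z))"
    by (simp add: matrix_vector_mul_assoc)
qed

text \<open>An affine form that vanishes at \<open>z\<close> but nowhere on the orbit of \<open>z'\<close> has an orbit product which is
  an invariant polynomial separating \<open>z\<close> from \<open>z'\<close>.\<close>

lemma theta_fibre:
  assumes eq: "\<theta> z = \<theta> z'" shows "\<exists>\<sigma>\<in>G. z' = \<sigma> *v z"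
proof (rule ccontr)
  assume no: "\<not> ?thesis"
  have ne: "\<sigma> *v z' - z \<noteq> 0" if s: "\<sigma> \<in> G" for \<sigma>
  proof
    assume "\<sigma> *v z' - z = 0"
    then have "z' = matrix_inv \<sigma> *v z" using inv_cancel(1)[OF s, of z'] by simp
    then show False using no inv_G[OF s] by blast
  qed
  have "\<exists>c::complex^'d. \<forall>\<sigma>\<in>G. (\<Sum>i\<in>UNIV. c $ i * (\<sigma> *v z' - z) $ i) \<noteq> 0"
  proof (rule polyfun_prod_nonzero[OF finite_G])
    fix \<sigma> assume s: "\<sigma> \<in> G"
    obtain k where k: "(\<sigma> *v z' - z) $ k \<noteq> 0" using ne[OF s] by (metis vec_eq_iff zero_index)
    have "(\<Sum>i\<in>UNIV. axis k 1 $ i * (\<sigma> *v z' - z) $ i) = (\<sigma> *v z' - z) $ k"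
      by (simp add: axis_def if_distrib if_distribR cong: if_cong)
    then have "\<exists>c. (\<Sum>i\<in>UNIV. c $ i * (\<sigma> *v z' - z) $ i) \<noteq> 0" using k by metis
    then show "polyfun (\<lambda>c::complex^'d. \<Sum>i\<in>UNIV. c $ i * (\<sigma> *v z' - z) $ i) \<and>
        (\<exists>c. (\<Sum>i\<in>UNIV. c $ i * (\<sigma> *v z' - z) $ i) \<noteq> 0)"
      by (intro conjI polyfun_sum polyfun.mult polyfun.nth polyfun.const)
  qed
  then obtain c :: "complex^'d" where c: "\<And>\<sigma>. \<sigma> \<in> G \<Longrightarrow> (\<Sum>i\<in>UNIV. c $ i * (\<sigma> *v z' - z) $ i) \<noteq> 0" by blast
  let ?p = "\<lambda>x. \<Sum>i\<in>UNIV. c $ i * (x $ i + (- z $ i))"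
  have "polyfun ?p" by (intro polyfun_sum polyfun.mult polyfun.add polyfun.nth polyfun.const)
  then obtain g where g: "\<And>x. (\<Prod>\<sigma>\<in>G. ?p (\<sigma> *v x)) = g (\<theta> x)" using polyfun_orbit_product by blast
  have "?p (mat 1 *v z) = 0" by simp
  then have "(\<Prod>\<sigma>\<in>G. ?p (\<sigma> *v z)) = 0" using one_G finite_G by (intro prod_zero) blast+
  moreover have "(\<Prod>\<sigma>\<in>G. ?p (\<sigma> *v z')) \<noteq> 0"
    using c finite_G by simp
  ultimately show False using g eq by metis
qed

subsection \<open>The Jacobian determinant\<close>

abbreviation J :: "complex^'d \<Rightarrow> complex" where "J \<equiv> complex_jacobian \<theta>"

definition Jm :: "complex^'d \<Rightarrow> complex^'d^'d" where
  "Jm z = (\<chi> i j. deriv (\<lambda>t. \<theta> (z + t *s axis j 1) $ i) 0)"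

lemma J_eq: "J z = det (Jm z)" by (simp add: complex_jacobian_def Jm_def)

lemma polyfun_J: "polyfun J"
proof -
  have "polyfun (\<lambda>z. det (Jm z))"
    by (rule polyfun_det) (simp add: Jm_def polyfun_partial[OF polyfun_theta])
  then show ?thesis by (simp add: J_eq[abs_def] fun_eq_iff[symmetric])
qed

lemma theta_has_derivative: "(\<theta> has_derivative (*v) (Jm z)) (at z)"
proof -
  have "((\<lambda>z. \<theta> z $ i) has_derivative (\<lambda>h. (Jm z *v h) $ i)) (at z)" for i
  proof -
    obtain f' where f': "((\<lambda>z. \<theta> z $ i) has_derivative f') (at z)" "Vector_Spaces.linear (*s) (*) f'"
      using polyfun_holomorphic[OF polyfun_theta, of UNIV i] unfolding holomorphic_fun_def by blast
    have f'e: "f' (axis j 1) = Jm z $ i $ j" for j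
    proof -
      have "((\<lambda>t. \<theta> (z + t *s axis j 1) $ i) has_field_derivative f' (axis j 1)) (at 0)"
        by (rule holomorphic_fun_field_derivative_line[of "\<lambda>z. \<theta> z $ i" f' z 0 "axis j 1", OF _ f'(2)])
           (simp add: f'(1))
      then show ?thesis by (simp add: Jm_def DERIV_imp_deriv)
    qed
    have "f' h = (Jm z *v h) $ i" for h
    proof -
      interpret Vector_Spaces.linear "(*s)" "(*)" f' by (rule f'(2))
      have "f' h = f' (\<Sum>j\<in>UNIV. h $ j *s axis j 1)" by (simp add: basis_expansion)
      also have "\<dots> = (\<Sum>j\<in>UNIV. h $ j * f' (axis j 1))" by (simp only: sum scale)
      also have "\<dots> = (\<Sum>j\<in>UNIV. Jm z $ i $ j * h $ j)" by (simp only: f'e mult.commute)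
      finally show ?thesis by (simp add: matrix_vector_mult_def)
    qed
    then have "f' = (\<lambda>h. (Jm z *v h) $ i)" by blast
    then show ?thesis using f'(1) by simp
  qed
  then have "((\<lambda>w. \<Sum>i\<in>UNIV. (\<theta> w $ i) *s (axis i 1 :: complex^'d)) has_derivative
      (\<lambda>h. \<Sum>i\<in>UNIV. ((Jm z *v h) $ i) *s axis i 1)) (at z)"
    by (intro has_derivative_sum bounded_linear.has_derivative[OF bounded_linear_smult_left])
  then show ?thesis by (simp add: basis_expansion)
qed

lemma Jm_transform: "\<sigma> \<in> G \<Longrightarrow> Jm (\<sigma> *v z) ** \<sigma> = Jm z"
proof -
  assume s: "\<sigma> \<in> G"
  have "((\<lambda>x. \<theta> (\<sigma> *v x)) has_derivative (\<lambda>h. Jm (\<sigma> *v z) *v (\<sigma> *v h))) (at z)"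
    by (rule has_derivative_compose[OF has_derivative_matrix theta_has_derivative])
  moreover have "(\<lambda>x. \<theta> (\<sigma> *v x)) = \<theta>" by (simp add: theta_invariant[OF s])
  ultimately have "(\<theta> has_derivative (\<lambda>h. Jm (\<sigma> *v z) *v (\<sigma> *v h))) (at z)" by simp
  then have "(\<lambda>h. Jm (\<sigma> *v z) *v (\<sigma> *v h)) = (*v) (Jm z)"
    by (rule has_derivative_unique[OF _ theta_has_derivative])
  then show ?thesis
    by (intro matrix_eqI) (simp add: matrix_vector_mul_assoc[symmetric] fun_eq_iff)
qed

lemma cmod_J: "\<sigma> \<in> G \<Longrightarrow> cmod (J (\<sigma> *v z)) = cmod (J z)"
proof -
  assume s: "\<sigma> \<in> G"
  have "J (\<sigma> *v z) * det \<sigma> = J z"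
    unfolding J_eq det_mul[symmetric] Jm_transform[OF s] ..
  then have "cmod (J (\<sigma> *v z)) * cmod (det \<sigma>) = cmod (J z)" by (metis norm_mult)
  then show ?thesis using det_G[OF s] by simp
qed

text \<open>Where the Jacobian does not vanish, stabilizers are trivial, so \<open>\<theta>\<close> is locally injective because
  its fibres are orbits.\<close>

lemma local_inverse:
  assumes J: "J z \<noteq> 0"
  obtains U g where "open U" "z \<in> U" "\<And>w. w \<in> U \<Longrightarrow> J w \<noteq> 0" "\<And>E. open E \<Longrightarrow> E \<subseteq> U \<Longrightarrow> open (\<theta> ` E)"
    "holomorphic_map (\<theta> ` U) g" "\<And>w. w \<in> U \<Longrightarrow> g (\<theta> w) = w"
proof -
  have free: "\<sigma> *v z \<noteq> z" if s: "\<sigma> \<in> G" "\<sigma> \<noteq> mat 1" for \<sigma>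
  proof
    assume "\<sigma> *v z = z"
    then have "Jm z ** \<sigma> = Jm z" using Jm_transform[OF s(1), of z] by simp
    moreover have iJ: "invertible (Jm z)" using J by (simp add: J_eq invertible_det_nz)
    ultimately have "matrix_inv (Jm z) ** (Jm z ** \<sigma>) = mat 1"
      using matrix_inv_works(2)[OF iJ] by simp
    then have "\<sigma> = mat 1" by (simp add: matrix_mul_assoc matrix_inv_works(2)[OF iJ])
    then show False using s(2) by blast
  qed
  have "\<forall>\<^sub>F w in nhds z. J w \<noteq> 0 \<and> (\<forall>\<sigma>\<in>G - {mat 1}. dist (\<sigma> *v w) z > dist (\<sigma> *v z) z / 2 \<and> dist w z < dist (\<sigma> *v z) z / 2)"
  proof (intro eventually_conj eventually_ball_finite ballI)
    have "open {w. J w \<noteq> 0}"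
      using open_Collect_neq[of J "\<lambda>u. 0"] polyfun_continuous_on[OF polyfun_J] by simp
    then show "\<forall>\<^sub>F w in nhds z. J w \<noteq> 0"
      using eventually_nhds_in_open[of "{w. J w \<noteq> 0}" z] J by simp
    show "finite (G - {mat 1})" using finite_G by simp
    fix \<sigma> assume s: "\<sigma> \<in> G - {mat 1}"
    have d: "dist (\<sigma> *v z) z > 0" using free s by simp
    have "open {w. dist (\<sigma> *v z) z / 2 < dist (\<sigma> *v w) z}"
      by (intro open_Collect_less continuous_intros holomorphic_map_imp_continuous_on holomorphic_map_matrix)
    then show "\<forall>\<^sub>F w in nhds z. dist (\<sigma> *v z) z / 2 < dist (\<sigma> *v w) z"
      using eventually_nhds_in_open[of "{w. dist (\<sigma> *v z) z / 2 < dist (\<sigma> *v w) z}" z] d by simp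
    show "\<forall>\<^sub>F w in nhds z. dist w z < dist (\<sigma> *v z) z / 2"
      using eventually_nhds_in_open[of "ball z (dist (\<sigma> *v z) z / 2)" z] d by (simp add: dist_commute)
  qed
  then obtain U where U: "open U" "z \<in> U" "\<And>w. w \<in> U \<Longrightarrow> J w \<noteq> 0"
    "\<And>w \<sigma>. w \<in> U \<Longrightarrow> \<sigma> \<in> G - {mat 1} \<Longrightarrow> dist (\<sigma> *v w) z > dist (\<sigma> *v z) z / 2 \<and> dist w z < dist (\<sigma> *v z) z / 2"
    unfolding eventually_nhds by blast
  have inj: "inj_on \<theta> U"
  proof (rule inj_onI)
    fix w w' assume w: "w \<in> U" "w' \<in> U" "\<theta> w = \<theta> w'"
    then obtain \<sigma> where s: "\<sigma> \<in> G" "w' = \<sigma> *v w" using theta_fibre by blast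
    show "w = w'"
    proof (cases "\<sigma> = mat 1")
      case True
      then show ?thesis using s by simp
    next
      case False
      then have "\<sigma> \<in> G - {mat 1}" using s(1) by simp
      from U(4)[OF w(1) this] U(4)[OF w(2) this] show ?thesis using s(2) by auto
    qed
  qed
  have op: "open (\<theta> ` E)" if "open E" "E \<subseteq> U" for E
    by (rule invariance_of_domain[OF continuous_theta that(1) inj_on_subset[OF inj that(2)]])
  obtain g where g: "homeomorphism U (\<theta> ` U) \<theta> g"
    using invariance_of_domain_homeomorphism[OF U(1) continuous_theta _ inj] by auto
  have gt: "g (\<theta> w) = w" if "w \<in> U" for w using g that by (simp add: homeomorphism_def)
  have cg: "continuous_on (\<theta> ` U) g" using g by (simp add: homeomorphism_def)
  have "holomorphic_map (\<theta> ` U) g"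
    unfolding holomorphic_map_def
  proof
    fix u assume "u \<in> \<theta> ` U"
    then obtain w where w: "w \<in> U" "u = \<theta> w" by blast
    have iJ: "invertible (Jm w)" using U(3)[OF w(1)] by (simp add: J_eq invertible_det_nz)
    have lin: "Vector_Spaces.linear (*s) (*s) ((*v) (matrix_inv (Jm w)))"
      by (intro clinear_mapI) (simp_all add: matrix_vector_right_distrib vector_scalar_commute)
    have "(*v) (matrix_inv (Jm w)) \<circ> (*v) (Jm w) = id"
      by (simp add: fun_eq_iff matrix_vector_mul_assoc matrix_inv_works(2)[OF iJ])
    then have "(g has_derivative (*v) (matrix_inv (Jm w))) (at (\<theta> w))"
      by (intro has_derivative_inverse_dieudonne[OF U(1) op[OF U(1) order_refl] continuous_theta cg gt w(1)
            theta_has_derivative clinear_map_imp_bounded_linear[OF lin]])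
    then show "\<exists>g'. (g has_derivative g') (at u) \<and> Vector_Spaces.linear (*s) (*s) g'"
      using lin w(2) by blast
  qed
  then show thesis using that[OF U(1) U(2) U(3) op _ gt] by blast
qed

subsection \<open>A fundamental domain\<close>

text \<open>The functional \<open>c\<close> separates the elements of \<open>G\<close>; its real part is used to single out one point of each
  generic orbit.\<close>

lemma generic_functional:
  "\<exists>c::complex^'d. \<forall>\<sigma>\<in>G - {mat 1}. \<exists>z. (\<Sum>i\<in>UNIV. c $ i * (\<sigma> *v z - z) $ i) \<noteq> 0"
proof -
  have "\<exists>z. \<sigma> *v z - z \<noteq> 0" if "\<sigma> \<in> G - {mat 1}" for \<sigma>
  proof (rule ccontr)
    assume "\<not> ?thesis"
    then have "\<sigma> = mat 1" by (intro matrix_eqI) simp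
    then show False using that by simp
  qed
  then obtain zs where zs: "\<And>\<sigma>. \<sigma> \<in> G - {mat 1} \<Longrightarrow> \<sigma> *v zs \<sigma> - zs \<sigma> \<noteq> 0" by metis
  have "\<exists>c::complex^'d. \<forall>\<sigma>\<in>G - {mat 1}. (\<Sum>i\<in>UNIV. c $ i * (\<sigma> *v zs \<sigma> - zs \<sigma>) $ i) \<noteq> 0"
  proof (rule polyfun_prod_nonzero)
    show "finite (G - {mat 1})" using finite_G by simp
    fix \<sigma> assume s: "\<sigma> \<in> G - {mat 1}"
    obtain k where k: "(\<sigma> *v zs \<sigma> - zs \<sigma>) $ k \<noteq> 0" using zs[OF s] by (metis vec_eq_iff zero_index)
    have "(\<Sum>i\<in>UNIV. axis k 1 $ i * (\<sigma> *v zs \<sigma> - zs \<sigma>) $ i) = (\<sigma> *v zs \<sigma> - zs \<sigma>) $ k"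
      by (simp add: axis_def if_distrib if_distribR cong: if_cong)
    then have "\<exists>c. (\<Sum>i\<in>UNIV. c $ i * (\<sigma> *v zs \<sigma> - zs \<sigma>) $ i) \<noteq> 0" using k by metis
    then show "polyfun (\<lambda>c::complex^'d. \<Sum>i\<in>UNIV. c $ i * (\<sigma> *v zs \<sigma> - zs \<sigma>) $ i) \<and>
        (\<exists>c. (\<Sum>i\<in>UNIV. c $ i * (\<sigma> *v zs \<sigma> - zs \<sigma>) $ i) \<noteq> 0)"
      by (intro conjI polyfun_sum polyfun.mult polyfun.nth polyfun.const)
  qed
  then show ?thesis by blast
qed

definition gc :: "complex^'d" where
  "gc = (SOME c. \<forall>\<sigma>\<in>G - {mat 1}. \<exists>z. (\<Sum>i\<in>UNIV. c $ i * (\<sigma> *v z - z) $ i) \<noteq> 0)"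

definition \<phi>\<^sub>c :: "complex^'d \<Rightarrow> real" where "\<phi>\<^sub>c z = Re (\<Sum>i\<in>UNIV. gc $ i * z $ i)"

text \<open>The points at which the functional is strictly smaller than at all other points of the orbit form an
  open fundamental domain.  Every orbit off the walls, where two points of
  an orbit tie, meets it exactly once.\<close>

definition dom :: "(complex^'d) set" where
  "dom = {z\<in>\<Omega>. \<forall>\<sigma>\<in>G - {mat 1}. \<phi>\<^sub>c z < \<phi>\<^sub>c (\<sigma> *v z)}"

definition walls :: "(complex^'d) set" where
  "walls = (\<Union>\<sigma>\<in>G. \<Union>\<tau>\<in>G - {\<sigma>}. {z. \<phi>\<^sub>c (\<sigma> *v z) = \<phi>\<^sub>c (\<tau> *v z)})"

lemma linear_\<phi>\<^sub>c: "linear \<phi>\<^sub>c"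
  by (rule linearI)
     (simp_all add: \<phi>\<^sub>c_def distrib_left sum.distrib scaleR_sum_right[symmetric])

lemma continuous_\<phi>\<^sub>c: "continuous_on S (\<lambda>z. \<phi>\<^sub>c (\<sigma> *v z))"
  by (intro continuous_on_compose2[OF linear_continuous_on[of \<phi>\<^sub>c UNIV]]
      holomorphic_map_imp_continuous_on holomorphic_map_matrix)
     (use linear_\<phi>\<^sub>c linear_conv_bounded_linear in auto)

lemma open_dom: "open dom"
proof -
  have eq: "dom = \<Omega> \<inter> (\<Inter>\<sigma>\<in>G - {mat 1}. {z. \<phi>\<^sub>c (mat 1 *v z) < \<phi>\<^sub>c (\<sigma> *v z)})" by (auto simp: dom_def)
  have "open {z. \<phi>\<^sub>c (mat 1 *v z) < \<phi>\<^sub>c (\<sigma> *v z)}" for \<sigma>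
    by (intro open_Collect_less continuous_\<phi>\<^sub>c)
  then show ?thesis
    unfolding eq by (intro open_Int open_\<Omega> open_INT finite_Diff finite_G) blast
qed

lemma negligible_walls: "negligible walls"
proof -
  have "negligible {z. \<phi>\<^sub>c (\<sigma> *v z) = \<phi>\<^sub>c (\<tau> *v z)}" if s: "\<sigma> \<in> G" "\<tau> \<in> G" "\<sigma> \<noteq> \<tau>" for \<sigma> \<tau>
  proof -
    let ?s = "\<sigma> ** matrix_inv \<tau>"
    have "?s \<noteq> mat 1"
    proof
      assume "?s = mat 1"
      then have "?s ** \<tau> = mat 1 ** \<tau>" by simp
      then show False using s(3) by (simp add: matrix_mul_assoc[symmetric] inv_left[OF s(2)])
    qed
    then have "?s \<in> G - {mat 1}" using s by (auto intro: mult_G inv_G)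
    moreover have "\<forall>\<sigma>\<in>G - {mat 1}. \<exists>z. (\<Sum>i\<in>UNIV. gc $ i * (\<sigma> *v z - z) $ i) \<noteq> 0"
      unfolding gc_def by (rule someI_ex[OF generic_functional])
    ultimately obtain y where y: "(\<Sum>i\<in>UNIV. gc $ i * (?s *v y - y) $ i) \<noteq> 0" by blast
    let ?S = "\<lambda>z. \<Sum>i\<in>UNIV. gc $ i * (\<sigma> *v z - \<tau> *v z) $ i"
    have S1: "?S (matrix_inv \<tau> *v y) \<noteq> 0"
      using y by (simp add: matrix_vector_mul_assoc[symmetric] inv_cancel[OF s(2)])
    have Sm: "?S (c *s z) = c * ?S z" for c z
      by (simp add: vector_scalar_commute sum_distrib_left algebra_simps)
    have gS: "\<phi>\<^sub>c (\<sigma> *v z) - \<phi>\<^sub>c (\<tau> *v z) = Re (?S z)" for z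
      by (simp add: \<phi>\<^sub>c_def right_diff_distrib sum_subtractf)
    \<comment> \<open>A complex linear form whose real part vanishes is zero.\<close>
    have "\<exists>z. Re (?S z) \<noteq> 0"
    proof (rule ccontr)
      assume "\<not> ?thesis"
      then have a: "Re (?S z) = 0" for z by blast
      have "Re (cnj (?S (matrix_inv \<tau> *v y)) * ?S (matrix_inv \<tau> *v y)) = 0"
        using a[of "cnj (?S (matrix_inv \<tau> *v y)) *s (matrix_inv \<tau> *v y)"] unfolding Sm .
      then have "(cmod (?S (matrix_inv \<tau> *v y)))\<^sup>2 = 0"
        by (metis Re_complex_of_real complex_norm_square mult.commute)
      then show False using S1 by simp
    qed
    then obtain x where x: "\<phi>\<^sub>c (\<sigma> *v x) - \<phi>\<^sub>c (\<tau> *v x) \<noteq> 0" using gS by metis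
    define h where "h = (\<lambda>z. \<phi>\<^sub>c (\<sigma> *v z) - \<phi>\<^sub>c (\<tau> *v z))"
    have lin: "linear h"
      unfolding h_def
      by (intro linear_compose_sub linear_compose[OF linear_matrix_vector linear_\<phi>\<^sub>c, unfolded o_def])
    have h: "h z = (\<Sum>b\<in>Basis. h b *\<^sub>R b) \<bullet> z" for z
    proof -
      have "h z = h (\<Sum>b\<in>Basis. (z \<bullet> b) *\<^sub>R b)" by (simp add: euclidean_representation)
      also have "\<dots> = (\<Sum>b\<in>Basis. (z \<bullet> b) * h b)"
        using lin by (simp add: linear_sum linear_scale)
      finally show ?thesis
        unfolding inner_sum_left inner_scaleR_left by (simp only: inner_commute mult.commute)
    qed
    have "(\<Sum>b\<in>Basis. h b *\<^sub>R b) \<noteq> 0" using x h[of x] by (metis h_def inner_zero_left)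
    then have "negligible {z. (\<Sum>b\<in>Basis. h b *\<^sub>R b) \<bullet> z = 0}" by (intro negligible_hyperplane disjI1)
    moreover have "{z. (\<Sum>b\<in>Basis. h b *\<^sub>R b) \<bullet> z = 0} = {z. \<phi>\<^sub>c (\<sigma> *v z) = \<phi>\<^sub>c (\<tau> *v z)}"
      unfolding h[symmetric] by (simp add: h_def)
    ultimately show ?thesis by simp
  qed
  then show ?thesis
    unfolding walls_def using finite_G by (intro negligible_Union) auto
qed

lemma dom_unique:
  assumes z: "z \<in> dom" and s: "\<sigma> \<in> G" "\<sigma> *v z \<in> dom" shows "\<sigma> = mat 1"
proof (rule ccontr)
  assume ne: "\<sigma> \<noteq> mat 1"
  then have 1: "\<phi>\<^sub>c z < \<phi>\<^sub>c (\<sigma> *v z)" using z s by (simp add: dom_def)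
  have "matrix_inv \<sigma> \<noteq> mat 1"
  proof
    assume "matrix_inv \<sigma> = mat 1"
    then have "\<sigma> = mat 1" using inv_left[OF s(1)] by simp
    then show False using ne by blast
  qed
  then have "\<phi>\<^sub>c (\<sigma> *v z) < \<phi>\<^sub>c (matrix_inv \<sigma> *v (\<sigma> *v z))" using s(2) inv_G[OF s(1)] unfolding dom_def by blast
  then show False using 1 by (simp add: inv_cancel[OF s(1)])
qed

lemma inj_on_dom: "inj_on \<theta> dom"
proof (rule inj_onI)
  fix z z' assume z: "z \<in> dom" "z' \<in> dom" "\<theta> z = \<theta> z'"
  then obtain \<sigma> where s: "\<sigma> \<in> G" "z' = \<sigma> *v z" using theta_fibre by blast
  then have "\<sigma> = mat 1" using dom_unique[OF z(1) s(1)] z(2) by simp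
  then show "z = z'" using s(2) by simp
qed

lemma dom_covers:
  assumes z: "z \<in> \<Omega>" "z \<notin> walls" shows "\<exists>\<sigma>\<in>G. \<sigma> *v z \<in> dom"
proof -
  have "\<exists>\<sigma>\<in>G. \<forall>\<tau>\<in>G. \<phi>\<^sub>c (\<sigma> *v z) \<le> \<phi>\<^sub>c (\<tau> *v z)"
  proof -
    let ?f = "\<lambda>\<sigma>. \<phi>\<^sub>c (\<sigma> *v z)"
    have "Min (?f ` G) \<in> ?f ` G" using finite_G one_G by (intro Min_in) auto
    then obtain \<sigma> where s: "\<sigma> \<in> G" "?f \<sigma> = Min (?f ` G)" by force
    have "?f \<sigma> \<le> ?f \<tau>" if "\<tau> \<in> G" for \<tau>
      unfolding s(2) using finite_G that by (intro Min_le) auto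
    then show ?thesis using s(1) by blast
  qed
  then obtain \<sigma> where s: "\<sigma> \<in> G" "\<And>\<tau>. \<tau> \<in> G \<Longrightarrow> \<phi>\<^sub>c (\<sigma> *v z) \<le> \<phi>\<^sub>c (\<tau> *v z)" by blast
  have "\<phi>\<^sub>c (\<sigma> *v z) < \<phi>\<^sub>c (\<tau> *v (\<sigma> *v z))" if t: "\<tau> \<in> G - {mat 1}" for \<tau>
  proof -
    have ts: "\<tau> ** \<sigma> \<in> G" using t s by (auto intro: mult_G)
    have "\<tau> ** \<sigma> \<noteq> \<sigma>"
    proof
      assume "\<tau> ** \<sigma> = \<sigma>"
      then have "\<tau> ** \<sigma> ** matrix_inv \<sigma> = mat 1" using inv_right[OF s(1)] by simp
      then have "\<tau> = mat 1" by (simp add: matrix_mul_assoc[symmetric] inv_right[OF s(1)])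
      then show False using t by simp
    qed
    then have "\<phi>\<^sub>c (\<sigma> *v z) \<noteq> \<phi>\<^sub>c ((\<tau> ** \<sigma>) *v z)"
      using z(2) s(1) ts unfolding walls_def by blast
    then show ?thesis using s(2)[OF ts] by (simp add: matrix_vector_mul_assoc)
  qed
  then have "\<sigma> *v z \<in> dom" using G_\<Omega>[OF s(1) z(1)] by (simp add: dom_def)
  then show ?thesis using s(1) by blast
qed

lemma open_theta_dom: "open (\<theta> ` dom)"
  by (rule invariance_of_domain[OF continuous_theta open_dom inj_on_dom])

lemma bounded_theta: "bounded (\<theta> ` \<Omega>)"
proof -
  have "compact (\<theta> ` closure \<Omega>)"
    using bounded_\<Omega> by (intro compact_continuous_image continuous_theta) (simp add: compact_closure)
  then show ?thesis
    using bounded_subset[OF compact_imp_bounded] closure_subset image_mono by metis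
qed

lemma emeasure_theta_dom:
  assumes S: "S \<in> sets borel"
  shows "emeasure lborel (\<theta> ` dom \<inter> S)
    = (\<integral>\<^sup>+z. ennreal ((cmod (J z))\<^sup>2) * indicator (dom \<inter> \<theta> -` S) z \<partial>lborel)"
proof -
  have m: "\<theta> \<in> borel_measurable borel" by (rule borel_measurable_continuous_onI[OF continuous_theta])
  have S': "dom \<inter> \<theta> -` S \<in> sets borel" using measurable_sets[OF m S] open_dom by simp
  have im: "\<theta> ` (dom \<inter> \<theta> -` S) = \<theta> ` dom \<inter> S" by blast
  have "emeasure lborel (\<theta> ` (dom \<inter> \<theta> -` S))
     = (\<integral>\<^sup>+z. ennreal ((cmod (det (Jm z)))\<^sup>2) * indicator (dom \<inter> \<theta> -` S) z \<partial>lborel)"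
  proof (rule emeasure_holomorphic_image[OF S' theta_has_derivative])
    show "inj_on \<theta> (dom \<inter> \<theta> -` S)" by (rule inj_on_subset[OF inj_on_dom]) simp
    show "\<theta> ` (dom \<inter> \<theta> -` S) \<in> sets borel" unfolding im using S open_theta_dom by simp
    have "bounded (\<theta> ` dom \<inter> S)" by (rule bounded_subset[OF bounded_theta]) (auto simp: dom_def)
    then show "emeasure lborel (\<theta> ` (dom \<inter> \<theta> -` S)) < \<infinity>"
      unfolding im by (rule emeasure_bounded_finite)
    show "(\<lambda>x. det (Jm x)) \<in> borel_measurable borel"
      using borel_measurable_continuous_onI[OF polyfun_continuous_on[OF polyfun_J]] by (simp add: J_eq[abs_def])
  qed
  then show ?thesis by (simp only: im J_eq)
qed

lemma dom_nonempty: "dom \<noteq> {}"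
proof
  assume "dom = {}"
  then have "\<Omega> \<subseteq> walls" using dom_covers by blast
  then have "negligible \<Omega>" by (rule negligible_subset[OF negligible_walls])
  then show False using open_not_negligible open_\<Omega> nonempty_\<Omega> by blast
qed

text \<open>The image of the fundamental domain is open by invariance of domain, so it has positive measure and
  the Jacobian cannot vanish identically.\<close>

lemma J_nonzero: "\<exists>w. J w \<noteq> 0"
proof (rule ccontr)
  assume "\<not> ?thesis"
  then have "emeasure lborel (\<theta> ` dom) = 0" using emeasure_theta_dom[of UNIV] by simp
  then have "negligible (\<theta> ` dom)"
    using open_theta_dom by (simp add: negligible_iff_emeasure0)
  then show False using open_not_negligible open_theta_dom dom_nonempty by blast
qed

subsection \<open>Openness and descent\<close>

text \<open>An invariant polynomial that vanishes on the reflecting hyperplanes and on the zeros of \<open>J\<close> and \<open>\<l>\<close>.\<close>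

definition \<Delta> :: "complex^'d \<Rightarrow> complex" where
  "\<Delta> z = (\<Prod>\<sigma>\<in>G. J (\<sigma> *v z) * \<l> (\<sigma> *v z) * (\<Prod>H\<in>R. l H (\<sigma> *v z)))"

lemma polyfun_\<Delta>: "polyfun \<Delta>"
  unfolding \<Delta>_def[abs_def]
  by (intro polyfun_prod polyfun.mult polyfun_compose_matrix[OF polyfun_J]
      polyfun_compose_matrix[OF polyfun_rep_poly]
      polyfun_compose_matrix[OF clinear_functional_props(6)[OF l_linear]])

lemma \<Delta>_D: "\<Delta> z \<noteq> 0 \<Longrightarrow> J z \<noteq> 0" "\<Delta> z \<noteq> 0 \<Longrightarrow> \<l> z \<noteq> 0" "\<Delta> z \<noteq> 0 \<Longrightarrow> H \<in> R \<Longrightarrow> l H z \<noteq> 0"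
proof -
  have "J (mat 1 *v z) * \<l> (mat 1 *v z) * (\<Prod>H\<in>R. l H (mat 1 *v z)) \<noteq> 0" if "\<Delta> z \<noteq> 0" for z
  proof
    assume "J (mat 1 *v z) * \<l> (mat 1 *v z) * (\<Prod>H\<in>R. l H (mat 1 *v z)) = 0"
    then have "\<Delta> z = 0" unfolding \<Delta>_def using one_G by (intro prod_zero finite_G bexI)
    then show False using that by blast
  qed
  then show "\<Delta> z \<noteq> 0 \<Longrightarrow> J z \<noteq> 0" "\<Delta> z \<noteq> 0 \<Longrightarrow> \<l> z \<noteq> 0" "\<Delta> z \<noteq> 0 \<Longrightarrow> H \<in> R \<Longrightarrow> l H z \<noteq> 0"
    using finite_R by (auto simp: prod_zero_iff)
qed

lemma \<Delta>_nonzero: "\<exists>w. \<Delta> w \<noteq> 0"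
proof -
  let ?f = "\<lambda>z. J z * \<l> z * (\<Prod>H\<in>R. l H z)"
  have pf: "polyfun (\<lambda>z. \<Prod>H\<in>R. l H z)"
    by (intro polyfun_prod clinear_functional_props(6) l_linear)
  obtain w1 where w1: "J w1 \<noteq> 0" using J_nonzero by blast
  obtain w2 where w2: "\<l> w2 \<noteq> 0" using rep_poly_nonzero by blast
  obtain w3 where w3: "(\<Prod>H\<in>R. l H w3) \<noteq> 0" using all_forms_nonzero finite_R by auto
  have "\<exists>w. \<forall>i\<in>{0,1,2::nat}. (if i = 0 then J else if i = 1 then \<l> else (\<lambda>z. \<Prod>H\<in>R. l H z)) w \<noteq> 0"
    by (rule polyfun_prod_nonzero) (use polyfun_J polyfun_rep_poly pf w1 w2 w3 in auto)
  then obtain w where "?f w \<noteq> 0" by auto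
  have "polyfun ?f" by (intro polyfun.mult polyfun_J polyfun_rep_poly pf)
  have "\<exists>w. \<forall>\<sigma>\<in>G. ?f (\<sigma> *v w) \<noteq> 0"
  proof (rule polyfun_prod_nonzero[OF finite_G])
    fix \<sigma> assume s: "\<sigma> \<in> G"
    have "?f (\<sigma> *v (matrix_inv \<sigma> *v w)) \<noteq> 0" using \<open>?f w \<noteq> 0\<close> by (simp only: inv_cancel[OF s]) simp
    then show "polyfun (\<lambda>z. ?f (\<sigma> *v z)) \<and> (\<exists>w. ?f (\<sigma> *v w) \<noteq> 0)"
      using polyfun_compose_matrix[OF \<open>polyfun ?f\<close>] by blast
  qed
  then show ?thesis using finite_G by (auto simp: \<Delta>_def)
qed

lemma \<delta>_exists: "\<exists>\<delta>. polyfun \<delta> \<and> (\<forall>z. \<Delta> z = \<delta> (\<theta> z))"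
proof -
  have "polyfun (\<lambda>z. J z * \<l> z * (\<Prod>H\<in>R. l H z))"
    by (intro polyfun.mult polyfun_J polyfun_rep_poly polyfun_prod clinear_functional_props(6) l_linear)
  from polyfun_orbit_product[OF this] show ?thesis by (simp add: \<Delta>_def)
qed

text \<open>The polynomial that expresses \<open>\<Delta>\<close> in terms of \<open>\<theta>\<close>.\<close>

definition \<delta> :: "complex^'d \<Rightarrow> complex" where
  "\<delta> = (SOME \<delta>. polyfun \<delta> \<and> (\<forall>z. \<Delta> z = \<delta> (\<theta> z)))"

lemma polyfun_\<delta>: "polyfun \<delta>" and \<Delta>_eq: "\<Delta> z = \<delta> (\<theta> z)"
  using someI_ex[OF \<delta>_exists] unfolding \<delta>_def[symmetric] by auto

lemma \<delta>_nonzero: "\<exists>u. \<delta> u \<noteq> 0"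
  using \<Delta>_nonzero \<Delta>_eq by auto

lemma open_regular_image: "open E \<Longrightarrow> open (\<theta> ` (E \<inter> {z. \<Delta> z \<noteq> 0}))"
proof -
  assume E: "open E"
  show ?thesis
  proof (rule Topological_Spaces.openI)
    fix u assume "u \<in> \<theta> ` (E \<inter> {z. \<Delta> z \<noteq> 0})"
    then obtain z where z: "z \<in> E" "\<Delta> z \<noteq> 0" "u = \<theta> z" by blast
    obtain U where U: "open U" "z \<in> U" "\<And>E. open E \<Longrightarrow> E \<subseteq> U \<Longrightarrow> open (\<theta> ` E)"
      using local_inverse[OF \<Delta>_D(1)[OF z(2)]] by metis
    have "open {z. \<Delta> z \<noteq> 0}"
      using open_Collect_neq[of \<Delta> "\<lambda>u. 0"] polyfun_continuous_on[OF polyfun_\<Delta>] by simp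
    then have "open (\<theta> ` (U \<inter> E \<inter> {z. \<Delta> z \<noteq> 0}))" using U E by (intro U(3) open_Int) auto
    moreover have "u \<in> \<theta> ` (U \<inter> E \<inter> {z. \<Delta> z \<noteq> 0})" using z U(2) by blast
    ultimately show "\<exists>T. open T \<and> u \<in> T \<and> T \<subseteq> \<theta> ` (E \<inter> {z. \<Delta> z \<noteq> 0})" by blast
  qed
qed

text \<open>Near a point of the image of a bounded invariant open set \<open>E\<close>, the image of the closure of \<open>E\<close> is
  closed, and it is open off the zero set of \<open>\<delta>\<close>.  As the complement of this zero set in a ball is
  connected and dense, the image contains a whole ball.\<close>

lemma open_image_invariant:
  assumes E: "open E" "bounded E" and inv: "\<And>\<sigma> z. \<sigma> \<in> G \<Longrightarrow> z \<in> E \<Longrightarrow> \<sigma> *v z \<in> E"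
  shows "open (\<theta> ` E)"
proof (rule Topological_Spaces.openI)
  fix u0 assume "u0 \<in> \<theta> ` E"
  then obtain z0 where z0: "z0 \<in> E" "u0 = \<theta> z0" by blast
  let ?C = "closure E" and ?F = "closure E - E"
  have cC: "compact ?C" using E(2) by (simp add: compact_closure)
  have "compact (\<theta> ` ?F)"
    by (intro compact_continuous_image continuous_theta compact_diff cC E(1))
  moreover have notin: "u0 \<notin> \<theta> ` ?F"
  proof
    assume "u0 \<in> \<theta> ` ?F"
    then obtain z where z: "z \<in> ?F" "\<theta> z0 = \<theta> z" using z0 by auto
    then obtain \<sigma> where "\<sigma> \<in> G" "z = \<sigma> *v z0" using theta_fibre by blast
    then show False using inv z0(1) z(1) by blast
  qed
  ultimately have "open (- \<theta> ` ?F)" "u0 \<in> - \<theta> ` ?F" using compact_imp_closed by auto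
  then obtain \<epsilon> where e: "\<epsilon> > 0" "ball u0 \<epsilon> \<subseteq> - \<theta> ` ?F" using open_contains_ball by blast
  let ?B = "ball u0 \<epsilon>"
  let ?W = "?B \<inter> {u. \<delta> u \<noteq> 0}"
  let ?P = "\<theta> ` (E \<inter> {z. \<Delta> z \<noteq> 0})" and ?Q = "- \<theta> ` ?C"
  have oP: "open ?P" by (rule open_regular_image[OF E(1)])
  have oQ: "open ?Q" using compact_imp_closed[OF compact_continuous_image[OF continuous_theta cC]] by auto
  have Csub: "u \<in> \<theta> ` E" if "u \<in> ?B" "u \<in> \<theta> ` ?C" for u
    using that e(2) by blast
  have WPQ: "?W \<subseteq> ?P \<union> ?Q"
  proof
    fix u assume u: "u \<in> ?W"
    show "u \<in> ?P \<union> ?Q"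
    proof (cases "u \<in> \<theta> ` ?C")
      case True
      then have "u \<in> \<theta> ` E" using Csub u by blast
      then show ?thesis using u \<Delta>_eq by auto
    qed simp
  qed
  have PQ: "?P \<inter> ?Q \<inter> ?W = {}" using closure_subset[of E] by blast
  have ne: "?P \<inter> ?W \<noteq> {}"
  proof -
    have o: "open (E \<inter> \<theta> -` ?B)"
      using continuous_open_preimage[OF continuous_theta E(1) open_ball] by simp
    have z0': "z0 \<in> E \<inter> \<theta> -` ?B" using z0 e(1) by simp
    obtain w where w: "\<Delta> w \<noteq> 0" using \<Delta>_nonzero by blast
    obtain y where y: "y \<in> E \<inter> \<theta> -` ?B" "\<Delta> y \<noteq> 0"
      using polyfun_nonzero_dense[OF polyfun_\<Delta> w o z0'] by blast
    then have "\<theta> y \<in> ?P \<inter> ?W" using \<Delta>_eq[of y] by auto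
    then show ?thesis by blast
  qed
  have "?Q \<inter> ?W = {}"
    using connectedD[OF connected_ball_minus_zeros[OF polyfun_\<delta>] oP oQ] PQ WPQ ne by blast
  have "?B \<subseteq> \<theta> ` ?C"
  proof
    fix u assume u: "u \<in> ?B"
    show "u \<in> \<theta> ` ?C"
    proof (rule ccontr)
      assume "u \<notin> \<theta> ` ?C"
      then have "u \<in> ?B \<inter> ?Q" using u by blast
      moreover have "open (?B \<inter> ?Q)" using oQ by (intro open_Int) auto
      moreover obtain w where w: "\<delta> w \<noteq> 0" using \<delta>_nonzero by blast
      ultimately obtain y where "y \<in> ?B \<inter> ?Q" "\<delta> y \<noteq> 0"
        using polyfun_nonzero_dense[OF polyfun_\<delta> w] by metis
      then show False using \<open>?Q \<inter> ?W = {}\<close> by blast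
    qed
  qed
  then have "?B \<subseteq> \<theta> ` E" using Csub by blast
  then show "\<exists>T. open T \<and> u0 \<in> T \<and> T \<subseteq> \<theta> ` E" using e(1) by (intro exI[of _ ?B]) auto
qed

text \<open>The saturation of \<open>U\<close> under \<open>G\<close> is open and invariant and has the same image.\<close>

lemma open_image:
  assumes U: "open U" "U \<subseteq> \<Omega>" shows "open (\<theta> ` U)"
proof -
  let ?E = "\<Union>\<sigma>\<in>G. (\<lambda>z. \<sigma> *v z) -` U"
  have "open ((\<lambda>z. \<sigma> *v z) -` U)" for \<sigma>
    using continuous_open_preimage[OF holomorphic_map_imp_continuous_on[OF holomorphic_map_matrix] open_UNIV U(1)]
    by simp
  then have oE: "open ?E" by blast
  have "?E \<subseteq> \<Omega>" using U(2) G_\<Omega>_iff by blast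
  then have bE: "bounded ?E" using bounded_\<Omega> bounded_subset by blast
  have inv: "\<tau> *v z \<in> ?E" if t: "\<tau> \<in> G" and z: "z \<in> ?E" for \<tau> z
  proof -
    obtain \<sigma> where s: "\<sigma> \<in> G" "\<sigma> *v z \<in> U" using z by blast
    have "(\<sigma> ** matrix_inv \<tau>) *v (\<tau> *v z) \<in> U"
      using s(2) by (simp add: matrix_vector_mul_assoc[symmetric] inv_cancel[OF t])
    then show ?thesis using mult_G[OF s(1) inv_G[OF t]] by blast
  qed
  have "\<theta> ` ?E = \<theta> ` U"
  proof
    show "\<theta> ` ?E \<subseteq> \<theta> ` U"
    proof
      fix u assume "u \<in> \<theta> ` ?E"
      then obtain z \<sigma> where "\<sigma> \<in> G" "\<sigma> *v z \<in> U" "u = \<theta> z" by blast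
      then show "u \<in> \<theta> ` U" using theta_invariant by (metis imageI)
    qed
    have "U \<subseteq> ?E" using one_G by force
    then show "\<theta> ` U \<subseteq> \<theta> ` ?E" by blast
  qed
  then show ?thesis using open_image_invariant[OF oE bE inv] by metis
qed

text \<open>The map \<open>\<theta>\<close> is open and its fibres are orbits, so it is a quotient map for the group action.\<close>

lemma descend_continuous:
  fixes f :: "complex^'d \<Rightarrow> 'b::topological_space"
  assumes E: "open E" "E \<subseteq> \<Omega>" and cf: "continuous_on E f"
    and inv: "\<And>\<sigma> z. \<sigma> \<in> G \<Longrightarrow> z \<in> E \<Longrightarrow> \<sigma> *v z \<in> E \<Longrightarrow> f (\<sigma> *v z) = f z"
  obtains h where "continuous_on (\<theta> ` E) h" "\<And>z. z \<in> E \<Longrightarrow> h (\<theta> z) = f z"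
proof -
  define h where "h = (\<lambda>u. f (SOME z. z \<in> E \<and> \<theta> z = u))"
  have h: "h (\<theta> z) = f z" if z: "z \<in> E" for z
  proof -
    let ?z = "SOME z'. z' \<in> E \<and> \<theta> z' = \<theta> z"
    have zz: "?z \<in> E \<and> \<theta> ?z = \<theta> z" by (rule someI[of _ z]) (use z in simp)
    then obtain \<sigma> where s: "\<sigma> \<in> G" "?z = \<sigma> *v z" using theta_fibre[of z ?z] by auto
    then have "f ?z = f z" using inv[OF s(1) z] zz by simp
    then show ?thesis by (simp add: h_def)
  qed
  have "continuous_on (\<theta> ` E) h"
    unfolding continuous_on_open_vimage[OF open_image[OF E]]
  proof (intro allI impI)
    fix B :: "'b set" assume B: "open B"
    have "h -` B \<inter> \<theta> ` E = \<theta> ` (E \<inter> f -` B)" using h by auto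
    moreover have "open (E \<inter> f -` B)" by (rule continuous_open_preimage[OF cf E(1) B])
    ultimately show "open (h -` B \<inter> \<theta> ` E)" using open_image[of "E \<inter> f -` B"] E(2) by (simp add: le_infI1)
  qed
  then show thesis using h that by blast
qed

text \<open>The local inverses of \<open>\<theta>\<close> settle the points off the zero set of \<open>\<delta>\<close>; the remaining singularities are
  removable because the descended function is continuous.\<close>

theorem descend_holomorphic:
  assumes f: "holomorphic_fun \<Omega> f" and inv: "\<And>\<sigma> z. \<sigma> \<in> G \<Longrightarrow> z \<in> \<Omega> \<Longrightarrow> f (\<sigma> *v z) = f z"
  obtains h where "holomorphic_fun (\<theta> ` \<Omega>) h" "\<And>z. z \<in> \<Omega> \<Longrightarrow> h (\<theta> z) = f z"
proof -
  obtain h where h: "continuous_on (\<theta> ` \<Omega>) h" "\<And>z. z \<in> \<Omega> \<Longrightarrow> h (\<theta> z) = f z"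
    using descend_continuous[OF open_\<Omega> order_refl holomorphic_fun_imp_continuous_on[OF f] inv] by metis
  obtain w where w: "\<delta> w \<noteq> 0" using \<delta>_nonzero by blast
  have "holomorphic_fun (\<theta> ` \<Omega>) h"
  proof (rule removable_polyfun_zeros[OF open_image[OF open_\<Omega> order_refl] h(1) polyfun_\<delta> w])
    show "holomorphic_fun (\<theta> ` \<Omega> \<inter> {u. \<delta> u \<noteq> 0}) h"
    proof (rule holomorphic_fun_local)
      fix u assume "u \<in> \<theta> ` \<Omega> \<inter> {u. \<delta> u \<noteq> 0}"
      then obtain z where z: "z \<in> \<Omega>" "u = \<theta> z" "\<Delta> z \<noteq> 0" using \<Delta>_eq by auto
      obtain U g where U: "open U" "z \<in> U" "\<And>E. open E \<Longrightarrow> E \<subseteq> U \<Longrightarrow> open (\<theta> ` E)"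
        "holomorphic_map (\<theta> ` U) g" "\<And>w. w \<in> U \<Longrightarrow> g (\<theta> w) = w"
        using local_inverse[OF \<Delta>_D(1)[OF z(3)]] by metis
      let ?U = "\<theta> ` (U \<inter> \<Omega>)"
      have o: "open ?U" using U(1) open_\<Omega> by (intro U(3)) auto
      have hm: "holomorphic_map ?U g" using U(4) unfolding holomorphic_map_def by blast
      have "holomorphic_fun ?U (\<lambda>u. f (g u))"
        by (rule holomorphic_fun_compose[OF f hm]) (use U(5) in auto)
      then have "holomorphic_fun ?U h"
        by (rule holomorphic_fun_cong[OF o]) (use U(5) h(2) in auto)
      moreover have "u \<in> ?U" unfolding z(2) using z(1) U(2) by (intro imageI IntI)
      ultimately show "\<exists>U. u \<in> U \<and> holomorphic_fun U h" by (intro exI[of _ ?U] conjI)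
    qed
  qed
  then show thesis using h(2) that by blast
qed

end

section \<open>Integration over the quotient\<close>

lemma lebesgue_distr_matrix:
  fixes A :: "complex^'d^'d"
  assumes d: "cmod (det A) = 1"
  shows "(*v) A \<in> measurable lebesgue lebesgue" "distr lebesgue lebesgue ((*v) A) = lebesgue"
proof -
  have mb: "(*v) A \<in> borel_measurable borel"
    by (intro borel_measurable_continuous_onI holomorphic_map_imp_continuous_on holomorphic_map_matrix)
  then have m: "(*v) A \<in> measurable lborel lborel" by simp
  have em: "emeasure lborel ((*v) A -` S) = emeasure lborel S" if "S \<in> sets borel" for S
    by (subst (2) lborel_distr_matrix[OF d, symmetric]) (use mb that in \<open>simp add: emeasure_distr\<close>)
  show ml: "(*v) A \<in> measurable lebesgue lebesgue"
  proof (rule measurableI)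
    fix A' :: "(complex^'d) set" assume "A' \<in> sets lebesgue"
    then obtain S N N' where S: "A' = S \<union> N" "N \<subseteq> N'" "N' \<in> null_sets lborel" "S \<in> sets lborel"
      by (rule sets_completionE)
    have Sb: "(*v) A -` S \<in> sets lborel" "(*v) A -` N' \<in> sets lborel"
      using measurable_sets[OF m, of S] measurable_sets[OF m, of N'] S(3,4) by auto
    have "(*v) A -` N' \<in> null_sets lborel"
      using em[of N'] Sb(2) S(3) by (auto simp: null_sets_def)
    then have "(*v) A -` N \<in> null_sets lebesgue"
      using null_sets_completion_iff2[of "(*v) A -` N" lborel] vimage_mono[OF S(2), of "(*v) A"] by blast
    then have "(*v) A -` S \<union> (*v) A -` N \<in> sets lebesgue"
      using Sb(1) by (intro sets.Un) auto
    then show "(*v) A -` A' \<inter> space lebesgue \<in> sets lebesgue" unfolding S(1) by (simp add: vimage_Un)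
  qed simp
  show "distr lebesgue lebesgue ((*v) A) = lebesgue"
  proof (rule measure_eqI)
    fix S assume "S \<in> sets (distr lebesgue lebesgue ((*v) A))"
    then have S: "S \<in> sets lebesgue" by simp
    then obtain S0 N N' where S0: "S = S0 \<union> N" "N \<subseteq> N'" "N' \<in> null_sets lborel" "S0 \<in> sets lborel"
      by (rule sets_completionE)
    have n1: "N \<in> null_sets lebesgue" using S0(2,3) null_sets_completion_iff2 by blast
    have "(*v) A -` N' \<in> null_sets lborel"
      using em[of N'] measurable_sets[OF m, of N'] S0(3) by (auto simp: null_sets_def)
    then have n2: "(*v) A -` N \<in> null_sets lebesgue"
      using null_sets_completion_iff2[of "(*v) A -` N" lborel] vimage_mono[OF S0(2), of "(*v) A"] by blast
    have "emeasure (distr lebesgue lebesgue ((*v) A)) S = emeasure lebesgue ((*v) A -` S0 \<union> (*v) A -` N)"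
      using ml S by (simp add: emeasure_distr S0(1) vimage_Un)
    also have "\<dots> = emeasure lebesgue ((*v) A -` S0)"
      using measurable_sets[OF m, of S0] S0(4) by (intro emeasure_Un_null_set[OF _ n2]) auto
    also have "\<dots> = emeasure lborel ((*v) A -` S0)"
      using measurable_sets[OF m, of S0] S0(4) by simp
    also have "\<dots> = emeasure lborel S0" using em[of S0] S0(4) by simp
    also have "\<dots> = emeasure lebesgue S0" using S0(4) by simp
    also have "\<dots> = emeasure lebesgue S"
      unfolding S0(1) using S0(4) by (intro emeasure_Un_null_set[OF _ n1, symmetric]) auto
    finally show "emeasure (distr lebesgue lebesgue ((*v) A)) S = emeasure lebesgue S" .
  qed simp
qed

lemma integrable_scaleR_iff:
  fixes f :: "'a \<Rightarrow> 'b::{banach, second_countable_topology}"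
  assumes "c \<noteq> 0" shows "integrable M (\<lambda>x. c *\<^sub>R f x) \<longleftrightarrow> integrable M f"
  using integrable_scaleR_right[of "1 / c" M "\<lambda>x. c *\<^sub>R f x"] integrable_scaleR_right[of c M f] assms
  by auto

lemma integrable_scale_measure:
  fixes f :: "'a \<Rightarrow> 'b::{banach, second_countable_topology}"
  assumes k: "k > 0"
  shows "integrable (scale_measure (ennreal k) M) f \<longleftrightarrow> integrable M f"
    and "integral\<^sup>L (scale_measure (ennreal k) M) f = k *\<^sub>R integral\<^sup>L M f"
proof -
  have bm: "borel_measurable (scale_measure (ennreal k) M) = borel_measurable M"
    by (rule measurable_cong_sets) auto
  have 1: "integrable (scale_measure (ennreal k) M) f \<longleftrightarrow> integrable M f"
  proof (cases "f \<in> borel_measurable M")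
    case True
    have "integrable (density M (\<lambda>_. ennreal k)) f \<longleftrightarrow> integrable M (\<lambda>x. k *\<^sub>R f x)"
      by (rule integrable_density) (use True k in auto)
    also have "\<dots> \<longleftrightarrow> integrable M f" by (rule integrable_scaleR_iff) (use k in simp)
    finally show ?thesis unfolding scale_measure_eq_density .
  next
    case False
    then have "\<not> integrable M f" "\<not> integrable (scale_measure (ennreal k) M) f"
      using borel_measurable_integrable bm by blast+
    then show ?thesis by blast
  qed
  then show "integrable (scale_measure (ennreal k) M) f \<longleftrightarrow> integrable M f" .
  show "integral\<^sup>L (scale_measure (ennreal k) M) f = k *\<^sub>R integral\<^sup>L M f"
  proof (cases "f \<in> borel_measurable M")
    case True
    have "integral\<^sup>L (density M (\<lambda>_. ennreal k)) f = integral\<^sup>L M (\<lambda>x. k *\<^sub>R f x)"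
      by (rule integral_density) (use True k in auto)
    then show ?thesis unfolding scale_measure_eq_density by simp
  next
    case False
    then have "\<not> integrable M f" using borel_measurable_integrable by blast
    then show ?thesis using 1 by (simp add: not_integrable_integral_eq)
  qed
qed

lemma set_integrable_scale_measure:
  fixes f :: "'a \<Rightarrow> 'b::{banach, second_countable_topology}"
  assumes k: "k > 0" and S: "S \<in> sets M"
  shows "set_integrable (scale_measure (ennreal k) M) S f \<longleftrightarrow> integrable (restrict_space M S) f"
    and "set_lebesgue_integral (scale_measure (ennreal k) M) S f = k *\<^sub>R integral\<^sup>L (restrict_space M S) f"
proof -
  have S': "S \<inter> space M \<in> sets M" using S by simp
  show "set_integrable (scale_measure (ennreal k) M) S f \<longleftrightarrow> integrable (restrict_space M S) f"
    unfolding set_integrable_def integrable_scale_measure[OF k] integrable_restrict_space[OF S'] ..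
  show "set_lebesgue_integral (scale_measure (ennreal k) M) S f = k *\<^sub>R integral\<^sup>L (restrict_space M S) f"
    unfolding set_lebesgue_integral_def integrable_scale_measure[OF k] integral_restrict_space[OF S'] ..
qed

context reflection_quotient
begin

abbreviation \<Theta> :: "(complex^'d) set" where "\<Theta> \<equiv> \<theta> ` \<Omega>"

lemma open_\<Theta>: "open \<Theta>" by (rule open_image[OF open_\<Omega> order_refl])

lemma theta_borel: "\<theta> \<in> borel_measurable borel"
  by (rule borel_measurable_continuous_onI[OF continuous_theta])

lemma J_borel: "(\<lambda>z. ennreal ((cmod (J z))\<^sup>2)) \<in> borel_measurable borel"
proof -
  have [measurable]: "J \<in> borel_measurable borel"
    by (rule borel_measurable_continuous_onI[OF polyfun_continuous_on[OF polyfun_J]])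
  show ?thesis by measurable
qed

text \<open>Off the walls every point of \<open>\<Omega>\<close> is moved into the fundamental domain by exactly one group
  element, so the integral over \<open>\<Omega>\<close> is \<open>card G\<close> times the integral over the fundamental domain, on
  which \<open>\<theta>\<close> is injective.\<close>

lemma nn_integral_theta:
  assumes S: "S \<in> sets borel"
  shows "(\<integral>\<^sup>+z. ennreal ((cmod (J z))\<^sup>2) * indicator (\<Omega> \<inter> \<theta> -` S) z \<partial>lborel)
    = ennreal (real (card G)) * emeasure lborel (\<Theta> \<inter> S)"
proof -
  define F where "F = (\<lambda>z. ennreal ((cmod (J z))\<^sup>2) * indicator (dom \<inter> \<theta> -` S) z)"
  have Sm: "dom \<inter> \<theta> -` S \<in> sets borel" using measurable_sets[OF theta_borel S] open_dom by simp
  have F: "F \<in> borel_measurable borel"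
    unfolding F_def using J_borel Sm by measurable
  have mv: "(*v) \<sigma> \<in> borel_measurable borel" for \<sigma> :: "complex^'d^'d"
    by (intro borel_measurable_continuous_onI holomorphic_map_imp_continuous_on holomorphic_map_matrix)
  have Fs: "(\<lambda>z. F (\<sigma> *v z)) \<in> borel_measurable borel" for \<sigma> :: "complex^'d^'d"
    by (rule measurable_compose[OF mv F])
  have pt: "ennreal ((cmod (J z))\<^sup>2) * indicator (\<Omega> \<inter> \<theta> -` S) z = (\<Sum>\<sigma>\<in>G. F (\<sigma> *v z))"
    if z: "z \<notin> walls" for z
  proof (cases "z \<in> \<Omega>")
    case False
    then have "F (\<sigma> *v z) = 0" if "\<sigma> \<in> G" for \<sigma>
      using G_\<Omega>_iff[OF that, of z] by (simp add: F_def dom_def)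
    then show ?thesis using False by simp
  next
    case True
    then obtain \<sigma> where s: "\<sigma> \<in> G" "\<sigma> *v z \<in> dom" using dom_covers z by blast
    have zero: "F (\<tau> *v z) = 0" if t: "\<tau> \<in> G - {\<sigma>}" for \<tau>
    proof -
      have "\<tau> *v z \<notin> dom"
      proof
        assume "\<tau> *v z \<in> dom"
        then have "(\<tau> ** matrix_inv \<sigma>) *v (\<sigma> *v z) \<in> dom"
          by (simp add: matrix_vector_mul_assoc[symmetric] inv_cancel[OF s(1)])
        then have "\<tau> ** matrix_inv \<sigma> = mat 1"
          using dom_unique[OF s(2)] t s(1) by (auto intro: mult_G inv_G)
        then have "\<tau> ** matrix_inv \<sigma> ** \<sigma> = \<sigma>" by simp
        then have "\<tau> = \<sigma>" by (simp add: matrix_mul_assoc[symmetric] inv_left[OF s(1)])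
        then show False using t by simp
      qed
      then show ?thesis by (simp add: F_def)
    qed
    have "(\<Sum>\<tau>\<in>G. F (\<tau> *v z)) = F (\<sigma> *v z) + (\<Sum>\<tau>\<in>G - {\<sigma>}. F (\<tau> *v z))"
      by (rule sum.remove[OF finite_G s(1)])
    also have "(\<Sum>\<tau>\<in>G - {\<sigma>}. F (\<tau> *v z)) = 0" by (rule sum.neutral) (use zero in blast)
    also have "F (\<sigma> *v z) = ennreal ((cmod (J z))\<^sup>2) * indicator (\<Omega> \<inter> \<theta> -` S) z"
      using s True by (simp add: F_def cmod_J theta_invariant indicator_def)
    finally show ?thesis by simp
  qed
  have "(\<integral>\<^sup>+z. ennreal ((cmod (J z))\<^sup>2) * indicator (\<Omega> \<inter> \<theta> -` S) z \<partial>lborel)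
      = (\<integral>\<^sup>+z. ennreal ((cmod (J z))\<^sup>2) * indicator (\<Omega> \<inter> \<theta> -` S) z \<partial>lebesgue)"
    by (simp add: nn_integral_completion)
  also have "\<dots> = (\<integral>\<^sup>+z. (\<Sum>\<sigma>\<in>G. F (\<sigma> *v z)) \<partial>lebesgue)"
  proof (rule nn_integral_cong_AE, rule AE_I'[of walls])
    show "walls \<in> null_sets lebesgue" using negligible_walls by (simp add: negligible_iff_null_sets)
  qed (use pt in blast)
  also have "\<dots> = (\<integral>\<^sup>+z. (\<Sum>\<sigma>\<in>G. F (\<sigma> *v z)) \<partial>lborel)" by (simp add: nn_integral_completion)
  also have "\<dots> = (\<Sum>\<sigma>\<in>G. \<integral>\<^sup>+z. F (\<sigma> *v z) \<partial>lborel)"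
    by (rule nn_integral_sum) (use Fs in simp)
  also have "\<dots> = (\<Sum>\<sigma>\<in>G. \<integral>\<^sup>+z. F z \<partial>lborel)"
  proof (rule sum.cong)
    fix \<sigma> assume s: "\<sigma> \<in> G"
    have "(\<integral>\<^sup>+z. F z \<partial>distr lborel borel ((*v) \<sigma>)) = (\<integral>\<^sup>+z. F (\<sigma> *v z) \<partial>lborel)"
      by (rule nn_integral_distr) (use mv F in auto)
    then show "(\<integral>\<^sup>+z. F (\<sigma> *v z) \<partial>lborel) = (\<integral>\<^sup>+z. F z \<partial>lborel)"
      by (simp add: lborel_distr_matrix[OF det_G[OF s]])
  qed simp
  also have "\<dots> = ennreal (real (card G)) * emeasure lborel (\<theta> ` dom \<inter> S)"
    unfolding emeasure_theta_dom[OF S] F_def by (simp add: ennreal_of_nat_eq_real_of_nat)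
  also have "emeasure lborel (\<theta> ` dom \<inter> S) = emeasure lborel (\<Theta> \<inter> S)"
  proof (rule antisym)
    have sb: "\<Theta> \<inter> S \<in> sets borel" "\<theta> ` dom \<inter> S \<in> sets borel" using open_\<Theta> open_theta_dom S by auto
    show "emeasure lborel (\<theta> ` dom \<inter> S) \<le> emeasure lborel (\<Theta> \<inter> S)"
      by (rule emeasure_mono) (use sb in \<open>auto simp: dom_def\<close>)
    have "negligible (\<theta> ` walls)"
      by (rule negligible_differentiable_image_negligible[OF order_refl negligible_walls])
         (use theta_has_derivative in \<open>auto simp: differentiable_on_def differentiable_def intro: has_derivative_at_withinI\<close>)
    then have n: "\<theta> ` walls \<in> null_sets lebesgue" by (simp add: negligible_iff_null_sets)
    have "\<Theta> \<inter> S \<subseteq> (\<theta> ` dom \<inter> S) \<union> \<theta> ` walls"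
    proof
      fix u assume u: "u \<in> \<Theta> \<inter> S"
      then obtain z where z: "z \<in> \<Omega>" "u = \<theta> z" by blast
      show "u \<in> (\<theta> ` dom \<inter> S) \<union> \<theta> ` walls"
      proof (cases "z \<in> walls")
        case False
        then obtain \<sigma> where "\<sigma> \<in> G" "\<sigma> *v z \<in> dom" using dom_covers z(1) by blast
        then have "u \<in> \<theta> ` dom" using theta_invariant[of \<sigma> z] z(2) by (intro image_eqI[of _ _ "\<sigma> *v z"]) auto
        then show ?thesis using u by blast
      qed (use z in blast)
    qed
    then have "emeasure lebesgue (\<Theta> \<inter> S) \<le> emeasure lebesgue ((\<theta> ` dom \<inter> S) \<union> \<theta> ` walls)"
      using n sb by (intro emeasure_mono sets.Un) auto
    also have "\<dots> = emeasure lebesgue (\<theta> ` dom \<inter> S)" using sb by (intro emeasure_Un_null_set n) auto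
    finally show "emeasure lborel (\<Theta> \<inter> S) \<le> emeasure lborel (\<theta> ` dom \<inter> S)" using sb by simp
  qed
  finally show ?thesis .
qed

lemma negligible_J: "negligible {z. J z = 0}"
  using polyfun_zeros_negligible[OF polyfun_J] J_nonzero by blast

text \<open>The set has measure zero with respect to the density \<open>|J|\<^sup>2\<close>, whose zeros are negligible.\<close>

lemma negligible_theta_preimage:
  assumes N: "N \<in> null_sets lborel" shows "\<Omega> \<inter> \<theta> -` N \<in> null_sets lebesgue"
proof -
  have Nb: "N \<in> sets borel" "emeasure lborel N = 0" using N by (auto simp: null_sets_def)
  have Sm: "\<Omega> \<inter> \<theta> -` N \<in> sets borel" using measurable_sets[OF theta_borel Nb(1)] open_\<Omega> by simp
  have "emeasure lborel (\<Theta> \<inter> N) \<le> emeasure lborel N" using Nb by (intro emeasure_mono) auto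
  then have "(\<integral>\<^sup>+z. ennreal ((cmod (J z))\<^sup>2) * indicator (\<Omega> \<inter> \<theta> -` N) z \<partial>lborel) = 0"
    using nn_integral_theta[OF Nb(1)] Nb(2) by simp
  moreover have "(\<lambda>z. ennreal ((cmod (J z))\<^sup>2) * indicator (\<Omega> \<inter> \<theta> -` N) z) \<in> borel_measurable lborel"
    using J_borel Sm by measurable
  ultimately have "AE z in lborel. ennreal ((cmod (J z))\<^sup>2) * indicator (\<Omega> \<inter> \<theta> -` N) z = 0"
    using nn_integral_0_iff_AE by blast
  then obtain N0 where N0: "{z\<in>space lborel. \<not> ennreal ((cmod (J z))\<^sup>2) * indicator (\<Omega> \<inter> \<theta> -` N) z = 0} \<subseteq> N0"
     "N0 \<in> null_sets lborel"
    by (auto elim!: AE_E simp: null_sets_def)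
  have "\<Omega> \<inter> \<theta> -` N \<subseteq> N0 \<union> {z. J z = 0}"
  proof
    fix z assume "z \<in> \<Omega> \<inter> \<theta> -` N"
    then show "z \<in> N0 \<union> {z. J z = 0}" using N0(1) by (cases "J z = 0") (auto simp: subset_iff)
  qed
  moreover have "negligible N0" using N0(2) by (simp add: negligible_iff_null_sets null_sets_completionI)
  ultimately have "negligible (\<Omega> \<inter> \<theta> -` N)"
    using negligible_subset[OF negligible_Un[OF _ negligible_J]] by blast
  then show ?thesis by (simp add: negligible_iff_null_sets)
qed

lemma theta_preimage_null:
  assumes "N \<in> null_sets lebesgue" shows "\<Omega> \<inter> \<theta> -` N \<in> null_sets lebesgue"
proof -
  obtain N' where N': "N' \<in> null_sets lborel" "N \<subseteq> N'" using assms null_sets_completion_iff2[of N lborel] by blast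
  have "negligible (\<Omega> \<inter> \<theta> -` N')" using negligible_theta_preimage[OF N'(1)] by (simp add: negligible_iff_null_sets)
  then have "negligible (\<Omega> \<inter> \<theta> -` N)" by (rule negligible_subset) (use N'(2) in blast)
  then show ?thesis by (simp add: negligible_iff_null_sets)
qed

lemma theta_measurable: "\<theta> \<in> measurable (lebesgue_on \<Omega>) (lebesgue_on \<Theta>)"
proof (rule measurable_restrict_space2)
  show "\<theta> \<in> space (lebesgue_on \<Omega>) \<rightarrow> \<Theta>" by (simp add: space_restrict_space)
  show "\<theta> \<in> measurable (lebesgue_on \<Omega>) lebesgue"
  proof (rule measurableI)
    fix A :: "(complex^'d) set" assume "A \<in> sets lebesgue"
    then obtain S N N' where S: "A = S \<union> N" "N \<subseteq> N'" "N' \<in> null_sets lborel" "S \<in> sets lborel"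
      by (rule sets_completionE)
    have "N \<in> null_sets lebesgue" using S(2,3) null_sets_completion_iff2[of N lborel] by blast
    then have "\<Omega> \<inter> \<theta> -` N \<in> sets lebesgue" using theta_preimage_null by blast
    moreover have "\<Omega> \<inter> \<theta> -` S \<in> sets lebesgue"
      using measurable_sets[OF theta_borel, of S] S(4) open_\<Omega> by simp
    ultimately have "(\<Omega> \<inter> \<theta> -` S) \<union> (\<Omega> \<inter> \<theta> -` N) \<in> sets lebesgue" by (rule sets.Un[rotated])
    moreover have "(\<Omega> \<inter> \<theta> -` S) \<union> (\<Omega> \<inter> \<theta> -` N) = \<theta> -` A \<inter> \<Omega>" using S(1) by blast
    ultimately show "\<theta> -` A \<inter> space (lebesgue_on \<Omega>) \<in> sets (lebesgue_on \<Omega>)"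
      using open_\<Omega> by (simp add: space_restrict_space sets_restrict_space_iff)
  qed simp
qed

lemma J_measurable: "(\<lambda>z. (cmod (J z))\<^sup>2) \<in> borel_measurable (lebesgue_on \<Omega>)"
proof -
  have "continuous_on UNIV (\<lambda>z. (cmod (J z))\<^sup>2)"
    by (intro continuous_intros polyfun_continuous_on polyfun_J)
  then have "(\<lambda>z. (cmod (J z))\<^sup>2) \<in> borel_measurable lborel" by (simp add: borel_measurable_continuous_onI)
  then show ?thesis by (intro measurable_restrict_space1 measurable_completion)
qed

lemma distr_theta:
  "distr (density (lebesgue_on \<Omega>) (\<lambda>z. ennreal ((cmod (J z))\<^sup>2))) (lebesgue_on \<Theta>) \<theta>
    = scale_measure (ennreal (real (card G))) (lebesgue_on \<Theta>)"
proof (rule measure_eqI)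
  fix A assume "A \<in> sets (distr (density (lebesgue_on \<Omega>) (\<lambda>z. ennreal ((cmod (J z))\<^sup>2))) (lebesgue_on \<Theta>) \<theta>)"
  then have A': "A \<in> sets (lebesgue_on \<Theta>)" by simp
  then have A: "A \<in> sets lebesgue" "A \<subseteq> \<Theta>"
    using open_\<Theta> by (auto simp: sets_restrict_space_iff)
  obtain S N N' where S: "A = S \<union> N" "N \<subseteq> N'" "N' \<in> null_sets lborel" "S \<in> sets lborel"
    using A(1) by (rule sets_completionE)
  have N: "N \<in> null_sets lebesgue" using S(2,3) null_sets_completion_iff2[of N lborel] by blast
  have vA: "\<theta> -` A \<inter> \<Omega> \<in> sets (lebesgue_on \<Omega>)"
    using measurable_sets[OF theta_measurable A'] by (simp add: space_restrict_space)
  have m: "\<theta> \<in> measurable (density (lebesgue_on \<Omega>) (\<lambda>z. ennreal ((cmod (J z))\<^sup>2))) (lebesgue_on \<Theta>)"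
    using theta_measurable by simp
  have "emeasure (distr (density (lebesgue_on \<Omega>) (\<lambda>z. ennreal ((cmod (J z))\<^sup>2))) (lebesgue_on \<Theta>) \<theta>) A
      = emeasure (density (lebesgue_on \<Omega>) (\<lambda>z. ennreal ((cmod (J z))\<^sup>2))) (\<theta> -` A \<inter> \<Omega>)"
    using emeasure_distr[OF m A'] by (simp add: space_restrict_space)
  also have "\<dots> = (\<integral>\<^sup>+z. ennreal ((cmod (J z))\<^sup>2) * indicator (\<theta> -` A \<inter> \<Omega>) z \<partial>lebesgue_on \<Omega>)"
    by (rule emeasure_density) (use J_measurable vA in auto)
  also have "\<dots> = (\<integral>\<^sup>+z. ennreal ((cmod (J z))\<^sup>2) * indicator (\<theta> -` A \<inter> \<Omega>) z * indicator \<Omega> z \<partial>lebesgue)"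
    by (rule nn_integral_restrict_space) (use open_\<Omega> in simp)
  also have "\<dots> = (\<integral>\<^sup>+z. ennreal ((cmod (J z))\<^sup>2) * indicator (\<Omega> \<inter> \<theta> -` S) z \<partial>lebesgue)"
  proof (rule nn_integral_cong_AE, rule AE_I'[OF theta_preimage_null[OF N]])
    show "{z \<in> space lebesgue. ennreal ((cmod (J z))\<^sup>2) * indicator (\<theta> -` A \<inter> \<Omega>) z * indicator \<Omega> z
        \<noteq> ennreal ((cmod (J z))\<^sup>2) * indicator (\<Omega> \<inter> \<theta> -` S) z} \<subseteq> \<Omega> \<inter> \<theta> -` N"
      using S(1) by (auto simp: indicator_def split: if_splits)
  qed
  also have "\<dots> = ennreal (real (card G)) * emeasure lborel (\<Theta> \<inter> S)"
    using nn_integral_theta[of S] S(4) by (simp add: nn_integral_completion)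
  also have "\<Theta> \<inter> S = S" using A(2) S(1) by blast
  also have "emeasure lborel S = emeasure lebesgue (S \<union> N)"
    using emeasure_Un_null_set[OF _ N, of S] S(4) by simp
  also have "\<dots> = emeasure (lebesgue_on \<Theta>) A"
    using A open_\<Theta> by (simp add: S(1)[symmetric] emeasure_restrict_space)
  finally show "emeasure (distr (density (lebesgue_on \<Omega>) (\<lambda>z. ennreal ((cmod (J z))\<^sup>2))) (lebesgue_on \<Theta>) \<theta>) A
      = emeasure (scale_measure (ennreal (real (card G))) (lebesgue_on \<Theta>)) A" by simp
qed simp

lemma card_G_pos: "card G > 0"
  using finite_G one_G by (auto simp: card_gt_0_iff)

lemma change_of_variables_theta:
  fixes F :: "complex^'d \<Rightarrow> 'b::{banach, second_countable_topology}"
  assumes F: "F \<in> borel_measurable (lebesgue_on \<Theta>)"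
  shows "integrable (lebesgue_on \<Omega>) (\<lambda>z. (cmod (J z))\<^sup>2 *\<^sub>R F (\<theta> z)) \<longleftrightarrow> integrable (lebesgue_on \<Theta>) F"
    and "integral\<^sup>L (lebesgue_on \<Omega>) (\<lambda>z. (cmod (J z))\<^sup>2 *\<^sub>R F (\<theta> z)) = real (card G) *\<^sub>R integral\<^sup>L (lebesgue_on \<Theta>) F"
proof -
  let ?M = "density (lebesgue_on \<Omega>) (\<lambda>z. ennreal ((cmod (J z))\<^sup>2))"
  have m: "\<theta> \<in> measurable ?M (lebesgue_on \<Theta>)" using theta_measurable by simp
  have Ft: "(\<lambda>z. F (\<theta> z)) \<in> borel_measurable (lebesgue_on \<Omega>)"
    using measurable_compose[OF theta_measurable F] .
  have cG: "real (card G) > 0" using card_G_pos by simp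
  have "integrable (lebesgue_on \<Omega>) (\<lambda>z. (cmod (J z))\<^sup>2 *\<^sub>R F (\<theta> z)) \<longleftrightarrow> integrable ?M (\<lambda>z. F (\<theta> z))"
    by (rule integrable_density[symmetric]) (use Ft J_measurable in auto)
  also have "\<dots> \<longleftrightarrow> integrable (distr ?M (lebesgue_on \<Theta>) \<theta>) F"
    by (rule integrable_distr_eq[OF m F, symmetric])
  also have "\<dots> \<longleftrightarrow> integrable (lebesgue_on \<Theta>) F"
    unfolding distr_theta by (rule integrable_scale_measure[OF cG])
  finally show "integrable (lebesgue_on \<Omega>) (\<lambda>z. (cmod (J z))\<^sup>2 *\<^sub>R F (\<theta> z)) \<longleftrightarrow> integrable (lebesgue_on \<Theta>) F" .
  have "integral\<^sup>L (lebesgue_on \<Omega>) (\<lambda>z. (cmod (J z))\<^sup>2 *\<^sub>R F (\<theta> z)) = integral\<^sup>L ?M (\<lambda>z. F (\<theta> z))"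
    by (rule integral_density[symmetric]) (use Ft J_measurable in auto)
  also have "\<dots> = integral\<^sup>L (distr ?M (lebesgue_on \<Theta>) \<theta>) F"
    by (rule integral_distr[OF m F, symmetric])
  also have "\<dots> = real (card G) *\<^sub>R integral\<^sup>L (lebesgue_on \<Theta>) F"
    unfolding distr_theta by (rule integrable_scale_measure[OF cG])
  finally show "integral\<^sup>L (lebesgue_on \<Omega>) (\<lambda>z. (cmod (J z))\<^sup>2 *\<^sub>R F (\<theta> z)) = real (card G) *\<^sub>R integral\<^sup>L (lebesgue_on \<Theta>) F" .
qed

end

section \<open>The projection formula\<close>

context weighted_domain
begin

lemma A2_sum:
  assumes "finite I" "\<And>i. i \<in> I \<Longrightarrow> g i \<in> A2 V D \<nu>"
  shows "(\<lambda>w. \<Sum>i\<in>I. c i * g i w) \<in> A2 V D \<nu>"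
  using assms
proof (induction I rule: finite_induct)
  case empty
  then show ?case using A2_zero by simp
next
  case (insert i I)
  have "(\<lambda>w. (\<Sum>i\<in>I. c i * g i w) + c i * g i w) \<in> A2 V D \<nu>"
    by (rule A2_add_smult) (use insert in auto)
  then show ?case using insert.hyps by (simp add: add.commute)
qed

lemma ip_sum_right:
  assumes f: "f \<in> L2 V D \<nu>" and g: "\<And>i. i \<in> I \<Longrightarrow> g i \<in> L2 V D \<nu>"
  shows "ip f (\<lambda>w. \<Sum>i\<in>I. c i * g i w) = (\<Sum>i\<in>I. cnj (c i) * ip f (g i))"
proof -
  let ?F = "\<lambda>i w. indicator D w *\<^sub>R (f w * cnj (g i w) * complex_of_real (\<nu> w))"
  have "ip f (\<lambda>w. \<Sum>i\<in>I. c i * g i w) = (LINT w|V. (\<Sum>i\<in>I. cnj (c i) * ?F i w))"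
    unfolding ip_def set_lebesgue_integral_def
    by (rule Bochner_Integration.integral_cong)
       (simp_all add: sum_distrib_left sum_distrib_right scaleR_sum_right cnj_sum mult_ac)
  also have "\<dots> = (\<Sum>i\<in>I. LINT w|V. cnj (c i) * ?F i w)"
  proof (rule Bochner_Integration.integral_sum)
    fix i assume "i \<in> I"
    then have "integrable V (?F i)" using L2_product_integrable[OF f g] by (simp add: set_integrable_def)
    then show "integrable V (\<lambda>w. cnj (c i) * ?F i w)" by (rule integrable_mult_right)
  qed
  also have "\<dots> = (\<Sum>i\<in>I. cnj (c i) * ip f (g i))"
    unfolding ip_def set_lebesgue_integral_def by (simp only: integral_mult_right_zero)
  finally show ?thesis .
qed

lemma ip_cong:
  assumes "\<And>w. w \<in> D \<Longrightarrow> f w = f' w" "\<And>w. w \<in> D \<Longrightarrow> g w = g' w"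
  shows "ip f g = ip f' g'"
  unfolding ip_def set_lebesgue_integral_def
  by (rule Bochner_Integration.integral_cong) (use assms in \<open>auto simp: indicator_def\<close>)

end

locale weighted_quotient = reflection_quotient G \<rho> l a \<Omega> \<theta>
  for G :: "(complex^'d^'d) set" and \<rho> l a \<Omega> \<theta> +
  fixes \<omega>' :: "complex^'d \<Rightarrow> real"
  assumes continuous_\<omega>': "continuous_on (\<theta> ` \<Omega>) \<omega>'" and \<omega>'_pos: "\<And>u. u \<in> \<theta> ` \<Omega> \<Longrightarrow> \<omega>' u > 0"
begin

subsection \<open>The induced weight\<close>

abbreviation V :: "(complex^'d) measure" where "V \<equiv> normalized_volume \<Omega>"

abbreviation \<omega> :: "complex^'d \<Rightarrow> real" where "\<omega> \<equiv> \<omega>' \<circ> \<theta>"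

abbreviation W :: "complex^'d \<Rightarrow> real" where "W \<equiv> rep_weight G \<Omega> \<theta> \<l> \<omega>'"

definition \<kappa> :: real where "\<kappa> = 1 / measure lebesgue \<Omega>"

lemma kappa_pos: "\<kappa> > 0" and V_eq: "V = scale_measure (ennreal \<kappa>) lebesgue"
proof -
  have l: "\<Omega> \<in> lmeasurable" using lmeasurable_open[OF bounded_\<Omega> open_\<Omega>] .
  have "measure lebesgue \<Omega> \<noteq> 0"
    using open_not_negligible[OF open_\<Omega> nonempty_\<Omega>] negligible_iff_measure0[OF l] by blast
  then have m: "measure lebesgue \<Omega> > 0" using measure_nonneg[of lebesgue \<Omega>] by linarith
  then show "\<kappa> > 0" by (simp add: \<kappa>_def)
  have "(1::ennreal) / ennreal (measure lebesgue \<Omega>) = ennreal (1 / measure lebesgue \<Omega>)"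
    using divide_ennreal[of 1 "measure lebesgue \<Omega>"] m by simp
  then show "V = scale_measure (ennreal \<kappa>) lebesgue"
    unfolding normalized_volume_def \<kappa>_def emeasure_eq_measure2[OF l] by simp
qed

lemma cmod_rep_poly: "\<sigma> \<in> G \<Longrightarrow> cmod (\<l> (\<sigma> *v z)) = cmod (\<l> z)"
  by (simp add: char norm_mult cmod_char)

text \<open>The expression that defines the weight is constant on the fibres of \<open>\<theta>\<close>, which are orbits.\<close>

lemma weight_eq:
  assumes z: "z \<in> \<Omega>" "\<theta> z \<notin> \<theta> ` (\<Union>R)"
  shows "W (\<theta> z) = (cmod (\<l> z))\<^sup>2 / (cmod (J z))\<^sup>2 * \<omega>' (\<theta> z)"
proof -
  let ?f = "\<lambda>z. (cmod (\<l> z))\<^sup>2 / (cmod (J z))\<^sup>2 * \<omega>' (\<theta> z)"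
  have const: "?f z' = ?f z" if e: "\<theta> z' = \<theta> z" for z'
  proof -
    obtain \<sigma> where s: "\<sigma> \<in> G" "z' = \<sigma> *v z" using theta_fibre[OF e[symmetric]] by blast
    show ?thesis unfolding s(2) cmod_rep_poly[OF s(1)] cmod_J[OF s(1)] theta_invariant[OF s(1)] ..
  qed
  have "(THE r. \<forall>z'\<in>\<Omega>. \<theta> z' = \<theta> z \<longrightarrow> r = ?f z') = ?f z"
  proof (rule the_equality)
    show "\<forall>z'\<in>\<Omega>. \<theta> z' = \<theta> z \<longrightarrow> ?f z = ?f z'" using const by metis
  qed (use z(1) in blast)
  moreover have "\<theta> z \<in> \<theta> ` \<Omega> - \<theta> ` (\<Union>R)" using z by blast
  ultimately show ?thesis unfolding rep_weight_def by simp
qed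

lemma regular_not_branch:
  assumes "\<Delta> z \<noteq> 0" shows "\<theta> z \<notin> \<theta> ` (\<Union>R)"
proof
  assume "\<theta> z \<in> \<theta> ` (\<Union>R)"
  then obtain H z' where H: "H \<in> R" "z' \<in> H" "\<theta> z' = \<theta> z" by force
  then obtain \<sigma> where s: "\<sigma> \<in> G" "z = \<sigma> *v z'" using theta_fibre by blast
  have "l ((*v) \<sigma> ` H) z = 0" using l_zero[OF hyperplane_image[OF H(1) s(1)]] H(2) s(2) by blast
  then show False using \<Delta>_D(3)[OF assms hyperplane_image[OF H(1) s(1)]] by blast
qed

lemma weight_regular:
  "z \<in> \<Omega> \<Longrightarrow> \<Delta> z \<noteq> 0 \<Longrightarrow> W (\<theta> z) = (cmod (\<l> z))\<^sup>2 / (cmod (J z))\<^sup>2 * \<omega>' (\<theta> z)"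
  using weight_eq regular_not_branch by blast

lemma weight_nonneg: "u \<in> \<Theta> \<Longrightarrow> 0 \<le> W u"
proof (cases "u \<in> \<theta> ` (\<Union>R)")
  case True
  then show ?thesis by (simp add: rep_weight_def)
next
  case False
  assume "u \<in> \<Theta>"
  then obtain z where z: "z \<in> \<Omega>" "u = \<theta> z" by blast
  then have "0 \<le> \<omega>' u" using \<omega>'_pos[of u] by auto
  then show ?thesis using weight_eq[of z] False z by simp
qed

definition \<Theta>\<^sub>r :: "(complex^'d) set" where "\<Theta>\<^sub>r = \<theta> ` (\<Omega> \<inter> {z. \<Delta> z \<noteq> 0})"

lemma regular_image: "\<Theta>\<^sub>r = \<Theta> \<inter> {u. \<delta> u \<noteq> 0}"
  by (auto simp: \<Theta>\<^sub>r_def \<Delta>_eq)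

lemma open_regular: "open (\<Omega> \<inter> {z. \<Delta> z \<noteq> 0})"
  using open_Collect_neq[of \<Delta> "\<lambda>u. 0"] polyfun_continuous_on[OF polyfun_\<Delta>] open_\<Omega> by (intro open_Int) auto

lemma open_\<Theta>r: "open \<Theta>\<^sub>r"
  unfolding \<Theta>\<^sub>r_def by (rule open_image[OF open_regular]) simp

lemma continuous_on_\<omega>: "continuous_on \<Omega> \<omega>"
  unfolding o_def by (rule continuous_on_compose2[OF continuous_\<omega>' continuous_theta]) simp

lemma continuous_weight: "continuous_on \<Theta>\<^sub>r W"
proof -
  let ?E = "\<Omega> \<inter> {z. \<Delta> z \<noteq> 0}"
  let ?f = "\<lambda>z. (cmod (\<l> z))\<^sup>2 / (cmod (J z))\<^sup>2 * \<omega> z"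
  have c: "continuous_on ?E ?f"
    by (intro continuous_on_mult continuous_on_divide continuous_on_power continuous_on_norm
          polyfun_continuous_on[OF polyfun_J] polyfun_continuous_on[OF polyfun_rep_poly]
          continuous_on_subset[OF continuous_on_\<omega>]) (use \<Delta>_D(1) in auto)
  have i: "?f (\<sigma> *v z) = ?f z" if "\<sigma> \<in> G" for \<sigma> z
    using that by (simp add: cmod_rep_poly cmod_J theta_invariant)
  obtain h where h: "continuous_on (\<theta> ` ?E) h" "\<And>z. z \<in> ?E \<Longrightarrow> h (\<theta> z) = ?f z"
    using descend_continuous[OF open_regular Int_lower1 c i] by blast
  have "W u = h u" if u: "u \<in> \<theta> ` ?E" for u
  proof -
    obtain z where z: "z \<in> ?E" "u = \<theta> z" using u by blast
    then show ?thesis using h(2)[OF z(1)] weight_regular[of z] by simp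
  qed
  then have "continuous_on (\<theta> ` ?E) W \<longleftrightarrow> continuous_on (\<theta> ` ?E) h" by (rule continuous_on_cong[OF refl])
  then show ?thesis using h(1) by (simp add: \<Theta>\<^sub>r_def)
qed

text \<open>The weight is continuous off the zero set of \<open>\<delta>\<close>, which is negligible.\<close>

lemma weight_measurable: "W \<in> borel_measurable (lebesgue_on \<Theta>)"
proof -
  have "(\<lambda>u. indicator \<Theta>\<^sub>r u *\<^sub>R W u) \<in> borel_measurable borel"
    by (rule borel_measurable_continuous_on_indicator[OF _ continuous_weight]) (use open_\<Theta>r in simp)
  then have 1: "(\<lambda>u. indicator \<Theta>\<^sub>r u *\<^sub>R W u) \<in> borel_measurable lebesgue"
    by (intro measurable_completion) simp
  obtain w where w: "\<delta> w \<noteq> 0" using \<delta>_nonzero by blast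
  have n: "{u. \<delta> u = 0} \<in> null_sets lebesgue"
    using polyfun_zeros_negligible[OF polyfun_\<delta> w] by (simp add: negligible_iff_null_sets)
  have "AE u in lebesgue. indicator \<Theta>\<^sub>r u *\<^sub>R W u = indicator \<Theta> u *\<^sub>R W u"
    by (rule AE_I'[OF n]) (auto simp: regular_image indicator_def)
  then have "(\<lambda>u. indicator \<Theta> u *\<^sub>R W u) \<in> borel_measurable lebesgue" by (rule borel_measurable_AE[OF 1])
  moreover have "\<Theta> \<inter> space lebesgue \<in> sets lebesgue" using open_\<Theta> by simp
  ultimately show ?thesis by (simp only: borel_measurable_restrict_space_iff)
qed

lemma weight_bounded_below:
  assumes u: "u \<in> \<Theta>" "\<delta> u \<noteq> 0"
  shows "\<exists>r>0. \<exists>c>0. ball u r \<subseteq> \<Theta> \<and> (\<forall>x\<in>ball u r. c \<le> W x)"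
proof -
  obtain z where z: "z \<in> \<Omega>" "u = \<theta> z" using u by blast
  then have D: "\<Delta> z \<noteq> 0" using u(2) by (simp add: \<Delta>_eq)
  have pos: "W u > 0"
    using \<omega>'_pos[OF u(1)] \<Delta>_D(1,2)[OF D] unfolding z(2) weight_regular[OF z(1) D] by simp
  have "open (\<Theta>\<^sub>r \<inter> W -` {W u / 2<..})"
    by (rule continuous_open_preimage[OF continuous_weight open_\<Theta>r open_greaterThan])
  moreover have "u \<in> \<Theta>\<^sub>r \<inter> W -` {W u / 2<..}" using u pos by (simp add: regular_image)
  ultimately obtain r where r: "r > 0" "ball u r \<subseteq> \<Theta>\<^sub>r \<inter> W -` {W u / 2<..}"
    using open_contains_ball by blast
  show ?thesis
  proof (intro exI conjI ballI)
    show "ball u r \<subseteq> \<Theta>" using r(2) by (auto simp: regular_image)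
    show "W u / 2 \<le> W x" if "x \<in> ball u r" for x using r(2) that by force
  qed (use r(1) pos in auto)
qed

lemma weight_upstairs_bounded_below:
  assumes u: "u \<in> \<Omega>"
  shows "\<exists>r>0. \<exists>c>0. ball u r \<subseteq> \<Omega> \<and> (\<forall>x\<in>ball u r. c \<le> \<omega> x)"
proof -
  have pos: "\<omega> u > 0" using \<omega>'_pos u by simp
  have "open (\<Omega> \<inter> \<omega> -` {\<omega> u / 2<..})"
    by (rule continuous_open_preimage[OF continuous_on_\<omega> open_\<Omega> open_greaterThan])
  moreover have "u \<in> \<Omega> \<inter> \<omega> -` {\<omega> u / 2<..}" using u pos by simp
  ultimately obtain r where r: "r > 0" "ball u r \<subseteq> \<Omega> \<inter> \<omega> -` {\<omega> u / 2<..}"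
    using open_contains_ball by blast
  show ?thesis
  proof (intro exI conjI ballI)
    show "ball u r \<subseteq> \<Omega>" using r(2) by auto
    show "\<omega> u / 2 \<le> \<omega> x" if "x \<in> ball u r" for x using r(2) that by force
  qed (use r(1) pos in auto)
qed

lemma set_borel_measurable_V_iff:
  fixes f :: "complex^'d \<Rightarrow> 'b::real_normed_vector"
  assumes "open D" shows "set_borel_measurable V D f \<longleftrightarrow> f \<in> borel_measurable (lebesgue_on D)"
proof -
  have V: "(borel_measurable V :: (complex^'d \<Rightarrow> 'b) set) = borel_measurable lebesgue"
    by (rule measurable_cong_sets) (simp_all add: V_eq)
  show ?thesis
    unfolding set_borel_measurable_def V
    by (rule borel_measurable_restrict_space_iff[symmetric]) (use assms in simp)
qed

lemma continuous_imp_lebesgue_on: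
  fixes f :: "complex^'d \<Rightarrow> 'b::{real_normed_vector,second_countable_topology}"
  assumes "open D" "continuous_on D f" shows "f \<in> borel_measurable (lebesgue_on D)"
proof -
  have "(\<lambda>x. indicator D x *\<^sub>R f x) \<in> borel_measurable borel"
    by (rule borel_measurable_continuous_on_indicator[OF _ assms(2)]) (use assms(1) in simp)
  then have "(\<lambda>x. indicator D x *\<^sub>R f x) \<in> borel_measurable lebesgue"
    by (intro measurable_completion) simp
  moreover have "D \<inter> space lebesgue \<in> sets lebesgue" using assms(1) by simp
  ultimately show ?thesis by (simp only: borel_measurable_restrict_space_iff)
qed

sublocale up: weighted_domain V \<Omega> \<omega> \<kappa> "\<lambda>_. 1" 0
proof
  show "set_borel_measurable V \<Omega> \<omega>"
    unfolding set_borel_measurable_V_iff[OF open_\<Omega>] by (rule continuous_imp_lebesgue_on[OF open_\<Omega> continuous_on_\<omega>])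
  show "0 \<le> \<omega> z" if "z \<in> \<Omega>" for z using \<omega>'_pos[of "\<theta> z"] that by (simp add: less_imp_le)
  show "polyfun (\<lambda>_. 1)" by (rule polyfun.const)
  show "\<exists>r>0. \<exists>c>0. ball u r \<subseteq> \<Omega> \<and> (\<forall>x\<in>ball u r. c \<le> \<omega> x)" if "u \<in> \<Omega>" for u
    by (rule weight_upstairs_bounded_below[OF that])
qed (use V_eq kappa_pos open_\<Omega> in simp_all)

sublocale down: weighted_domain V \<Theta> W \<kappa> \<delta> "SOME u. \<delta> u \<noteq> 0"
proof
  show "set_borel_measurable V \<Theta> W"
    unfolding set_borel_measurable_V_iff[OF open_\<Theta>] by (rule weight_measurable)
  show "\<delta> (SOME u. \<delta> u \<noteq> 0) \<noteq> 0" by (rule someI_ex[OF \<delta>_nonzero])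
  show "\<exists>r>0. \<exists>c>0. ball u r \<subseteq> \<Theta> \<and> (\<forall>x\<in>ball u r. c \<le> W x)" if "u \<in> \<Theta>" "\<delta> u \<noteq> 0" for u
    by (rule weight_bounded_below[OF that])
qed (use V_eq kappa_pos open_\<Theta> weight_nonneg polyfun_\<delta> in simp_all)

subsection \<open>Lifting along the basic polynomial map\<close>

text \<open>The weight \<open>W\<close> is made so that the Jacobian factor of the change of variables cancels.\<close>

lemma lift_integral:
  fixes \<Phi> :: "complex^'d \<Rightarrow> 'b::{banach, second_countable_topology}"
  assumes \<Phi>: "\<Phi> \<in> borel_measurable (lebesgue_on \<Theta>)"
  shows "set_integrable V \<Omega> (\<lambda>z. ((cmod (\<l> z))\<^sup>2 * \<omega> z) *\<^sub>R \<Phi> (\<theta> z)) \<longleftrightarrow> set_integrable V \<Theta> (\<lambda>u. W u *\<^sub>R \<Phi> u)"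
    and "(LINT z:\<Omega>|V. ((cmod (\<l> z))\<^sup>2 * \<omega> z) *\<^sub>R \<Phi> (\<theta> z)) = real (card G) *\<^sub>R (LINT u:\<Theta>|V. W u *\<^sub>R \<Phi> u)"
proof -
  let ?L = "\<lambda>z. ((cmod (\<l> z))\<^sup>2 * \<omega> z) *\<^sub>R \<Phi> (\<theta> z)" and ?F = "\<lambda>u. W u *\<^sub>R \<Phi> u"
  have F: "?F \<in> borel_measurable (lebesgue_on \<Theta>)"
    by (rule borel_measurable_scaleR[OF weight_measurable \<Phi>])
  have Ft: "(\<lambda>z. (cmod (J z))\<^sup>2 *\<^sub>R ?F (\<theta> z)) \<in> borel_measurable (lebesgue_on \<Omega>)"
    by (rule borel_measurable_scaleR[OF J_measurable measurable_compose[OF theta_measurable F]])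
  have Lm: "?L \<in> borel_measurable (lebesgue_on \<Omega>)"
    by (intro borel_measurable_scaleR measurable_compose[OF theta_measurable \<Phi>] continuous_imp_lebesgue_on[OF open_\<Omega>]
          continuous_on_mult continuous_on_power continuous_on_norm polyfun_continuous_on[OF polyfun_rep_poly]
          continuous_on_\<omega>)
  obtain w where w: "\<Delta> w \<noteq> 0" using \<Delta>_nonzero by blast
  have n: "{z. \<Delta> z = 0} \<in> null_sets lebesgue"
    using polyfun_zeros_negligible[OF polyfun_\<Delta> w] by (simp add: negligible_iff_null_sets)
  have eq: "?L z = (cmod (J z))\<^sup>2 *\<^sub>R ?F (\<theta> z)" if z: "z \<in> \<Omega>" "\<Delta> z \<noteq> 0" for z
    using \<Delta>_D(1)[OF z(2)] by (simp add: weight_regular[OF z])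
  have "AE z in lebesgue. z \<in> \<Omega> \<longrightarrow> ?L z = (cmod (J z))\<^sup>2 *\<^sub>R ?F (\<theta> z)"
    by (rule AE_I'[OF n]) (use eq in blast)
  moreover have "\<Omega> \<inter> space lebesgue \<in> sets lebesgue" using open_\<Omega> by simp
  ultimately have ae: "AE z in lebesgue_on \<Omega>. ?L z = (cmod (J z))\<^sup>2 *\<^sub>R ?F (\<theta> z)"
    by (simp only: AE_restrict_space_iff)
  have sets: "\<Omega> \<in> sets lebesgue" "\<Theta> \<in> sets lebesgue" using open_\<Omega> open_\<Theta> by auto
  note S = set_integrable_scale_measure[OF kappa_pos sets(1)] set_integrable_scale_measure[OF kappa_pos sets(2)]
  show "set_integrable V \<Omega> ?L \<longleftrightarrow> set_integrable V \<Theta> ?F"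
    unfolding V_eq S integrable_cong_AE[OF Lm Ft ae] change_of_variables_theta(1)[OF F] ..
  show "(LINT z:\<Omega>|V. ?L z) = real (card G) *\<^sub>R (LINT u:\<Theta>|V. ?F u)"
    unfolding V_eq S integral_cong_AE[OF Lm Ft ae] change_of_variables_theta(2)[OF F]
    by (simp add: mult.commute)
qed

abbreviation lift :: "(complex^'d \<Rightarrow> complex) \<Rightarrow> complex^'d \<Rightarrow> complex" where
  "lift h \<equiv> \<lambda>z. \<l> z * h (\<theta> z)"

lemma lift_measurable:
  "h \<in> borel_measurable (lebesgue_on \<Theta>) \<Longrightarrow> lift h \<in> borel_measurable (lebesgue_on \<Omega>)"
  by (intro borel_measurable_times measurable_compose[OF theta_measurable] continuous_imp_lebesgue_on[OF open_\<Omega>]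
        polyfun_continuous_on[OF polyfun_rep_poly])

lemma lift_L2:
  assumes h: "h \<in> borel_measurable (lebesgue_on \<Theta>)"
  shows "lift h \<in> L2 V \<Omega> \<omega> \<longleftrightarrow> h \<in> L2 V \<Theta> W"
proof -
  have "(\<lambda>u. (cmod (h u))\<^sup>2) \<in> borel_measurable (lebesgue_on \<Theta>)"
    using h by measurable
  from lift_integral(1)[OF this]
  have "set_integrable V \<Omega> (\<lambda>z. (cmod (\<l> z * h (\<theta> z)))\<^sup>2 * \<omega> z) \<longleftrightarrow> set_integrable V \<Theta> (\<lambda>u. (cmod (h u))\<^sup>2 * W u)"
    by (simp add: norm_mult power_mult_distrib mult_ac)
  then show ?thesis
    using h lift_measurable[OF h]
    by (simp add: L2_def set_borel_measurable_V_iff open_\<Omega> open_\<Theta>)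
qed

lemma lift_ip:
  assumes h: "h \<in> borel_measurable (lebesgue_on \<Theta>)" "h' \<in> borel_measurable (lebesgue_on \<Theta>)"
  shows "up.ip (lift h) (lift h') = real (card G) * down.ip h h'"
proof -
  have c: "cnj \<in> borel_measurable borel" by (intro borel_measurable_continuous_onI continuous_intros)
  have "(\<lambda>u. h u * cnj (h' u)) \<in> borel_measurable (lebesgue_on \<Theta>)"
    by (intro borel_measurable_times h(1) measurable_compose[OF h(2) c])
  note T = lift_integral(2)[OF this]
  have "up.ip (lift h) (lift h') = (LINT z:\<Omega>|V. ((cmod (\<l> z))\<^sup>2 * \<omega> z) *\<^sub>R (h (\<theta> z) * cnj (h' (\<theta> z))))"
    unfolding up.ip_def scaleR_conv_of_real[where 'a=complex] of_real_mult complex_norm_square complex_cnj_mult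
    by (simp only: mult_ac)
  moreover have "down.ip h h' = (LINT u:\<Theta>|V. W u *\<^sub>R (h u * cnj (h' u)))"
    unfolding down.ip_def scaleR_conv_of_real[where 'a=complex] by (simp only: mult_ac)
  ultimately show ?thesis using T by (simp only: scaleR_conv_of_real)
qed

lemma holomorphic_theta: "holomorphic_map D \<theta>"
  unfolding holomorphic_map_def
proof
  fix z
  have "Vector_Spaces.linear (*s) (*s) ((*v) (Jm z))"
    by (intro clinear_mapI) (simp_all add: matrix_vector_right_distrib vector_scalar_commute)
  then show "\<exists>f'. (\<theta> has_derivative f') (at z) \<and> Vector_Spaces.linear (*s) (*s) f'"
    using theta_has_derivative by blast
qed

lemma holomorphic_lift: "holomorphic_fun \<Theta> h \<Longrightarrow> holomorphic_fun \<Omega> (lift h)"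
  by (rule holomorphic_fun_mult[OF polyfun_holomorphic[OF polyfun_rep_poly]
        holomorphic_fun_compose[OF _ holomorphic_theta]]) auto

lemma lift_A2:
  assumes h: "holomorphic_fun \<Theta> h"
  shows "lift h \<in> A2 V \<Omega> \<omega> \<longleftrightarrow> h \<in> A2 V \<Theta> W"
proof -
  have "h \<in> borel_measurable (lebesgue_on \<Theta>)"
    by (rule continuous_imp_lebesgue_on[OF open_\<Theta> holomorphic_fun_imp_continuous_on[OF h]])
  then show ?thesis using lift_L2 h holomorphic_lift[OF h] by (simp add: A2_def)
qed

lemma L2_imp_measurable: "h \<in> L2 V \<Theta> W \<Longrightarrow> h \<in> borel_measurable (lebesgue_on \<Theta>)"
  by (simp add: L2_def set_borel_measurable_V_iff open_\<Theta>)

lemma A2_imp_measurable: "h \<in> A2 V \<Theta> W \<Longrightarrow> h \<in> borel_measurable (lebesgue_on \<Theta>)"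
  by (simp add: A2_def L2_imp_measurable)

subsection \<open>Averaging over the group\<close>

lemma translate_integral:
  fixes f :: "complex^'d \<Rightarrow> 'b::{banach, second_countable_topology}"
  assumes s: "\<sigma> \<in> G" and f: "set_borel_measurable V \<Omega> f"
  shows "set_integrable V \<Omega> (\<lambda>w. f (\<sigma> *v w)) \<longleftrightarrow> set_integrable V \<Omega> f"
    and "(LINT w:\<Omega>|V. f (\<sigma> *v w)) = (LINT w:\<Omega>|V. f w)"
proof -
  let ?F = "\<lambda>w. indicator \<Omega> w *\<^sub>R f w"
  note d = lebesgue_distr_matrix[OF det_G[OF s]]
  have F: "?F \<in> borel_measurable lebesgue"
    using f unfolding set_borel_measurable_def up.measurable_V .
  have eq: "indicator \<Omega> w *\<^sub>R f (\<sigma> *v w) = ?F (\<sigma> *v w)" for w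
    by (simp add: indicator_def G_\<Omega>_iff[OF s])
  have "integrable (distr lebesgue lebesgue ((*v) \<sigma>)) ?F \<longleftrightarrow> integrable lebesgue (\<lambda>w. ?F (\<sigma> *v w))"
    by (rule integrable_distr_eq[OF d(1) F])
  then show "set_integrable V \<Omega> (\<lambda>w. f (\<sigma> *v w)) \<longleftrightarrow> set_integrable V \<Omega> f"
    unfolding set_integrable_def V_eq integrable_scale_measure[OF kappa_pos] eq d(2) by blast
  have "integral\<^sup>L (distr lebesgue lebesgue ((*v) \<sigma>)) ?F = integral\<^sup>L lebesgue (\<lambda>w. ?F (\<sigma> *v w))"
    by (rule integral_distr[OF d(1) F])
  then show "(LINT w:\<Omega>|V. f (\<sigma> *v w)) = (LINT w:\<Omega>|V. f w)"
    unfolding set_lebesgue_integral_def V_eq integrable_scale_measure(2)[OF kappa_pos] eq d(2) by simp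
qed

lemma A2_translate:
  assumes s: "\<sigma> \<in> G" and k: "k \<in> A2 V \<Omega> \<omega>" shows "(\<lambda>w. k (\<sigma> *v w)) \<in> A2 V \<Omega> \<omega>"
proof (rule up.A2_I)
  have hk: "holomorphic_fun \<Omega> k" using k by (simp add: A2_def)
  show "holomorphic_fun \<Omega> (\<lambda>w. k (\<sigma> *v w))"
    by (rule holomorphic_fun_compose[OF hk holomorphic_map_matrix]) (use G_\<Omega>[OF s] in auto)
  let ?f = "\<lambda>w. (cmod (k w))\<^sup>2 * \<omega> w"
  have f: "set_integrable V \<Omega> ?f" using k by (simp add: A2_def L2_def)
  have "set_borel_measurable V \<Omega> ?f"
    using f unfolding set_integrable_def set_borel_measurable_def by (rule borel_measurable_integrable)
  then show "set_integrable V \<Omega> (\<lambda>w. ?f (\<sigma> *v w))" using translate_integral(1)[OF s] f by blast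
  show "(cmod (k (\<sigma> *v w)))\<^sup>2 * \<omega> w \<le> ?f (\<sigma> *v w)" for w
    by (simp add: theta_invariant[OF s])
qed

lemma ip_translate:
  assumes s: "\<sigma> \<in> G" and f: "f \<in> L2 V \<Omega> \<omega>" and g: "g \<in> L2 V \<Omega> \<omega>"
  shows "up.ip (\<lambda>w. f (\<sigma> *v w)) (\<lambda>w. g (\<sigma> *v w)) = up.ip f g"
proof -
  let ?f = "\<lambda>w. f w * cnj (g w) * complex_of_real (\<omega> w)"
  have "set_borel_measurable V \<Omega> ?f"
    using f g by (intro up.set_measurable_product) (auto simp: L2_def)
  from translate_integral(2)[OF s this] show ?thesis
    by (simp add: up.ip_def theta_invariant[OF s])
qed

text \<open>The projection to the functions that transform by \<open>\<chi>\<^sub>l\<close>.\<close>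

definition average :: "(complex^'d \<Rightarrow> complex) \<Rightarrow> complex^'d \<Rightarrow> complex" where
  "average k w = (\<Sum>\<sigma>\<in>G. (cnj (\<chi>\<^sub>l \<sigma>) / of_nat (card G)) * k (\<sigma> *v w))"

lemma average_A2: "k \<in> A2 V \<Omega> \<omega> \<Longrightarrow> average k \<in> A2 V \<Omega> \<omega>"
  unfolding average_def[abs_def] by (intro up.A2_sum finite_G A2_translate)

lemma char_cnj: "\<sigma> \<in> G \<Longrightarrow> \<chi>\<^sub>l \<sigma> * cnj (\<chi>\<^sub>l \<sigma>) = 1"
  using complex_norm_square[of "\<chi>\<^sub>l \<sigma>"] by (simp add: cmod_char)

lemma average_relative:
  assumes t: "\<tau> \<in> G" shows "average k (\<tau> *v w) = \<chi>\<^sub>l \<tau> * average k w"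
proof -
  let ?n = "of_nat (card G) :: complex"
  have bij: "bij_betw (\<lambda>\<sigma>. \<sigma> ** \<tau>) G G"
  proof (rule bij_betwI[where g = "\<lambda>\<sigma>. \<sigma> ** matrix_inv \<tau>"])
    show "\<sigma> ** \<tau> ** matrix_inv \<tau> = \<sigma>" for \<sigma>
      by (simp add: matrix_mul_assoc[symmetric] inv_right[OF t])
    show "\<sigma> ** matrix_inv \<tau> ** \<tau> = \<sigma>" for \<sigma>
      by (simp add: matrix_mul_assoc[symmetric] inv_left[OF t])
  qed (use t in \<open>auto intro: mult_G inv_G\<close>)
  have "\<chi>\<^sub>l \<tau> * average k w = \<chi>\<^sub>l \<tau> * (\<Sum>\<sigma>\<in>G. (cnj (\<chi>\<^sub>l (\<sigma> ** \<tau>)) / ?n) * k ((\<sigma> ** \<tau>) *v w))"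
    unfolding average_def sum.reindex_bij_betw[OF bij, of "\<lambda>\<sigma>. (cnj (\<chi>\<^sub>l \<sigma>) / ?n) * k (\<sigma> *v w)"] ..
  also have "\<dots> = (\<Sum>\<sigma>\<in>G. (cnj (\<chi>\<^sub>l \<sigma>) / ?n) * k (\<sigma> *v (\<tau> *v w)))"
    unfolding sum_distrib_left
  proof (rule sum.cong)
    fix \<sigma> assume s: "\<sigma> \<in> G"
    have "\<chi>\<^sub>l \<tau> * (cnj (\<chi>\<^sub>l (\<sigma> ** \<tau>)) / ?n * k ((\<sigma> ** \<tau>) *v w))
        = (\<chi>\<^sub>l \<tau> * cnj (\<chi>\<^sub>l \<tau>)) * (cnj (\<chi>\<^sub>l \<sigma>) / ?n * k ((\<sigma> ** \<tau>) *v w))"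
      unfolding char_mult[OF s t] complex_cnj_mult by (simp only: times_divide_eq_left times_divide_eq_right mult_ac)
    also have "\<dots> = cnj (\<chi>\<^sub>l \<sigma>) / ?n * k (\<sigma> *v (\<tau> *v w))"
      by (simp only: char_cnj[OF t] matrix_vector_mul_assoc[symmetric] mult_1_left)
    finally show "\<chi>\<^sub>l \<tau> * (cnj (\<chi>\<^sub>l (\<sigma> ** \<tau>)) / ?n * k ((\<sigma> ** \<tau>) *v w))
        = cnj (\<chi>\<^sub>l \<sigma>) / ?n * k (\<sigma> *v (\<tau> *v w))" .
  qed simp
  also have "\<dots> = average k (\<tau> *v w)" by (simp add: average_def)
  finally show ?thesis by simp
qed

text \<open>A lift transforms by \<open>\<chi>\<^sub>l\<close>, so pairing with it does not distinguish \<open>k\<close> from its projection to the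
  functions that transform by \<open>\<chi>\<^sub>l\<close>.\<close>

lemma ip_average:
  assumes h: "lift h \<in> L2 V \<Omega> \<omega>" and k: "k \<in> A2 V \<Omega> \<omega>"
  shows "up.ip (lift h) (average k) = up.ip (lift h) k"
proof -
  let ?n = "of_nat (card G) :: complex"
  have n: "?n \<noteq> 0" using card_G_pos by simp
  have summand: "\<chi>\<^sub>l \<sigma> * up.ip (lift h) (\<lambda>w. k (\<sigma> *v w)) = up.ip (lift h) k" if s: "\<sigma> \<in> G" for \<sigma>
  proof -
    have "up.ip (lift h) k = up.ip (\<lambda>w. lift h (\<sigma> *v w)) (\<lambda>w. k (\<sigma> *v w))"
      by (rule ip_translate[OF s h up.A2_L2[OF k], symmetric])
    also have "\<dots> = (LINT w:\<Omega>|V. \<chi>\<^sub>l \<sigma> * (\<l> w * h (\<theta> w) * cnj (k (\<sigma> *v w)) * complex_of_real (\<omega> w)))"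
      unfolding up.ip_def by (simp only: char[OF s] theta_invariant[OF s] mult.assoc)
    also have "\<dots> = \<chi>\<^sub>l \<sigma> * up.ip (lift h) (\<lambda>w. k (\<sigma> *v w))"
      unfolding up.ip_def by (rule set_integral_mult_right)
    finally show ?thesis ..
  qed
  have "up.ip (lift h) (average k)
      = (\<Sum>\<sigma>\<in>G. cnj (cnj (\<chi>\<^sub>l \<sigma>) / ?n) * up.ip (lift h) (\<lambda>w. k (\<sigma> *v w)))"
    unfolding average_def[abs_def] by (rule up.ip_sum_right[OF h up.A2_L2[OF A2_translate[OF _ k]]])
  also have "\<dots> = (\<Sum>\<sigma>\<in>G. up.ip (lift h) k / ?n)"
    by (rule sum.cong[OF refl]) (simp add: summand[symmetric])
  also have "\<dots> = up.ip (lift h) k" using n by simp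
  finally show ?thesis .
qed

text \<open>Division by \<open>\<l>\<close> leaves an invariant holomorphic function, which descends to the quotient.\<close>

lemma average_is_lift:
  assumes k: "k \<in> A2 V \<Omega> \<omega>"
  obtains g where "g \<in> A2 V \<Theta> W" "\<And>w. w \<in> \<Omega> \<Longrightarrow> average k w = lift g w"
proof -
  have hol: "holomorphic_fun \<Omega> (average k)" using average_A2[OF k] by (simp add: A2_def)
  obtain q where q: "holomorphic_fun \<Omega> q" "\<And>w. w \<in> \<Omega> \<Longrightarrow> average k w = \<l> w * q w"
    using relative_invariant_divisible[OF open_\<Omega> G_\<Omega> hol average_relative] by blast
  obtain w0 where w0: "\<l> w0 \<noteq> 0" using rep_poly_nonzero by blast
  have inv: "q (\<sigma> *v w) = q w" if s: "\<sigma> \<in> G" and w: "w \<in> \<Omega>" for \<sigma> w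
  proof -
    have "holomorphic_fun \<Omega> (\<lambda>w. q (\<sigma> *v w))"
      by (rule holomorphic_fun_compose[OF q(1) holomorphic_map_matrix]) (use G_\<Omega>[OF s] in auto)
    then have c: "continuous_on \<Omega> (\<lambda>w. q (\<sigma> *v w) - q w)"
      by (intro continuous_on_diff holomorphic_fun_imp_continuous_on q(1))
    have "q (\<sigma> *v w) - q w = 0"
    proof (rule continuous_zero_by_density[OF open_\<Omega> c polyfun_rep_poly w0 _ w])
      fix x assume x: "x \<in> \<Omega>" "\<l> x \<noteq> 0"
      have "\<chi>\<^sub>l \<sigma> * \<l> x * q (\<sigma> *v x) = average k (\<sigma> *v x)"
        using q(2)[OF G_\<Omega>[OF s x(1)]] char[OF s] by simp
      also have "\<dots> = \<chi>\<^sub>l \<sigma> * \<l> x * q x"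
        using q(2)[OF x(1)] average_relative[OF s] by simp
      finally show "q (\<sigma> *v x) - q x = 0" using x(2) cmod_char[OF s] by auto
    qed
    then show ?thesis by simp
  qed
  obtain g where g: "holomorphic_fun \<Theta> g" "\<And>w. w \<in> \<Omega> \<Longrightarrow> g (\<theta> w) = q w"
    using descend_holomorphic[OF q(1) inv] by blast
  have eq: "average k w = lift g w" if "w \<in> \<Omega>" for w using q(2) g(2) that by simp
  have "lift g \<in> A2 V \<Omega> \<omega>"
  proof (rule up.A2_I[OF holomorphic_lift[OF g(1)]])
    show "set_integrable V \<Omega> (\<lambda>w. (cmod (average k w))\<^sup>2 * \<omega> w)"
      using average_A2[OF k] by (simp add: A2_def L2_def)
  qed (simp add: eq)
  then have "g \<in> A2 V \<Theta> W" using lift_A2[OF g(1)] by blast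
  then show thesis using eq that by blast
qed

text \<open>Pairing a lift of \<open>h\<close> with either function gives \<open>\<l> z * h (\<theta> z)\<close>, and an element of the Bergman space of
  the quotient is determined by its pairings.\<close>

lemma kernel_average:
  assumes z: "z \<in> \<Omega>" and w: "w \<in> \<Omega>"
  shows "average (\<lambda>w. bergman_kernel V \<Omega> \<omega> w z) w
    = lift (\<lambda>u. (cnj (\<l> z) / of_nat (card G)) * bergman_kernel V \<Theta> W u (\<theta> z)) w"
proof -
  let ?k = "\<lambda>w. bergman_kernel V \<Omega> \<omega> w z" and ?k' = "\<lambda>u. bergman_kernel V \<Theta> W u (\<theta> z)"
  let ?c = "cnj (\<l> z) / of_nat (card G)"
  have n: "of_nat (card G) \<noteq> (0::complex)" using card_G_pos by simp
  have tz: "\<theta> z \<in> \<Theta>" using z by blast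
  have k: "?k \<in> A2 V \<Omega> \<omega>" by (rule up.kernel_A2[OF z])
  have k': "?k' \<in> A2 V \<Theta> W" by (rule down.kernel_A2[OF tz])
  obtain g where g: "g \<in> A2 V \<Theta> W" "\<And>w. w \<in> \<Omega> \<Longrightarrow> average ?k w = lift g w"
    using average_is_lift[OF k] by blast
  have orth: "down.ip h (\<lambda>u. g u + (- ?c) * ?k' u) = 0" if h: "h \<in> A2 V \<Theta> W" for h
  proof -
    have lh: "lift h \<in> A2 V \<Omega> \<omega>" using h lift_A2[of h] by (simp add: A2_def)
    have "of_nat (card G) * down.ip h g = up.ip (lift h) (lift g)"
      using lift_ip[OF A2_imp_measurable[OF h] A2_imp_measurable[OF g(1)]] by simp
    also have "\<dots> = up.ip (lift h) (average ?k)" by (rule up.ip_cong) (use g(2) in auto)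
    also have "\<dots> = up.ip (lift h) ?k" by (rule ip_average[OF up.A2_L2[OF lh] k])
    also have "\<dots> = \<l> z * h (\<theta> z)" using up.kernel_reproduces[OF lh z] by simp
    also have "h (\<theta> z) = down.ip h ?k'" by (rule down.kernel_reproduces[OF h tz])
    finally have "down.ip h g = \<l> z / of_nat (card G) * down.ip h ?k'" using n by (simp add: field_simps)
    moreover have "down.ip h (\<lambda>u. g u + (- ?c) * ?k' u) = down.ip h g + cnj (- ?c) * down.ip h ?k'"
      by (rule down.ip_add_right[OF g(1) k' h])
    ultimately show ?thesis by simp
  qed
  have "g (\<theta> w) + (- ?c) * ?k' (\<theta> w) = 0"
    by (rule down.A2_orthogonal_imp_zero[OF down.A2_add_smult[OF g(1) k'] orth]) (use w in auto)
  then have "g (\<theta> w) = ?c * ?k' (\<theta> w)" by simp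
  then show ?thesis using g(2)[OF w] by simp
qed

text \<open>The kernel upstairs is replaced by its average, which is the lift of the kernel downstairs, and the
  factor \<open>card G\<close> from the averaging cancels against the one from the change of variables.\<close>

theorem bergman_projection_lift:
  assumes \<phi>: "\<phi> \<in> L2 V \<Theta> W" and z: "z \<in> \<Omega>"
  shows "bergman_projection V \<Omega> \<omega> (lift \<phi>) z = \<l> z * bergman_projection V \<Theta> W \<phi> (\<theta> z)"
proof -
  let ?k = "\<lambda>w. bergman_kernel V \<Omega> \<omega> w z" and ?k' = "\<lambda>u. bergman_kernel V \<Theta> W u (\<theta> z)"
  let ?c = "cnj (\<l> z) / of_nat (card G)"
  have n: "of_nat (card G) \<noteq> (0::complex)" using card_G_pos by simp
  have tz: "\<theta> z \<in> \<Theta>" using z by blast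
  have k: "?k \<in> A2 V \<Omega> \<omega>" by (rule up.kernel_A2[OF z])
  have k': "?k' \<in> A2 V \<Theta> W" by (rule down.kernel_A2[OF tz])
  note m = L2_imp_measurable[OF \<phi>]
  have L: "lift \<phi> \<in> L2 V \<Omega> \<omega>" using lift_L2[OF m] \<phi> by blast
  have "bergman_projection V \<Omega> \<omega> (lift \<phi>) z = up.ip (lift \<phi>) ?k"
    by (rule up.bergman_projection_eq_ip[OF z])
  also have "\<dots> = up.ip (lift \<phi>) (average ?k)" by (rule ip_average[OF L k, symmetric])
  also have "\<dots> = up.ip (lift \<phi>) (lift (\<lambda>u. ?c * ?k' u))"
    by (rule up.ip_cong) (use kernel_average[OF z] in auto)
  also have "\<dots> = of_nat (card G) * down.ip \<phi> (\<lambda>u. ?c * ?k' u)"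
    using lift_ip[OF m A2_imp_measurable[OF down.A2_smult[OF k']], of ?c] by simp
  also have "down.ip \<phi> (\<lambda>u. ?c * ?k' u) = cnj ?c * down.ip \<phi> ?k'"
    using down.ip_sum_right[OF \<phi> down.A2_L2[OF k'], where I = "{()}" and c = "\<lambda>_. ?c"] by simp
  also have "of_nat (card G) * (cnj ?c * down.ip \<phi> ?k') = \<l> z * down.ip \<phi> ?k'" using n by simp
  also have "down.ip \<phi> ?k' = bergman_projection V \<Theta> W \<phi> (\<theta> z)"
    by (rule down.bergman_projection_eq_ip[OF tz, symmetric])
  finally show ?thesis .
qed

end

theorem theorem1p2:
  fixes G :: "(complex^'d^'d) set"
    and \<Omega> :: "(complex^'d) set"
    and \<theta> :: "complex^'d \<Rightarrow> complex^'d"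
    and \<omega>' :: "complex^'d \<Rightarrow> real"
    and \<rho> :: "complex^'d^'d \<Rightarrow> complex"
    and l :: "(complex^'d) set \<Rightarrow> complex^'d \<Rightarrow> complex"
    and a :: "(complex^'d) set \<Rightarrow> complex^'d^'d"
    and \<phi> :: "complex^'d \<Rightarrow> complex"
  defines "V \<equiv> normalized_volume \<Omega>"
    and "\<omega> \<equiv> \<omega>' \<circ> \<theta>"
    and "\<l> \<equiv> rep_poly G l a \<rho>"
    and "\<omega>\<^sub>\<rho> \<equiv> rep_weight G \<Omega> \<theta> (rep_poly G l a \<rho>) \<omega>'"
  assumes "finite_reflection_group G"
    and "domain_set \<Omega>" and "bounded \<Omega>" and "invariant_set G \<Omega>"
    and "basic_polynomial_map G \<theta>"
    and "continuous_on (\<theta> ` \<Omega>) \<omega>'" and "\<And>u. u \<in> \<theta> ` \<Omega> \<Longrightarrow> \<omega>' u > 0"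
    and "one_dim_rep G \<rho>"
    and "defining_forms G l" and "stabilizer_generators G a"
    and "\<phi> \<in> L2 V (\<theta> ` \<Omega>) \<omega>\<^sub>\<rho>"
  shows "(\<lambda>z. \<l> z * \<phi> (\<theta> z)) \<in> L2 V \<Omega> \<omega> \<and>
    (\<forall>z\<in>\<Omega>. bergman_projection V \<Omega> \<omega> (\<lambda>z. \<l> z * \<phi> (\<theta> z)) z
            = \<l> z * bergman_projection V (\<theta> ` \<Omega>) \<omega>\<^sub>\<rho> \<phi> (\<theta> z))"
proof -
  interpret Q: weighted_quotient G \<rho> l a \<Omega> \<theta> \<omega>'
    by unfold_locales (use assms(5-14) in auto)
  have \<phi>: "\<phi> \<in> L2 (normalized_volume \<Omega>) (\<theta> ` \<Omega>) (rep_weight G \<Omega> \<theta> (rep_poly G l a \<rho>) \<omega>')"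
    using assms(15) unfolding V_def \<omega>\<^sub>\<rho>_def .
  show ?thesis
    unfolding V_def \<omega>_def \<l>_def \<omega>\<^sub>\<rho>_def
    using Q.lift_L2[OF Q.L2_imp_measurable[OF \<phi>]] \<phi> Q.bergman_projection_lift[OF \<phi>] by blast
qed

end
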